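(* Let $H:\mathbb{R}^n\to\mathbb{R}$ be convex with $H(0)=\min_{\mathbb{R}^n}H=0$ and such that $\{p:H(p)=0\}$ is bounded and has empty interior. Let $U\subset\mathbb{R}^n$ be open (not necessarily bounded) and assume that $u:U\to\mathbb{R}$ is bounded. Then the following statements are equivalent: (1) $u$ is absolutely subminimizing in $U$ with respect to $H$; (2) $u$ satisfies comparisons with cones from above in $U$; (3) $u$ satisfies the convexity criterion in $U$; (4) $u$ satisfies the pointwise convexity criterion in $U$.
   Context: $V\ll U$ means that $V$ is open and $\bar V$ is a compact subset of $U$. $\mathrm{Lip}_{\mathrm{loc}}(U)$ is the set of functions $U\to\mathbb{R}$ that are Lipschitz continuous on every $V\ll U$; for such $v$, $\|H(Dv)\|_{L^\infty(U)}:=\operatorname{ess\,sup}_{x\in U}H(Dv(x))$ (possibly $\infty$). Absolutely subminimizing: $u\in\mathrm{Lip}_{\mathrm{loc}}(U)$ and, whenever $V\ll U$ and $v\in \mathrm{Lip}_{\mathrm{loc}}(V)\cap C(\bar V)$ satisfy $v=u$ on $\partial V$ and $u\ge v$ in $V$, one has $\|H(Du)\|_{L^\infty(V)}\le\|H(Dv)\|_{L^\infty(V)}$. Cones: for $k\ge0$, $C_k(x):=\max\{p\cdot x:H(p)=k\}$. $u$ satisfies comparisons with cones from above in $U$ if $u:U\to\mathbb{R}$ is upper semicontinuous and $\max_{x\in\bar V}(u(x)-C_k(x-x_0))=\max_{x\in\partial V}(u(x)-C_k(x-x_0))$ whenever $k\ge0$, $V\ll U$ and $x_0\in\mathbb{R}^n\setminus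 V$. Flow: the Lagrangian is $L(q):=\sup_{p\in\mathbb{R}^n}(p\cdot q-H(p))\in[0,\infty]$. For $u:U\to\mathbb{R}$ bounded and $x\in U$, $T^tu(x):=\sup_{y\in U}\left(u(y)-tL\left(\frac{y-x}{t}\right)\right)$ for $t>0$, and $T^0u(x):=u(x)$. Also $S^+u(x):=\limsup_{t\downarrow0}\frac{T^tu(x)-u(x)}{t}$. Convexity criterion in $U$: $u\in C(U)$ is bounded and for every $V\ll U$ there exists $\delta>0$ such that for each $x\in V$ the map $t\mapsto T^tu(x)$ is convex on $[0,\delta]$. Pointwise convexity criterion in $U$: $u\in\mathrm{Lip}_{\mathrm{loc}}(U)$ is bounded, the map $x\mapsto S^+u(x)$ is upper semicontinuous in $U$, and for each $x\in U$ there exists $\delta(x)>0$ such that $t\mapsto T^tu(x)$ is convex on $[0,\delta(x)]$. *)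

theory Defs
  imports "HOL-Analysis.Analysis" "HOL-Probability.Essential_Supremum"
begin

(* A function on an open set U is a total function of which only the values on U matter;
   R^n with n >= 1 is an arbitrary type of class euclidean_space. *)

definition well_inside :: "'a::topological_space set \<Rightarrow> 'a set \<Rightarrow> bool"  (infix "\<lless>" 50)
  where "V \<lless> U \<longleftrightarrow> open V \<and> compact (closure V) \<and> closure V \<subseteq> U"

definition lip_loc :: "'a::metric_space set \<Rightarrow> ('a \<Rightarrow> real) set"
  where "lip_loc U = {v. \<forall>V. V \<lless> U \<longrightarrow> (\<exists>C. C-lipschitz_on V v)}"

(* Used with values in real and in ereal. *)
definition usc_on :: "'a::topological_space set \<Rightarrow> ('a \<Rightarrow> 'b::linorder) \<Rightarrow> bool"
  where "usc_on U f \<longleftrightarrow> (\<forall>c. openin (top_of_set U) {x \<in> U. f x < c})"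

(* Dv is only defined almost everywhere (Rademacher); on the null set where v is not
   differentiable it is given the value 0, which does not affect essential suprema. *)
definition grad :: "('a::euclidean_space \<Rightarrow> real) \<Rightarrow> 'a \<Rightarrow> 'a"
  where "grad v x = (if v differentiable (at x) then (THE D. GDERIV v x :> D) else 0)"

(* The essential supremum is taken with respect to the completed Lebesgue measure, for which
   H (Dv) is measurable. For empty V its value is -\<infinity>. *)
definition H_norm :: "('a::euclidean_space \<Rightarrow> real) \<Rightarrow> 'a set \<Rightarrow> ('a \<Rightarrow> real) \<Rightarrow> ereal"
  where "H_norm H V v = esssup (lebesgue_on V) (\<lambda>x. ereal (H (grad v x)))"

definition absolutely_subminimizing ::
    "('a::euclidean_space \<Rightarrow> real) \<Rightarrow> 'a set \<Rightarrow> ('a \<Rightarrow> real) \<Rightarrow> bool"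
  where "absolutely_subminimizing H U u \<longleftrightarrow>
    u \<in> lip_loc U \<and>
    (\<forall>V v. V \<lless> U \<longrightarrow> v \<in> lip_loc V \<longrightarrow> continuous_on (closure V) v \<longrightarrow>
       (\<forall>x\<in>frontier V. v x = u x) \<longrightarrow> (\<forall>x\<in>V. v x \<le> u x) \<longrightarrow>
       H_norm H V u \<le> H_norm H V v)"

(* The maximum of f over S. It is only meaningful when it is attained, which is the case below:
   the level sets of H are compact and nonempty, and the functions maximised over the closure
   and the frontier of V are upper semicontinuous on compact sets (for empty V both sides of
   the comparison are the same term and the condition is void). *)
definition max_on :: "'a set \<Rightarrow> ('a \<Rightarrow> real) \<Rightarrow> real"
  where "max_on S f = (GREATEST m. m \<in> f ` S)"

definition cone :: "('a::euclidean_space \<Rightarrow> real) \<Rightarrow> real \<Rightarrow> 'a \<Rightarrow> real"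
  where "cone H k x = max_on {p. H p = k} (\<lambda>p. p \<bullet> x)"

definition comparison_with_cones_above ::
    "('a::euclidean_space \<Rightarrow> real) \<Rightarrow> 'a set \<Rightarrow> ('a \<Rightarrow> real) \<Rightarrow> bool"
  where "comparison_with_cones_above H U u \<longleftrightarrow>
    usc_on U u \<and>
    (\<forall>k V x\<^sub>0. 0 \<le> k \<longrightarrow> V \<lless> U \<longrightarrow> x\<^sub>0 \<notin> V \<longrightarrow>
       max_on (closure V) (\<lambda>x. u x - cone H k (x - x\<^sub>0)) =
       max_on (frontier V) (\<lambda>x. u x - cone H k (x - x\<^sub>0)))"

definition lagrangian :: "('a::euclidean_space \<Rightarrow> real) \<Rightarrow> 'a \<Rightarrow> ereal"
  where "lagrangian H q = (SUP p. ereal (p \<bullet> q - H p))"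

(* Only used for t \<ge> 0. *)
definition flow ::
    "('a::euclidean_space \<Rightarrow> real) \<Rightarrow> 'a set \<Rightarrow> real \<Rightarrow> ('a \<Rightarrow> real) \<Rightarrow> 'a \<Rightarrow> ereal"
  where "flow H U t u x =
    (if t = 0 then ereal (u x)
     else (SUP y\<in>U. ereal (u y) - ereal t * lagrangian H ((y - x) /\<^sub>R t)))"

definition S_plus ::
    "('a::euclidean_space \<Rightarrow> real) \<Rightarrow> 'a set \<Rightarrow> ('a \<Rightarrow> real) \<Rightarrow> 'a \<Rightarrow> ereal"
  where "S_plus H U u x =
    Limsup (at_right 0) (\<lambda>t. (flow H U t u x - ereal (u x)) / ereal t)"

(* For bounded u, x in U and H with minimum H 0 = 0 one has u x \<le> flow H U t u x \<le> sup u, so the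
   flow is finite and real_of_ereal below loses nothing. *)

definition convexity_criterion ::
    "('a::euclidean_space \<Rightarrow> real) \<Rightarrow> 'a set \<Rightarrow> ('a \<Rightarrow> real) \<Rightarrow> bool"
  where "convexity_criterion H U u \<longleftrightarrow>
    continuous_on U u \<and> bounded (u ` U) \<and>
    (\<forall>V. V \<lless> U \<longrightarrow>
       (\<exists>\<delta>>0. \<forall>x\<in>V. convex_on {0..\<delta>} (\<lambda>t. real_of_ereal (flow H U t u x))))"

definition pointwise_convexity_criterion ::
    "('a::euclidean_space \<Rightarrow> real) \<Rightarrow> 'a set \<Rightarrow> ('a \<Rightarrow> real) \<Rightarrow> bool"
  where "pointwise_convexity_criterion H U u \<longleftrightarrow>
    u \<in> lip_loc U \<and> bounded (u ` U) \<and> usc_on U (S_plus H U u) \<and>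
    (\<forall>x\<in>U. \<exists>\<delta>>0. convex_on {0..\<delta>} (\<lambda>t. real_of_ereal (flow H U t u x)))"

end

theory Submission
  imports Defs
begin

text \<open>The statements are proved in a cycle: (1) implies (2) implies (3) implies (4) implies (1).

  For (1) to (2), where comparison with \<open>C\<^sub>k\<close> fails, \<open>u\<close> competes with the cone itself; minimality
  gives \<open>H(Du) \<le> k\<close>, hence \<open>u(y) - u(x) \<le> C\<^sub>k(y - x)\<close> along segments, and following the ray towards
  the vertex of the cone yields a contradiction. Passing from the gradient bound to increments is
  where Rademacher's theorem is needed.

  For (2) to (3), \<open>L(q) = sup\<^sub>k (C\<^sub>k(q) - k)\<close>. The chord of \<open>t \<mapsto> T\<^sup>tu(x)\<close> over \<open>[a, b]\<close> has some
  slope \<open>k \<ge> 0\<close>, and comparing \<open>u\<close> with \<open>C\<^sub>k(\<cdot> - x)\<close> on the region reached at slope \<open>k\<close> in times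
  between \<open>a\<close> and \<open>b\<close> shows that the flow stays below the chord.

  For (4) to (1), let \<open>v\<close> be a competitor with \<open>H(Dv) \<le> k\<close>, suppose that \<open>H(Du) > \<kappa> > k\<close> somewhere,
  and maximize \<open>u - v\<close> over the compact set of points of the closure with \<open>S\<^sup>+u \<ge> \<kappa>\<close>. From any such
  interior point there is another one, uphill, along which \<open>u\<close> grows by at least \<open>C\<^sub>\<kappa>\<close> and \<open>v\<close> by at
  most \<open>C\<^sub>k\<close>. So the maximum is positive and not attained in the interior, while \<open>u = v\<close> on the
  boundary.\<close>

section \<open>Lipschitz functions on the line\<close>

text \<open>Gradient bounds hold only almost everywhere, whereas cones control increments along
  single segments, which are null sets. The bridge is Fubini: almost every translate of a segment
  meets a given null set in a null set of parameters, and continuity carries an excessive increment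
  over to nearby translates.

  All information on \<open>H\<close> passes through the duality between C_k and L. The bounded zero
  set yields linear growth of \<open>H\<close>; hence sublevel sets are compact, C_k increases
  strictly with k, and L is bounded near 0. Finiteness of \<open>H\<close> makes L superlinear, so
  for small times only nearby points matter, even if \<open>U\<close> is unbounded. As L may be
  infinite, the flow is handled through the inequality t L(z/t) \<le> c for pairs (z, c) instead of
  values of L.

  Upper semicontinuity of S^+ does two jobs in (4) to (1): it makes the set of points of large slope
  compact, and it transfers a slope from points approaching the end of an uphill step to that end
  itself. It holds under (3) because \<delta> is uniform there: S^+ is locally an infimum of
  difference quotients at fixed times, each continuous in x.\<close>

lemma lipschitz_density:
  fixes \<phi> :: "real \<Rightarrow> real"
  assumes "L-lipschitz_on UNIV \<phi>"
  obtains f where "\<And>a b. a \<le> b \<Longrightarrow> (f has_integral (\<phi> b - \<phi> a)) {a..b}"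
proof -
  \<comment> \<open>The added slope makes \<open>F\<close> increase at rate at least 1, so it is a
    bijection of the line with a 1-Lipschitz inverse, while \<open>F\<close> itself stays
    Lipschitz.\<close>
  define F where "F x = \<phi> x + (L + 1) * x" for x
  have L: "0 \<le> L" using assms by (rule lipschitz_on_nonneg)
  have lip: "\<bar>\<phi> x - \<phi> y\<bar> \<le> L * \<bar>x - y\<bar>" for x y
    using lipschitz_onD[OF assms, of x y] by (simp add: dist_real_def)
  have expand: "y - x \<le> F y - F x" if "x \<le> y" for x y
    using lip[of x y] that by (auto simp: F_def abs_if algebra_simps split: if_splits)
  have F_lip: "\<bar>F x - F y\<bar> \<le> (2 * L + 1) * \<bar>x - y\<bar>" for x y
  proof -
    have "\<bar>F x - F y\<bar> = \<bar>(\<phi> x - \<phi> y) + (L + 1) * (x - y)\<bar>"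
      by (simp add: F_def algebra_simps)
    also have "\<dots> \<le> \<bar>\<phi> x - \<phi> y\<bar> + \<bar>(L + 1) * (x - y)\<bar>"
      by (rule abs_triangle_ineq)
    also have "\<bar>(L + 1) * (x - y)\<bar> = (L + 1) * \<bar>x - y\<bar>"
      using L by (simp add: abs_mult)
    finally show ?thesis using lip[of x y] by (simp add: algebra_simps)
  qed
  have sm: "strict_mono F"
    by (rule strict_monoI) (smt (verit) expand)
  have contF: "continuous_on A F" for A
    using lipschitz_on_continuous_on[OF assms] continuous_on_subset
    unfolding F_def by (fastforce intro!: continuous_intros)
  have "\<exists>x. F x = y" for y
  proof -
    define r where "r = \<bar>y\<bar> + \<bar>F 0\<bar> + 1"
    have "F (- r) \<le> y" "y \<le> F r"
      using expand[of "- r" 0] expand[of 0 r] unfolding r_def by linarith+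
    then show ?thesis
      using IVT'[of F "-r" y r, OF _ _ _ contF] by (auto simp: r_def)
  qed
  then have bijF: "bij F"
    using strict_mono_imp_inj_on[OF sm] by (metis bijI surjI)
  define Fi where "Fi = inv F"
  have Fi: "Fi (F x) = x" "F (Fi y) = y" for x y
    using bijF unfolding Fi_def by (auto simp: bij_def surj_f_inv_f)
  have "1-lipschitz_on UNIV Fi"
  proof (rule lipschitz_onI)
    show "dist (Fi x) (Fi y) \<le> 1 * dist x y" for x y
      using expand[of "Fi x" "Fi y"] expand[of "Fi y" "Fi x"]
      by (cases "Fi x \<le> Fi y") (auto simp: Fi dist_real_def)
  qed simp
  then have meas[measurable]: "Fi \<in> borel_measurable borel"
    by (intro borel_measurable_continuous_onI lipschitz_on_continuous_on)
  have vimage: "Fi -` A = F ` A" for A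
    using Fi by (auto simp: image_iff) metis
  \<comment> \<open>The Stieltjes measure of \<open>F\<close>, written as the image of Lebesgue
    measure under the inverse. It is absolutely continuous because Lipschitz maps send null sets to
    null sets; its Radon-Nikodym density is the derivative sought.\<close>
  define M where "M = distr lborel borel Fi"
  have M_Icc: "emeasure M {a..b} = ennreal (F b - F a)" if "a \<le> b" for a b
  proof -
    have "F ` {a..b} = {F a..F b}"
    proof -
      have "F x \<in> {F a..F b}" if "x \<in> {a..b}" for x
        using that sm by (simp add: strict_mono_less_eq)
      moreover have "y \<in> F ` {a..b}" if "y \<in> {F a..F b}" for y
        using that sm Fi(2)[of y] by (metis atLeastAtMost_iff image_eqI strict_mono_less_eq)
      ultimately show ?thesis by blast
    qed
    then show ?thesis
      using sm \<open>a \<le> b\<close>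
      by (simp add: M_def emeasure_distr vimage strict_mono_less_eq)
  qed
  have "absolutely_continuous lborel M"
    unfolding absolutely_continuous_def
  proof
    fix N :: "real set" assume N: "N \<in> null_sets lborel"
    have "negligible (F ` N)"
    proof (rule negligible_locally_Lipschitz_image[OF order_refl])
      show "negligible N"
        using N by (simp add: negligible_iff_null_sets null_sets_completionI)
      show "\<exists>T B. open T \<and> x \<in> T \<and> (\<forall>y\<in>N \<inter> T. norm (F y - F x) \<le> B * norm (y - x))" for x
        using F_lip by (intro exI[of _ UNIV] exI[of _ "2 * L + 1"]) auto
    qed
    moreover have "F ` N \<in> sets borel"
      using N measurable_sets_borel[OF meas, of N] by (simp add: vimage null_sets_def)
    ultimately have "emeasure lborel (F ` N) = 0"
      by (auto simp: negligible_iff_null_sets null_sets_completion_iff)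
    then show "N \<in> null_sets M"
      using N by (auto simp: M_def null_sets_def emeasure_distr vimage)
  qed
  then obtain f where f[measurable]: "f \<in> borel_measurable lborel" and dens: "density lborel f = M"
    using sigma_finite_measure.Radon_Nikodym[OF sigma_finite_lborel, of M] by (auto simp: M_def)
  have int_f: "(\<integral>\<^sup>+x. f x * indicator {a..b} x \<partial>lborel) = ennreal (F b - F a)" if "a \<le> b" for a b
    using M_Icc[OF that] by (simp add: dens[symmetric] emeasure_density)
  have fin: "AE x in lborel. f x * indicator {a..b} x \<noteq> \<infinity>" if "a \<le> b" for a b
    by (rule nn_integral_PInf_AE) (use int_f[OF that] in auto)
  have g_int: "((\<lambda>x. enn2real (f x)) has_integral (F b - F a)) {a..b}" if "a \<le> b" for a b
  proof -
    have ae: "AE x in lborel. ennreal (enn2real (f x) * indicator {a..b} x) = f x * indicator {a..b} x"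
      using fin[OF that] by eventually_elim (auto simp: indicator_def less_top split: if_splits)
    have "(\<integral>\<^sup>+x. ennreal (enn2real (f x) * indicator {a..b} x) \<partial>lborel) = ennreal (F b - F a)"
      using nn_integral_cong_AE[OF ae] int_f[OF that] by simp
    then have "((\<lambda>x. enn2real (f x) * indicator {a..b} x) has_integral (F b - F a)) UNIV"
      by (intro nn_integral_has_integral) (use that expand[OF that] in auto)
    then have "((\<lambda>x. if x \<in> {a..b} then enn2real (f x) else 0) has_integral (F b - F a)) UNIV"
      by (rule has_integral_eq[rotated]) (auto simp: indicator_def)
    then show ?thesis
      by (simp only: has_integral_restrict_UNIV)
  qed
  have "((\<lambda>x. enn2real (f x) - (L + 1)) has_integral (\<phi> b - \<phi> a)) {a..b}" if "a \<le> b" for a b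
  proof -
    have "((\<lambda>x. enn2real (f x) - (L + 1)) has_integral (F b - F a) - (L + 1) * (b - a)) {a..b}"
      using has_integral_diff[OF g_int[OF that] has_integral_const_real[of "L + 1" a b]] that
      by (simp add: mult.commute)
    then show ?thesis by (simp add: F_def algebra_simps)
  qed
  then show thesis by (rule that)
qed

text \<open>Lebesgue differentiation of the density over the intervals [x, x + h]. These lie to the
  right of x, hence a right derivative, and one-sided limits suffice throughout.\<close>

lemma lipschitz_right_derivative:
  fixes \<phi> :: "real \<Rightarrow> real"
  assumes "L-lipschitz_on UNIV \<phi>"
  obtains f N where "\<And>a b. a \<le> b \<Longrightarrow> (f has_integral (\<phi> b - \<phi> a)) {a..b}"
    and "negligible N"
    and "\<And>x. x \<notin> N \<Longrightarrow> ((\<lambda>h. (\<phi> (x + h) - \<phi> x) / h) \<longlongrightarrow> f x) (at_right 0)"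
proof -
  obtain f where f: "\<And>a b. a \<le> b \<Longrightarrow> (f has_integral (\<phi> b - \<phi> a)) {a..b}"
    using lipschitz_density[OF assms] by blast
  have "f integrable_on cbox a b" for a b
    using f[of a b] by (cases "a \<le> b") (auto simp: integrable_on_def)
  then obtain N where N: "negligible N"
    "\<And>x e. \<lbrakk>x \<notin> N; 0 < e\<rbrakk> \<Longrightarrow> \<exists>d>0. \<forall>h. 0 < h \<and> h < d \<longrightarrow>
       norm (integral (cbox x (x + h *\<^sub>R One)) f /\<^sub>R h ^ DIM(real) - f x) < e"
    using integrable_ccontinuous_explicit[of f] by blast
  have "((\<lambda>h. (\<phi> (x + h) - \<phi> x) / h) \<longlongrightarrow> f x) (at_right 0)" if x: "x \<notin> N" for x
  proof (rule tendstoI)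
    fix e :: real assume "0 < e"
    then obtain d where "d > 0" and d: "\<And>h. 0 < h \<Longrightarrow> h < d \<Longrightarrow>
        norm (integral (cbox x (x + h *\<^sub>R One)) f /\<^sub>R h ^ DIM(real) - f x) < e"
      using N(2)[OF x] by blast
    have "dist ((\<phi> (x + h) - \<phi> x) / h) (f x) < e" if h: "0 < h" "h < d" for h
    proof -
      have "integral {x..x + h} f = \<phi> (x + h) - \<phi> x"
        using f[of x "x + h"] h by (intro integral_unique) auto
      then show ?thesis using d[OF h] by (simp add: dist_real_def divide_inverse mult.commute)
    qed
    then show "\<forall>\<^sub>F h in at_right 0. dist ((\<phi> (x + h) - \<phi> x) / h) (f x) < e"
      using \<open>d > 0\<close> by (auto simp: eventually_at_right intro!: exI[of _ d])
  qed
  then show thesis using that f N(1) by blast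
qed

text \<open>The Cantor function shows that this fails for merely continuous functions. Here the
  increment is the integral of a density, which may be redefined as \<open>c\<close> on the
  exceptional null set.\<close>

lemma lipschitz_mean_value_AE:
  fixes \<phi> :: "real \<Rightarrow> real"
  assumes "L-lipschitz_on UNIV \<phi>" "negligible N" "a \<le> b"
    and "\<And>x l. x \<in> {a..b} - N \<Longrightarrow> ((\<lambda>h. (\<phi> (x + h) - \<phi> x) / h) \<longlongrightarrow> l) (at_right 0) \<Longrightarrow> l \<le> c"
  shows "\<phi> b - \<phi> a \<le> c * (b - a)"
proof -
  obtain f N' where f: "\<And>a b. a \<le> b \<Longrightarrow> (f has_integral (\<phi> b - \<phi> a)) {a..b}"
    and N': "negligible N'"
    and d: "\<And>x. x \<notin> N' \<Longrightarrow> ((\<lambda>h. (\<phi> (x + h) - \<phi> x) / h) \<longlongrightarrow> f x) (at_right 0)"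
    using lipschitz_right_derivative[OF assms(1)] by blast
  define f' where "f' x = (if x \<in> N \<union> N' then c else f x)" for x
  have "(f' has_integral (\<phi> b - \<phi> a)) {a..b}"
    by (rule has_integral_spike[OF negligible_Un[OF assms(2) N'] _ f[OF \<open>a \<le> b\<close>]]) (auto simp: f'_def)
  moreover have "((\<lambda>x. c) has_integral (b - a) *\<^sub>R c) {a..b}"
    using has_integral_const_real[of c a b] \<open>a \<le> b\<close> by simp
  ultimately have "\<phi> b - \<phi> a \<le> (b - a) *\<^sub>R c"
    by (rule has_integral_le) (use assms(4) d in \<open>auto simp: f'_def\<close>)
  then show ?thesis by (simp add: mult.commute)
qed

section \<open>Null sets and families of parallel lines\<close>

lemma AE_translate:
  fixes A :: "'a::euclidean_space set"
  assumes "A \<in> sets borel"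
  shows "(AE x in lborel. x + c \<notin> A) \<longleftrightarrow> (AE x in lborel. x \<notin> A)"
proof -
  have "(AE x in lborel. x \<notin> A) \<longleftrightarrow> (AE x in distr lborel borel ((+) c). x \<notin> A)"
    by (subst lborel_distr_plus) (rule refl)
  also have "\<dots> \<longleftrightarrow> (AE x in lborel. c + x \<notin> A)"
    using assms by (subst AE_distr_iff) (auto intro: sets.sets_Collect_neg)
  finally show ?thesis by (simp add: add.commute)
qed

text \<open>After exchanging the quantifiers by Fubini, each fixed t asks about a translate of
  \<open>A\<close>, and translation preserves null sets. Rademacher's theorem passes from lines to
  space, the estimate along segments from space to lines.\<close>

lemma AE_lines_iff:
  fixes A :: "'a::euclidean_space set"
  assumes "A \<in> sets borel"
  shows "(AE x in lborel. AE t in lborel. x + t *\<^sub>R e \<notin> A) \<longleftrightarrow> (AE x in lborel. x \<notin> A)"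
proof -
  have [measurable]: "A \<in> sets borel" by fact
  have "(AE x in lborel. AE t in lborel. x + t *\<^sub>R e \<notin> A) \<longleftrightarrow>
      (AE t in (lborel :: real measure). AE x in lborel. x + t *\<^sub>R e \<notin> A)"
    by (rule lborel_pair.AE_commute) measurable
  also have "\<dots> \<longleftrightarrow> (AE t in (lborel :: real measure). AE x in lborel. x \<notin> A)"
    by (simp add: AE_translate[OF assms])
  also have "\<dots> \<longleftrightarrow> (AE x in lborel. x \<notin> A)"
    by (simp add: eventually_const_iff ae_filter_eq_bot_iff)
  finally show ?thesis .
qed

section \<open>Directional derivatives of Lipschitz functions\<close>

text \<open>Almost everywhere \<open>h x\<close> is the limit of its averages over small cubes, and
  these all vanish.\<close>

lemma AE_zero_if_integrals_zero:
  fixes h :: "'a::euclidean_space \<Rightarrow> real"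
  assumes "\<And>a b. (h has_integral 0) (cbox a b)"
  obtains N where "negligible N" "\<And>x. x \<notin> N \<Longrightarrow> h x = 0"
proof -
  have "\<And>a b. h integrable_on cbox a b" using assms by (auto simp: integrable_on_def)
  then obtain N where N: "negligible N"
    "\<And>x e. \<lbrakk>x \<notin> N; 0 < e\<rbrakk> \<Longrightarrow> \<exists>d>0. \<forall>k. 0 < k \<and> k < d \<longrightarrow>
       norm (integral (cbox x (x + k *\<^sub>R One)) h /\<^sub>R k ^ DIM('a) - h x) < e"
    using integrable_ccontinuous_explicit[of h] by blast
  have "h x = 0" if "x \<notin> N" for x
  proof (rule ccontr)
    assume "h x \<noteq> 0"
    with N(2)[OF that, of "\<bar>h x\<bar>"] obtain d where "d > 0" and
      "\<And>k. 0 < k \<and> k < d \<Longrightarrow> norm (integral (cbox x (x + k *\<^sub>R One)) h /\<^sub>R k ^ DIM('a) - h x) < \<bar>h x\<bar>"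
      by auto
    from this(2)[of "d/2"] \<open>d > 0\<close> show False
      using integral_unique[OF assms[of x "x + (d/2) *\<^sub>R One"]] by simp
  qed
  with N(1) that show thesis by blast
qed

text \<open>One-sided, so positive multiples of \<open>e\<close> come for free while negative ones
  have to be derived from additivity.\<close>

definition has_dir_deriv :: "('a::real_normed_vector \<Rightarrow> real) \<Rightarrow> 'a \<Rightarrow> 'a \<Rightarrow> real \<Rightarrow> bool"
  where "has_dir_deriv v e x l \<longleftrightarrow> ((\<lambda>t. (v (x + t *\<^sub>R e) - v x) / t) \<longlongrightarrow> l) (at_right 0)"

definition diff_quot :: "('a::real_normed_vector \<Rightarrow> real) \<Rightarrow> 'a \<Rightarrow> nat \<Rightarrow> 'a \<Rightarrow> real"
  where "diff_quot v e n x = real (Suc n) * (v (x + inverse (real (Suc n)) *\<^sub>R e) - v x)"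

text \<open>A limit along a fixed sequence, which makes the function total and Borel measurable. Its
  value is meaningful only where \<open>has_dir_deriv\<close> holds.\<close>

definition dir_deriv :: "('a::real_normed_vector \<Rightarrow> real) \<Rightarrow> 'a \<Rightarrow> 'a \<Rightarrow> real"
  where "dir_deriv v e x = lim (\<lambda>n. diff_quot v e n x)"

lemma filterlim_inverse_Suc_at_right: "filterlim (\<lambda>n. inverse (real (Suc n))) (at_right 0) sequentially"
  by (rule tendsto_imp_filterlim_at_right[OF LIMSEQ_inverse_real_of_nat]) simp

lemma at_right_zeroE:
  assumes "\<forall>\<^sub>F t in at_right (0::real). P t"
  obtains d where "0 < d" "\<And>t. 0 < t \<Longrightarrow> t < d \<Longrightarrow> P t"
  using assms unfolding eventually_at_right_field by blast

lemma has_dir_deriv_tendsto: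
  assumes "has_dir_deriv v e x l"
  shows "(\<lambda>n. diff_quot v e n x) \<longlonglongrightarrow> l"
  using filterlim_compose[OF assms[unfolded has_dir_deriv_def] filterlim_inverse_Suc_at_right]
  by (simp add: diff_quot_def divide_inverse mult.commute)

lemma has_dir_deriv_imp_eq: "has_dir_deriv v e x l \<Longrightarrow> dir_deriv v e x = l"
  unfolding dir_deriv_def by (rule limI[OF has_dir_deriv_tendsto])

lemma has_dir_deriv_scale:
  assumes "has_dir_deriv v e x l" "0 < c"
  shows "has_dir_deriv v (c *\<^sub>R e) x (c * l)"
proof -
  have "filterlim (\<lambda>t. t * c) (at_right 0) (at_right 0)"
  proof (rule tendsto_imp_filterlim_at_right)
    show "((\<lambda>t. t * c) \<longlongrightarrow> 0) (at_right 0)" by (rule tendsto_mult_left_zero) (rule tendsto_ident_at)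
    show "\<forall>\<^sub>F t in at_right 0. t * c > 0"
      using assms(2) unfolding eventually_at_right_field by (intro exI[of _ 1]) simp
  qed
  from tendsto_mult_left[OF filterlim_compose[OF assms(1)[unfolded has_dir_deriv_def] this], of c]
  show ?thesis using assms(2) by (simp add: has_dir_deriv_def mult.commute)
qed

lemma has_dir_deriv_zero: "has_dir_deriv v 0 x 0"
  by (simp add: has_dir_deriv_def)

lemma abs_diff_quot_le:
  assumes "L-lipschitz_on UNIV v"
  shows "\<bar>diff_quot v e n x\<bar> \<le> L * norm e"
proof -
  have "\<bar>v (x + inverse (real (Suc n)) *\<^sub>R e) - v x\<bar> \<le> L * (inverse (real (Suc n)) * norm e)"
    using lipschitz_onD[OF assms, of "x + inverse (real (Suc n)) *\<^sub>R e" x]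
    by (simp add: dist_norm)
  then have "real (Suc n) * \<bar>v (x + inverse (real (Suc n)) *\<^sub>R e) - v x\<bar>
      \<le> real (Suc n) * (L * (inverse (real (Suc n)) * norm e))"
    by (rule mult_left_mono) simp
  also have "\<dots> = L * norm e" by (simp add: field_simps)
  finally show ?thesis by (simp add: diff_quot_def abs_mult)
qed

lemma borel_measurable_lipschitz:
  fixes v :: "'a::metric_space \<Rightarrow> real"
  assumes "L-lipschitz_on UNIV v"
  shows "v \<in> borel_measurable borel"
  by (intro borel_measurable_continuous_onI lipschitz_on_continuous_on[OF assms])

lemma borel_measurable_diff_quot [measurable]:
  fixes v :: "'a::euclidean_space \<Rightarrow> real"
  assumes [measurable]: "v \<in> borel_measurable borel"
  shows "diff_quot v e n \<in> borel_measurable borel"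
  unfolding diff_quot_def by measurable

lemma borel_measurable_dir_deriv [measurable]:
  fixes v :: "'a::euclidean_space \<Rightarrow> real"
  assumes [measurable]: "v \<in> borel_measurable borel"
  shows "dir_deriv v e \<in> borel_measurable borel"
  unfolding dir_deriv_def by measurable

lemma lipschitz_on_line:
  fixes v :: "'a::real_normed_vector \<Rightarrow> real"
  assumes "L-lipschitz_on UNIV v"
  shows "(L * norm e)-lipschitz_on UNIV (\<lambda>t::real. v (x + t *\<^sub>R e))"
proof (rule lipschitz_onI)
  show "dist (v (x + s *\<^sub>R e)) (v (x + t *\<^sub>R e)) \<le> L * norm e * dist s t" for s t
    using lipschitz_onD[OF assms, of "x + s *\<^sub>R e" "x + t *\<^sub>R e"]
    by (simp add: dist_norm scaleR_diff_left[symmetric] mult_ac)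
  show "0 \<le> L * norm e" using lipschitz_on_nonneg[OF assms] by simp
qed

lemma Cauchy_imp_at_right_limit:
  fixes q :: "real \<Rightarrow> real"
  assumes "\<And>e. e > 0 \<Longrightarrow> \<exists>d>0. \<forall>s\<in>{0<..<d}. \<forall>t\<in>{0<..<d}. \<bar>q s - q t\<bar> \<le> e"
  shows "\<exists>l. (q \<longlongrightarrow> l) (at_right 0)"
proof -
  have small: "\<forall>\<^sub>F n in sequentially. inverse (real (Suc n)) \<in> {0<..<d}" if "d > 0" for d
    using order_tendstoD(2)[OF LIMSEQ_inverse_real_of_nat that] by eventually_elim simp
  have "Cauchy (\<lambda>n. q (inverse (real (Suc n))))"
  proof (rule metric_CauchyI)
    fix e :: real assume "e > 0"
    then obtain d where "d > 0" and d: "\<And>s t. s \<in> {0<..<d} \<Longrightarrow> t \<in> {0<..<d} \<Longrightarrow> \<bar>q s - q t\<bar> \<le> e / 2"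
      using assms[of "e / 2"] by auto
    obtain M where "\<And>n. n \<ge> M \<Longrightarrow> inverse (real (Suc n)) \<in> {0<..<d}"
      using small[OF \<open>d > 0\<close>] by (auto simp: eventually_sequentially)
    then show "\<exists>M. \<forall>m\<ge>M. \<forall>n\<ge>M. dist (q (inverse (real (Suc m)))) (q (inverse (real (Suc n)))) < e"
      using d \<open>e > 0\<close> by (intro exI[of _ M]) (fastforce simp: dist_real_def)
  qed
  then obtain l where l: "(\<lambda>n. q (inverse (real (Suc n)))) \<longlonglongrightarrow> l"
    by (auto simp: Cauchy_convergent_iff convergent_def)
  have "(q \<longlongrightarrow> l) (at_right 0)"
  proof (rule tendstoI)
    fix e :: real assume "e > 0"
    then obtain d where "d > 0" and d: "\<And>s t. s \<in> {0<..<d} \<Longrightarrow> t \<in> {0<..<d} \<Longrightarrow> \<bar>q s - q t\<bar> \<le> e / 2"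
      using assms[of "e / 2"] by auto
    have *: "\<bar>q s - l\<bar> \<le> e / 2" if s: "s \<in> {0<..<d}" for s
    proof (rule tendsto_upperbound)
      show "(\<lambda>n. \<bar>q s - q (inverse (real (Suc n)))\<bar>) \<longlonglongrightarrow> \<bar>q s - l\<bar>"
        by (intro tendsto_intros l)
      show "\<forall>\<^sub>F n in sequentially. \<bar>q s - q (inverse (real (Suc n)))\<bar> \<le> e / 2"
        using small[OF \<open>d > 0\<close>] by eventually_elim (use d s in auto)
    qed simp
    have "dist (q s) l < e" if "0 < s" "s < d" for s
      using *[of s] that \<open>e > 0\<close> unfolding dist_real_def by simp
    then show "\<forall>\<^sub>F s in at_right 0. dist (q s) l < e"
      using \<open>d > 0\<close> unfolding eventually_at_right_field by blast
  qed
  then show ?thesis by blast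
qed

text \<open>On every line in direction \<open>e\<close> the function is Lipschitz in one variable
  and has a right derivative almost everywhere. Fubini then applies, provided that the set of good
  points is Borel.\<close>

lemma AE_has_dir_deriv:
  fixes v :: "'a::euclidean_space \<Rightarrow> real"
  assumes lip: "L-lipschitz_on UNIV v"
  shows "AE x in lborel. has_dir_deriv v e x (dir_deriv v e x)"
proof -
  define q where "q t x = (v (x + t *\<^sub>R e) - v x) / t" for t x
  \<comment> \<open>A quantitative Cauchy condition over all real s and t. By continuity each
    \<open>E m n\<close> is an intersection of closed sets, however uncountable, so
    \<open>G\<close>, the set of convergence, is Borel.\<close>
  define E where "E m n = {x. \<forall>s\<in>{0<..<inverse (real (Suc n))}. \<forall>t\<in>{0<..<inverse (real (Suc n))}.
     \<bar>q s x - q t x\<bar> \<le> inverse (real (Suc m))}" for m n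
  define G where "G = (\<Inter>m. \<Union>n. E m n)"
  have contv: "continuous_on A v" for A
    using lipschitz_on_continuous_on[OF lip] continuous_on_subset by blast
  have contq: "continuous_on UNIV (q t)" if "t > 0" for t
    using that unfolding q_def
    by (intro continuous_intros continuous_on_compose2[OF contv]) auto
  have "closed (E m n)" for m n
  proof -
    have "E m n = (\<Inter>s\<in>{0<..<inverse (real (Suc n))}. \<Inter>t\<in>{0<..<inverse (real (Suc n))}.
       {x. \<bar>q s x - q t x\<bar> \<le> inverse (real (Suc m))})"
      by (auto simp: E_def)
    then show ?thesis
      by (auto intro!: closed_INT closed_Collect_le continuous_intros continuous_on_compose2[OF contq])
  qed
  then have G[measurable]: "G \<in> sets borel"
    unfolding G_def by (intro sets.countable_INT sets.countable_UN) auto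
  have lim: "has_dir_deriv v e x (dir_deriv v e x)" if x: "x \<in> G" for x
  proof -
    have "\<exists>l. ((\<lambda>t. q t x) \<longlongrightarrow> l) (at_right 0)"
    proof (rule Cauchy_imp_at_right_limit)
      fix \<epsilon> :: real assume "\<epsilon> > 0"
      then obtain m where m: "inverse (real (Suc m)) < \<epsilon>"
        using reals_Archimedean by blast
      obtain n where "x \<in> E m n" using x unfolding G_def by blast
      then have "\<forall>s\<in>{0<..<inverse (real (Suc n))}. \<forall>t\<in>{0<..<inverse (real (Suc n))}. \<bar>q s x - q t x\<bar> \<le> \<epsilon>"
      proof (intro ballI)
        fix s t assume st: "s \<in> {0<..<inverse (real (Suc n))}" "t \<in> {0<..<inverse (real (Suc n))}"
        with \<open>x \<in> E m n\<close> have "\<bar>q s x - q t x\<bar> \<le> inverse (real (Suc m))"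
          unfolding E_def by blast
        then show "\<bar>q s x - q t x\<bar> \<le> \<epsilon>" using m by linarith
      qed
      then show "\<exists>d>0. \<forall>s\<in>{0<..<d}. \<forall>t\<in>{0<..<d}. \<bar>q s x - q t x\<bar> \<le> \<epsilon>"
        by (metis inverse_positive_iff_positive of_nat_0_less_iff zero_less_Suc)
    qed
    then show ?thesis
      using has_dir_deriv_imp_eq unfolding has_dir_deriv_def q_def by metis
  qed
  have conv: "x \<in> G" if "(( \<lambda>t. q t x) \<longlongrightarrow> l) (at_right 0)" for x l
  proof -
    have "\<exists>n. x \<in> E m n" for m
    proof -
      have "\<forall>\<^sub>F t in at_right 0. dist (q t x) l < inverse (real (Suc m)) / 2"
        by (rule tendstoD[OF that]) simp
      then obtain d where "d > 0" and d: "\<And>t. 0 < t \<Longrightarrow> t < d \<Longrightarrow> \<bar>q t x - l\<bar> < inverse (real (Suc m)) / 2"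
        unfolding eventually_at_right_field dist_real_def by metis
      obtain n where n: "inverse (real (Suc n)) < d"
        using reals_Archimedean[OF \<open>d > 0\<close>] by blast
      have "\<bar>q s x - q t x\<bar> \<le> inverse (real (Suc m))"
        if "s \<in> {0<..<inverse (real (Suc n))}" "t \<in> {0<..<inverse (real (Suc n))}" for s t
      proof -
        have "0 < s" "s < d" "0 < t" "t < d" using that n by auto
        then show ?thesis using d[of s] d[of t] by linarith
      qed
      then have "x \<in> E m n" unfolding E_def by blast
      then show ?thesis ..
    qed
    then show ?thesis unfolding G_def by blast
  qed
  have "AE t in lborel. x + t *\<^sub>R e \<notin> - G" for x
  proof -
    define \<phi> where "\<phi> t = v (x + t *\<^sub>R e)" for t
    have "(L * norm e)-lipschitz_on UNIV \<phi>"
      unfolding \<phi>_def by (rule lipschitz_on_line[OF lip])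
    then obtain f N where "\<And>a b. a \<le> b \<Longrightarrow> (f has_integral (\<phi> b - \<phi> a)) {a..b}"
      and N: "negligible N"
      and f: "\<And>t. t \<notin> N \<Longrightarrow> ((\<lambda>h. (\<phi> (t + h) - \<phi> t) / h) \<longlongrightarrow> f t) (at_right 0)"
      by (rule lipschitz_right_derivative) (rule that)
    have *: "x + t *\<^sub>R e \<in> G" if "t \<notin> N" for t
      using f[OF that] by (intro conv[of _ "f t"]) (simp add: q_def \<phi>_def algebra_simps)
    have "AE t in lebesgue. t \<notin> N"
      using N by (simp add: negligible_iff_null_sets AE_not_in)
    then have "AE t in lebesgue. x + t *\<^sub>R e \<notin> - G"
      by eventually_elim (use * in auto)
    then show ?thesis by (simp add: AE_completion_iff)
  qed
  then have "AE x in lborel. AE t in lborel. x + t *\<^sub>R e \<notin> - G"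
    by simp
  then have "AE x in lborel. x \<notin> - G"
    by (subst (asm) AE_lines_iff) auto
  then show ?thesis by eventually_elim (use lim in auto)
qed

section \<open>Linearity in the direction and Rademacher's theorem\<close>

text \<open>Additivity is false pointwise but holds weakly: integrated over any box, the base point
  displaced by \<open>f\<close> can be moved back by translating the box, and the translation
  disappears in the limit.\<close>

lemma dir_deriv_add_AE:
  fixes v :: "'a::euclidean_space \<Rightarrow> real"
  assumes lip: "L-lipschitz_on UNIV v"
  shows "AE x in lborel. dir_deriv v (e + f) x = dir_deriv v e x + dir_deriv v f x"
proof -
  note [measurable] = borel_measurable_lipschitz[OF lip]
  let ?c = "\<lambda>n. inverse (real (Suc n))"
  have L: "0 \<le> L" using lip by (rule lipschitz_on_nonneg)
  have tendsto: "AE x in lborel. (\<lambda>n. diff_quot v e n x) \<longlonglongrightarrow> dir_deriv v e x" for e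
    using AE_has_dir_deriv[OF lip, of e] by eventually_elim (rule has_dir_deriv_tendsto)
  have main: "((\<lambda>x. dir_deriv v (e + f) x - dir_deriv v e x - dir_deriv v f x) has_integral 0) (cbox a b)" for a b
  proof -
    obtain R where R: "cbox a b \<subseteq> cball 0 R"
      using bounded_subset_ballD[OF bounded_cbox[of a b], of 0] ball_subset_cball by blast
    have shift: "(\<lambda>n. \<integral>x. indicator (cbox a b) (x - ?c n *\<^sub>R f) * diff_quot v e n x \<partial>lborel)
        \<longlonglongrightarrow> (\<integral>x. indicator (cbox a b) x * dir_deriv v e x \<partial>lborel)"
      and int: "integrable lborel (\<lambda>x. indicator (cbox a b) x * dir_deriv v e x)"
      and intn: "integrable lborel (\<lambda>x. indicator (cbox a b) (x - ?c n *\<^sub>R f) * diff_quot v e n x)" for e f n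
    proof -
      \<comment> \<open>A common integrable majorant: the quotients are bounded by the Lipschitz
        constant, and the ball contains all the shifted boxes.\<close>
      let ?w = "\<lambda>x. (L * norm e) * indicator (cball 0 (R + norm f)) x"
      have w: "integrable lborel ?w"
        by (intro integrable_mult_right integrable_real_indicator) (use emeasure_bounded_finite[OF bounded_cball] in auto)
      \<comment> \<open>The indicators of the shifted boxes converge at every point off the boundary
        of the box, which is null.\<close>
      have "AE x in lborel. x \<notin> cbox a b - box a b"
        using negligible_frontier_interval[of a b]
        by (intro AE_not_in) (simp add: negligible_iff_null_sets null_sets_completion_iff)
      then have conv: "AE x in lborel. (\<lambda>n. indicator (cbox a b) (x - ?c n *\<^sub>R f) * diff_quot v e n x)
          \<longlonglongrightarrow> indicator (cbox a b) x * dir_deriv v e x"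
        using tendsto[of e]
      proof eventually_elim
        case (elim x)
        have lim: "(\<lambda>n. x - ?c n *\<^sub>R f) \<longlonglongrightarrow> x - 0 *\<^sub>R f"
          by (intro tendsto_intros LIMSEQ_inverse_real_of_nat)
        have "\<forall>\<^sub>F n in sequentially. indicator (cbox a b) (x - ?c n *\<^sub>R f) = (indicator (cbox a b) x :: real)"
        proof (cases "x \<in> cbox a b")
          case True
          then have "x - 0 *\<^sub>R f \<in> box a b" using elim by auto
          from topological_tendstoD[OF lim open_box this]
          show ?thesis by eventually_elim (use True box_subset_cbox[of a b] in auto)
        next
          case False
          then have "x - 0 *\<^sub>R f \<in> - cbox a b" by auto
          from topological_tendstoD[OF lim _ this]
          have "\<forall>\<^sub>F n in sequentially. x - ?c n *\<^sub>R f \<in> - cbox a b"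
            by (simp add: open_Compl closed_cbox)
          then show ?thesis by eventually_elim (use False in auto)
        qed
        then have "(\<lambda>n. indicator (cbox a b) (x - ?c n *\<^sub>R f)) \<longlonglongrightarrow> (indicator (cbox a b) x :: real)"
          by (rule tendsto_eventually)
        then show ?case using elim(2) by (intro tendsto_mult)
      qed
      have bound: "AE x in lborel. norm (indicator (cbox a b) (x - ?c n *\<^sub>R f) * diff_quot v e n x) \<le> ?w x" for n
      proof (rule AE_I2)
        fix x
        have "x \<in> cball 0 (R + norm f)" if "x - ?c n *\<^sub>R f \<in> cbox a b"
        proof -
          have "norm x \<le> norm (x - ?c n *\<^sub>R f) + norm (?c n *\<^sub>R f)"
            using norm_triangle_ineq[of "x - ?c n *\<^sub>R f" "?c n *\<^sub>R f"] by simp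
          also have "norm (x - ?c n *\<^sub>R f) \<le> R" using that R by (auto simp: subset_iff)
          also have "norm (?c n *\<^sub>R f) \<le> 1 * norm f"
            unfolding norm_scaleR by (intro mult_right_mono) (auto simp: field_simps)
          finally show ?thesis by simp
        qed
        then show "norm (indicator (cbox a b) (x - ?c n *\<^sub>R f) * diff_quot v e n x) \<le> ?w x"
          using abs_diff_quot_le[OF lip, of e n x] L by (auto simp: indicator_def abs_mult)
      qed
      show "(\<lambda>n. \<integral>x. indicator (cbox a b) (x - ?c n *\<^sub>R f) * diff_quot v e n x \<partial>lborel)
        \<longlonglongrightarrow> (\<integral>x. indicator (cbox a b) x * dir_deriv v e x \<partial>lborel)"
        by (rule integral_dominated_convergence[OF _ _ w conv bound]) measurable
      show "integrable lborel (\<lambda>x. indicator (cbox a b) x * dir_deriv v e x)"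
        by (rule integrable_dominated_convergence[OF _ _ w conv bound]) measurable
      show "integrable lborel (\<lambda>x. indicator (cbox a b) (x - ?c n *\<^sub>R f) * diff_quot v e n x)"
      proof (rule Bochner_Integration.integrable_bound[OF w])
        show "AE x in lborel. norm (indicator (cbox a b) (x - ?c n *\<^sub>R f) * diff_quot v e n x) \<le> norm (?w x)"
          using bound[of n] by eventually_elim (erule order_trans, simp only: real_norm_def abs_ge_self)
      qed measurable
    qed
    have translate: "(\<integral>x. indicator (cbox a b) (x - c) * g x \<partial>lborel)
        = (\<integral>x. indicator (cbox a b) x * g (x + c) \<partial>lborel)"
      and translate_int: "integrable lborel (\<lambda>x. indicator (cbox a b) (x - c) * g x)
        \<longleftrightarrow> integrable lborel (\<lambda>x. indicator (cbox a b) x * g (x + c))"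
      if [measurable]: "g \<in> borel_measurable borel" for g :: "'a \<Rightarrow> real" and c
    proof -
      have "(\<integral>x. indicator (cbox a b) (x - c) * g x \<partial>distr lborel borel ((+) c))
        = (\<integral>x. indicator (cbox a b) x * g (x + c) \<partial>lborel)"
        by (subst integral_distr) (auto simp: add.commute)
      then show "(\<integral>x. indicator (cbox a b) (x - c) * g x \<partial>lborel)
        = (\<integral>x. indicator (cbox a b) x * g (x + c) \<partial>lborel)"
        by (simp only: lborel_distr_plus)
      have "integrable (distr lborel borel ((+) c)) (\<lambda>x. indicator (cbox a b) (x - c) * g x)
        \<longleftrightarrow> integrable lborel (\<lambda>x. indicator (cbox a b) x * g (x + c))"
        by (subst integrable_distr_eq) (auto simp: add.commute)
      then show "integrable lborel (\<lambda>x. indicator (cbox a b) (x - c) * g x)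
        \<longleftrightarrow> integrable lborel (\<lambda>x. indicator (cbox a b) x * g (x + c))"
        by (simp only: lborel_distr_plus)
    qed
    \<comment> \<open>The quotient along \<open>e + f\<close> telescopes through the intermediate
      point, which moves with n.\<close>
    have split: "diff_quot v (e + f) n x = diff_quot v e n (x + ?c n *\<^sub>R f) + diff_quot v f n x" for n x
      by (simp add: diff_quot_def algebra_simps)
    have "(\<integral>x. indicator (cbox a b) x * diff_quot v (e + f) n x \<partial>lborel) =
        (\<integral>x. indicator (cbox a b) (x - ?c n *\<^sub>R f) * diff_quot v e n x \<partial>lborel) +
        (\<integral>x. indicator (cbox a b) x * diff_quot v f n x \<partial>lborel)" for n
    proof -
      have i1: "integrable lborel (\<lambda>x. indicator (cbox a b) x * diff_quot v e n (x + ?c n *\<^sub>R f))"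
        using intn[of n f e] by (subst (asm) translate_int) auto
      have i2: "integrable lborel (\<lambda>x. indicator (cbox a b) x * diff_quot v f n x)"
        using intn[of n 0 f] by simp
      show ?thesis
        using Bochner_Integration.integral_add[OF i1 i2]
        by (simp only: split translate[OF borel_measurable_diff_quot[OF borel_measurable_lipschitz[OF lip]]] distrib_left)
    qed
    moreover have "(\<lambda>n. \<integral>x. indicator (cbox a b) x * diff_quot v (e + f) n x \<partial>lborel)
        \<longlonglongrightarrow> (\<integral>x. indicator (cbox a b) x * dir_deriv v (e + f) x \<partial>lborel)"
      using shift[of 0 "e + f"] by simp
    moreover have "(\<lambda>n. (\<integral>x. indicator (cbox a b) (x - ?c n *\<^sub>R f) * diff_quot v e n x \<partial>lborel) +
        (\<integral>x. indicator (cbox a b) x * diff_quot v f n x \<partial>lborel))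
        \<longlonglongrightarrow> (\<integral>x. indicator (cbox a b) x * dir_deriv v e x \<partial>lborel) + (\<integral>x. indicator (cbox a b) x * dir_deriv v f x \<partial>lborel)"
      using tendsto_add[OF shift[of f e] shift[of 0 f]] by simp
    ultimately have eq: "(\<integral>x. indicator (cbox a b) x * dir_deriv v (e + f) x \<partial>lborel) =
        (\<integral>x. indicator (cbox a b) x * dir_deriv v e x \<partial>lborel) + (\<integral>x. indicator (cbox a b) x * dir_deriv v f x \<partial>lborel)"
      using LIMSEQ_unique by simp
    have "((\<lambda>x. indicator (cbox a b) x * dir_deriv v (e + f) x - indicator (cbox a b) x * dir_deriv v e x
        - indicator (cbox a b) x * dir_deriv v f x) has_integral 0) UNIV"
      using has_integral_diff[OF has_integral_diff[OF has_integral_integral_lborel[OF int[of "e + f"]]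
        has_integral_integral_lborel[OF int[of e]]] has_integral_integral_lborel[OF int[of f]]]
      by (simp add: eq)
    then have "((\<lambda>x. if x \<in> cbox a b then dir_deriv v (e + f) x - dir_deriv v e x - dir_deriv v f x else 0)
        has_integral 0) UNIV"
      by (rule has_integral_eq[rotated]) (auto simp: indicator_def)
    then show ?thesis
      by (simp only: has_integral_restrict_UNIV)
  qed
  obtain N where N: "negligible N"
    and *: "\<And>x. x \<notin> N \<Longrightarrow> dir_deriv v (e + f) x - dir_deriv v e x - dir_deriv v f x = 0"
    using AE_zero_if_integrals_zero[OF main] by blast
  have "AE x in lebesgue. x \<notin> N"
    using N by (simp add: negligible_iff_null_sets AE_not_in)
  then have "AE x in lebesgue. dir_deriv v (e + f) x = dir_deriv v e x + dir_deriv v f x"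
    by eventually_elim (use * in fastforce)
  then show ?thesis by (simp add: AE_completion_iff)
qed

lemma dir_deriv_scale_AE:
  fixes v :: "'a::euclidean_space \<Rightarrow> real"
  assumes lip: "L-lipschitz_on UNIV v"
  shows "AE x in lborel. dir_deriv v (c *\<^sub>R e) x = c * dir_deriv v e x"
proof -
  have pos: "AE x in lborel. dir_deriv v (c *\<^sub>R e) x = c * dir_deriv v e x" if "c > 0" for c
    using AE_has_dir_deriv[OF lip, of e]
    by eventually_elim (rule has_dir_deriv_imp_eq[OF has_dir_deriv_scale[OF _ that]])
  have zero: "dir_deriv v 0 x = 0" for x
    by (rule has_dir_deriv_imp_eq[OF has_dir_deriv_zero])
  consider "c > 0" | "c = 0" | "c < 0" by linarith
  then show ?thesis
  proof cases
    case 3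
    \<comment> \<open>A one-sided derivative does not see the direction reversed; since
      \<open>c *\<^sub>R e\<close> and its negative add up to 0, additivity forces the sign.\<close>
    from 3 have "AE x in lborel. dir_deriv v ((- c) *\<^sub>R e) x = (- c) * dir_deriv v e x"
      by (intro pos) simp
    then show ?thesis
      using dir_deriv_add_AE[OF lip, of "c *\<^sub>R e" "(- c) *\<^sub>R e"]
      by eventually_elim (simp add: zero)
  qed (use pos zero in auto)
qed

text \<open>The null set depends on \<open>e\<close>, so this can be used for countably many
  directions at once only.\<close>

lemma dir_deriv_linear_AE:
  fixes v :: "'a::euclidean_space \<Rightarrow> real"
  assumes lip: "L-lipschitz_on UNIV v"
  shows "AE x in lborel. dir_deriv v e x = e \<bullet> (\<Sum>b\<in>Basis. dir_deriv v b x *\<^sub>R b)"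
proof -
  have "finite F \<Longrightarrow> AE x in lborel. dir_deriv v (\<Sum>b\<in>F. (e \<bullet> b) *\<^sub>R b) x = (\<Sum>b\<in>F. (e \<bullet> b) * dir_deriv v b x)" for F
  proof (induction F rule: finite_induct)
    case empty
    then show ?case by (simp add: has_dir_deriv_imp_eq[OF has_dir_deriv_zero])
  next
    case (insert b F)
    from insert.IH dir_deriv_add_AE[OF lip, of "(e \<bullet> b) *\<^sub>R b" "\<Sum>b\<in>F. (e \<bullet> b) *\<^sub>R b"]
      dir_deriv_scale_AE[OF lip, of "e \<bullet> b" b]
    show ?case
      by eventually_elim (use insert.hyps in simp)
  qed
  from this[OF finite_Basis] show ?thesis
    by (simp add: euclidean_representation inner_sum_right mult.commute)
qed

text \<open>The Lipschitz bound makes the difference quotients equicontinuous in the direction. By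
  compactness of the unit sphere finitely many directions of \<open>Q\<close> control all of them
  uniformly.\<close>

lemma has_derivative_if_has_dir_deriv_dense:
  fixes v :: "'a::euclidean_space \<Rightarrow> real"
  assumes lip: "L-lipschitz_on UNIV v"
    and dense: "closure Q = UNIV"
    and Q: "\<And>q. q \<in> Q \<Longrightarrow> has_dir_deriv v q x (q \<bullet> G)"
  shows "(v has_derivative (\<lambda>h. h \<bullet> G)) (at x)"
  unfolding has_derivative_at_alt
proof (intro conjI allI impI)
  show "bounded_linear (\<lambda>h. h \<bullet> G)" by (rule bounded_linear_inner_left)
  fix \<epsilon> :: real assume "\<epsilon> > 0"
  have L: "0 \<le> L" using lip by (rule lipschitz_on_nonneg)
  \<comment> \<open>Replacing a unit vector by a direction at distance \<eta> costs L \<eta> in the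
    values of \<open>v\<close> and \<eta> |G| in the linear part; the limit along that direction
    costs another \<eta>.\<close>
  define \<eta> where "\<eta> = \<epsilon> / (L + norm G + 1)"
  have "L + norm G + 1 > 0" using L norm_ge_zero[of G] by linarith
  then have \<eta>: "\<eta> > 0" "\<eta> * (L + norm G + 1) = \<epsilon>"
    using \<open>\<epsilon> > 0\<close> unfolding \<eta>_def by auto
  have "sphere (0::'a) 1 \<subseteq> (\<Union>q\<in>Q. ball q \<eta>)"
  proof
    fix y :: 'a
    have "y \<in> closure Q" using dense by simp
    then show "y \<in> (\<Union>q\<in>Q. ball q \<eta>)"
      using \<eta>(1) by (auto simp: closure_approachable dist_commute)
  qed
  then obtain Q' where Q': "Q' \<subseteq> Q" "finite Q'" "sphere 0 1 \<subseteq> (\<Union>q\<in>Q'. ball q \<eta>)"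
    using compactE_image[OF compact_sphere, of Q "\<lambda>q. ball q \<eta>" 0 1] by blast
  have "\<forall>\<^sub>F t in at_right 0. \<forall>q\<in>Q'. dist ((v (x + t *\<^sub>R q) - v x) / t) (q \<bullet> G) < \<eta>"
    using Q' Q \<eta>(1) unfolding has_dir_deriv_def
    by (intro eventually_ball_finite) (auto dest!: tendstoD)
  then obtain d where "d > 0" and
    "\<And>t. 0 < t \<Longrightarrow> t < d \<Longrightarrow> \<forall>q\<in>Q'. dist ((v (x + t *\<^sub>R q) - v x) / t) (q \<bullet> G) < \<eta>"
    by (rule at_right_zeroE) (rule that)
  then have d: "\<bar>(v (x + t *\<^sub>R q) - v x) / t - q \<bullet> G\<bar> < \<eta>" if "0 < t" "t < d" "q \<in> Q'" for t q
    using that unfolding dist_real_def by blast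
  have "norm (v y - v x - (y - x) \<bullet> G) \<le> \<epsilon> * norm (y - x)" if y: "norm (y - x) < d" for y
  proof (cases "y = x")
    case False
    define t where "t = norm (y - x)"
    define e where "e = (y - x) /\<^sub>R t"
    have t: "t > 0" "t < d" using False y by (auto simp: t_def)
    then have e: "norm e = 1" "y = x + t *\<^sub>R e" by (auto simp: e_def t_def)
    then obtain q where q: "q \<in> Q'" "dist q e < \<eta>" using Q'(3) by fastforce
    have 1: "\<bar>v (x + t *\<^sub>R e) - v (x + t *\<^sub>R q)\<bar> \<le> t * (L * \<eta>)"
    proof -
      have "\<bar>v (x + t *\<^sub>R e) - v (x + t *\<^sub>R q)\<bar> \<le> L * dist (x + t *\<^sub>R e) (x + t *\<^sub>R q)"
        using lipschitz_onD[OF lip, of "x + t *\<^sub>R e" "x + t *\<^sub>R q"] by (simp add: dist_real_def)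
      also have "\<dots> = L * (t * dist q e)"
        using t by (simp add: dist_norm scaleR_diff_right[symmetric] norm_minus_commute)
      also have "\<dots> \<le> L * (t * \<eta>)"
        using L t q by (intro mult_left_mono) auto
      finally show ?thesis by (simp add: mult_ac)
    qed
    have 2: "\<bar>v (x + t *\<^sub>R q) - v x - t * (q \<bullet> G)\<bar> \<le> t * \<eta>"
    proof -
      have "v (x + t *\<^sub>R q) - v x - t * (q \<bullet> G) = t * ((v (x + t *\<^sub>R q) - v x) / t - q \<bullet> G)"
        using t by (simp add: field_simps)
      then show ?thesis using d[OF t q(1)] t by (simp add: abs_mult)
    qed
    have 3: "\<bar>t * (q \<bullet> G) - t * (e \<bullet> G)\<bar> \<le> t * (\<eta> * norm G)"
    proof -
      have "\<bar>(q - e) \<bullet> G\<bar> \<le> norm (q - e) * norm G" by (rule Cauchy_Schwarz_ineq2)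
      also have "\<dots> \<le> \<eta> * norm G" using q(2) by (intro mult_right_mono) (auto simp: dist_norm)
      finally have "t * \<bar>(q - e) \<bullet> G\<bar> \<le> t * (\<eta> * norm G)" using t by (intro mult_left_mono) auto
      moreover have "\<bar>t * (q \<bullet> G) - t * (e \<bullet> G)\<bar> = t * \<bar>(q - e) \<bullet> G\<bar>"
        using t by (simp add: inner_diff_left abs_mult right_diff_distrib[symmetric])
      ultimately show ?thesis by simp
    qed
    have "\<bar>v y - v x - t * (e \<bullet> G)\<bar> \<le> t * (L * \<eta>) + t * \<eta> + t * (\<eta> * norm G)"
      using 1 2 3 unfolding e(2) by linarith
    also have "\<dots> = t * (\<eta> * (L + norm G + 1))"
      by (simp add: algebra_simps)
    also have "\<dots> = \<epsilon> * norm (y - x)" unfolding \<eta>(2) by (simp add: t_def)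
    finally show ?thesis by (simp add: e(2))
  qed simp
  then show "\<exists>d>0. \<forall>y. norm (y - x) < d \<longrightarrow> norm (v y - v x - (y - x) \<bullet> G) \<le> \<epsilon> * norm (y - x)"
    using \<open>d > 0\<close> by blast
qed

lemma rademacher:
  fixes v :: "'a::euclidean_space \<Rightarrow> real"
  assumes lip: "L-lipschitz_on UNIV v"
  shows "AE x in lborel. v differentiable (at x)"
proof -
  obtain Q :: "'a set" where Q: "countable Q" "closure Q = UNIV"
    by (rule separable[of "UNIV :: 'a set"]) (metis top.extremum_unique that)
  have "AE x in lborel. \<forall>q\<in>Q. has_dir_deriv v q x (dir_deriv v q x)"
    using Q(1) AE_has_dir_deriv[OF lip] by (simp add: AE_ball_countable)
  moreover have "AE x in lborel. \<forall>q\<in>Q. dir_deriv v q x = q \<bullet> (\<Sum>b\<in>Basis. dir_deriv v b x *\<^sub>R b)"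
    using Q(1) dir_deriv_linear_AE[OF lip] by (simp add: AE_ball_countable)
  ultimately show ?thesis
  proof eventually_elim
    case (elim x)
    show ?case
      unfolding differentiable_def
      using has_derivative_if_has_dir_deriv_dense[OF lip Q(2), of x "\<Sum>b\<in>Basis. dir_deriv v b x *\<^sub>R b"] elim
      by auto
  qed
qed

section \<open>Locally Lipschitz functions and increments along segments\<close>

text \<open>McShane's extension, the infimum of the cones with slope \<open>C\<close> above the
  graph. It reduces locally Lipschitz functions to globally Lipschitz ones.\<close>

lemma lipschitz_extension_real:
  fixes v :: "'a::metric_space \<Rightarrow> real"
  assumes lip: "C-lipschitz_on W v"
  obtains w where "C-lipschitz_on UNIV w" "\<And>x. x \<in> W \<Longrightarrow> w x = v x"
proof (cases "W = {}")
  case True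
  have "C-lipschitz_on UNIV (\<lambda>_. 0::real)"
    using lipschitz_on_nonneg[OF lip] by (intro lipschitz_onI) auto
  with that True show thesis by blast
next
  case False
  have C: "0 \<le> C" using lip by (rule lipschitz_on_nonneg)
  define w where "w x = (INF y\<in>W. v y + C * dist x y)" for x
  have lower: "v z - C * dist x z \<le> v y + C * dist x y" if "z \<in> W" "y \<in> W" for x y z
  proof -
    have "v z - v y \<le> C * dist z y"
      using lipschitz_onD[OF lip that] by (simp add: dist_real_def)
    also have "\<dots> \<le> C * (dist x z + dist x y)"
      using C by (intro mult_left_mono) (simp_all add: dist_triangle3)
    finally show ?thesis by (simp add: algebra_simps)
  qed
  obtain z where z: "z \<in> W" using False by blast
  have bdd: "bdd_below ((\<lambda>y. v y + C * dist x y) ` W)" for x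
    using lower[OF z] by (intro bdd_belowI2[of _ "v z - C * dist x z"])
  have le: "w x \<le> w x' + C * dist x x'" for x x'
  proof -
    have "w x - C * dist x x' \<le> v y + C * dist x' y" if "y \<in> W" for y
    proof -
      have "w x \<le> v y + C * dist x y"
        unfolding w_def using bdd that by (rule cINF_lower)
      moreover have "C * dist x y \<le> C * (dist x x' + dist x' y)"
        using C by (intro mult_left_mono dist_triangle)
      ultimately show ?thesis by (simp add: algebra_simps)
    qed
    then have "w x - C * dist x x' \<le> w x'"
      unfolding w_def[of x'] using False by (intro cINF_greatest)
    then show ?thesis by simp
  qed
  have "C-lipschitz_on UNIV w"
  proof (rule lipschitz_onI)
    show "dist (w x) (w y) \<le> C * dist x y" for x y
      using le[of x y] le[of y x] by (simp add: dist_real_def dist_commute abs_le_iff)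
  qed (rule C)
  moreover have "w x = v x" if "x \<in> W" for x
  proof (rule antisym)
    show "w x \<le> v x"
      unfolding w_def using cINF_lower[OF bdd that, of x] by simp
    show "v x \<le> w x"
      unfolding w_def using False
    proof (rule cINF_greatest)
      show "v x \<le> v y + C * dist x y" if "y \<in> W" for y
        using lower[OF \<open>x \<in> W\<close> that, of x] by simp
    qed
  qed
  ultimately show thesis by (rule that)
qed

lemma has_derivative_imp_grad_eq:
  assumes "(v has_derivative (\<lambda>h. h \<bullet> D)) (at x)"
  shows "grad v x = D"
proof -
  have "(THE D. GDERIV v x :> D) = D"
  proof (rule the_equality)
    show "GDERIV v x :> D" using assms by (simp add: gderiv_def)
    fix D' assume "GDERIV v x :> D'"
    then have "(\<lambda>h. h \<bullet> D') = (\<lambda>h. h \<bullet> D)"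
      using assms by (auto simp: gderiv_def intro: has_derivative_unique)
    then have "(D' - D) \<bullet> D' = (D' - D) \<bullet> D" by metis
    then show "D' = D" by (metis inner_diff_right inner_eq_zero_iff right_minus_eq)
  qed
  then show ?thesis
    using assms by (auto simp: grad_def differentiable_def)
qed

lemma has_derivative_grad:
  fixes v :: "'a::euclidean_space \<Rightarrow> real"
  assumes "v differentiable (at x)"
  shows "(v has_derivative (\<lambda>h. h \<bullet> grad v x)) (at x)"
proof -
  obtain f where f: "(v has_derivative f) (at x)"
    using assms by (auto simp: differentiable_def)
  then interpret linear f by (rule has_derivative_linear)
  have "f h = h \<bullet> (\<Sum>b\<in>Basis. f b *\<^sub>R b)" for h
  proof -
    have "f h = f (\<Sum>b\<in>Basis. (h \<bullet> b) *\<^sub>R b)" by (simp add: euclidean_representation)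
    also have "\<dots> = (\<Sum>b\<in>Basis. (h \<bullet> b) * f b)" by (simp add: sum scale)
    finally show ?thesis by (simp add: inner_sum_right mult.commute)
  qed
  then have "f = (\<lambda>h. h \<bullet> (\<Sum>b\<in>Basis. f b *\<^sub>R b))" by blast
  with f have "(v has_derivative (\<lambda>h. h \<bullet> (\<Sum>b\<in>Basis. f b *\<^sub>R b))) (at x)" by simp
  then show ?thesis using has_derivative_imp_grad_eq by metis
qed

lemma has_derivative_imp_has_dir_deriv:
  assumes "(v has_derivative (\<lambda>h. h \<bullet> D)) (at x)"
  shows "has_dir_deriv v e x (e \<bullet> D)"
proof -
  have "((\<lambda>t. x + t *\<^sub>R e) has_derivative (\<lambda>t. t *\<^sub>R e)) (at 0)"
    by (auto intro!: derivative_eq_intros)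
  then have "((\<lambda>t. v (x + t *\<^sub>R e)) has_derivative (\<lambda>t. (t *\<^sub>R e) \<bullet> D)) (at 0)"
    using assms by (intro has_derivative_compose[of "\<lambda>t. x + t *\<^sub>R e" _ 0 UNIV v]) simp_all
  then have "((\<lambda>t. v (x + t *\<^sub>R e)) has_field_derivative (e \<bullet> D)) (at 0)"
    by (simp add: has_field_derivative_def) (simp add: mult.commute[of _ "e \<bullet> D"])
  then have "((\<lambda>t. (v (x + t *\<^sub>R e) - v x) / t) \<longlongrightarrow> e \<bullet> D) (at 0)"
    by (simp add: DERIV_def)
  then show ?thesis
    unfolding has_dir_deriv_def by (rule filterlim_mono[OF _ order_refl at_le]) simp
qed

lemma has_dir_deriv_grad:
  fixes v :: "'a::euclidean_space \<Rightarrow> real"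
  shows "v differentiable (at x) \<Longrightarrow> has_dir_deriv v e x (e \<bullet> grad v x)"
  by (intro has_derivative_imp_has_dir_deriv has_derivative_grad)

lemma well_inside_ball:
  fixes x :: "'a::euclidean_space"
  assumes "open V" "x \<in> V"
  shows "\<exists>r>0. cball x r \<subseteq> V \<and> ball x r \<lless> V"
proof -
  obtain r where "r > 0" "cball x r \<subseteq> V"
    using assms open_contains_cball by blast
  then show ?thesis by (intro exI[of _ r]) (auto simp: well_inside_def)
qed

lemma differentiable_at_cong:
  fixes v w :: "'a::real_normed_vector \<Rightarrow> 'b::real_normed_vector"
  assumes "open W" "x \<in> W" "\<And>y. y \<in> W \<Longrightarrow> v y = w y"
  shows "v differentiable (at x) \<longleftrightarrow> w differentiable (at x)"
proof
  assume "v differentiable (at x)"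
  then obtain D where "(v has_derivative D) (at x)" unfolding differentiable_def by blast
  then have "(w has_derivative D) (at x)"
    using assms by (rule has_derivative_transform_within_open)
  then show "w differentiable (at x)" unfolding differentiable_def by blast
next
  assume "w differentiable (at x)"
  then obtain D where "(w has_derivative D) (at x)" unfolding differentiable_def by blast
  then have "(v has_derivative D) (at x)"
    using assms(1,2) by (rule has_derivative_transform_within_open) (simp add: assms(3))
  then show "v differentiable (at x)" unfolding differentiable_def by blast
qed

lemma lip_loc_differentiable_AE:
  fixes v :: "'a::euclidean_space \<Rightarrow> real"
  assumes "open V" "v \<in> lip_loc V"
  shows "negligible {x \<in> V. \<not> v differentiable (at x)}"
proof (subst locally_negligible_alt, rule ballI)
  let ?S = "{x \<in> V. \<not> v differentiable (at x)}"
  fix x assume x: "x \<in> ?S"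
  obtain r where r: "r > 0" "cball x r \<subseteq> V" "ball x r \<lless> V"
    using well_inside_ball[OF assms(1)] x by blast
  then obtain C where "C-lipschitz_on (ball x r) v"
    using assms(2) by (auto simp: lip_loc_def)
  then obtain w where w: "C-lipschitz_on UNIV w" "\<And>y. y \<in> ball x r \<Longrightarrow> w y = v y"
    by (rule lipschitz_extension_real) (rule that)
  have "AE y in lebesgue. w differentiable (at y)"
    using rademacher[OF w(1)] by (simp add: AE_completion_iff)
  then have "negligible {y. \<not> w differentiable (at y)}"
    by (simp add: negligible_iff_null_sets completion.AE_iff_null_sets)
  moreover have "v differentiable (at y) \<longleftrightarrow> w differentiable (at y)" if "y \<in> ball x r" for y
    by (rule differentiable_at_cong[OF open_ball that]) (simp add: w(2))
  then have "?S \<inter> ball x r \<subseteq> {y. \<not> w differentiable (at y)}" by blast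
  ultimately have "negligible (?S \<inter> ball x r)" by (rule negligible_subset)
  then show "\<exists>U. openin (top_of_set ?S) U \<and> x \<in> U \<and> negligible U"
    using x r(1) by (intro exI[of _ "?S \<inter> ball x r"]) auto
qed

lemma lip_loc_continuous_on:
  fixes v :: "'a::euclidean_space \<Rightarrow> real"
  assumes "open V" "v \<in> lip_loc V"
  shows "continuous_on V v"
proof (rule continuous_at_imp_continuous_on, rule ballI)
  fix x assume "x \<in> V"
  then obtain r where r: "r > 0" "ball x r \<lless> V"
    using well_inside_ball[OF assms(1)] by blast
  then obtain C where "C-lipschitz_on (ball x r) v"
    using assms(2) by (auto simp: lip_loc_def)
  then have "continuous_on (ball x r) v" by (rule lipschitz_on_continuous_on)
  then show "isCont v x"
    using r(1) by (simp add: continuous_on_eq_continuous_at)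
qed

text \<open>An essential supremum is bounded above through an almost everywhere bound only for
  measurable functions. The gradient agrees almost everywhere with the vector of the Borel functions
  \<open>dir_deriv\<close>.\<close>

lemma borel_measurable_H_grad:
  fixes v :: "'a::euclidean_space \<Rightarrow> real"
  assumes V: "open V" "v \<in> lip_loc V" and H: "continuous_on UNIV H"
  shows "(\<lambda>x. ereal (H (grad v x))) \<in> borel_measurable (lebesgue_on V)"
proof -
  \<comment> \<open>Extension by 0 may destroy continuity across the boundary, but it is Borel, and
    derivatives at points of the open set \<open>V\<close> do not notice it.\<close>
  define w where "w x = (if x \<in> V then v x else 0)" for x
  define f where "f x = (\<Sum>b\<in>Basis. dir_deriv w b x *\<^sub>R b)" for x
  define g where "g x = (if x \<in> V then grad v x else f x)" for x
  have [measurable]: "w \<in> borel_measurable borel"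
    unfolding w_def using lip_loc_continuous_on[OF V] V(1)
    by (intro borel_measurable_continuous_on_if) auto
  have "f \<in> borel_measurable borel" unfolding f_def by measurable
  then have f: "f \<in> borel_measurable lebesgue" by (simp add: measurable_completion)
  have eq: "grad v x = f x" if x: "x \<in> V" "v differentiable (at x)" for x
  proof -
    have "(w has_derivative (\<lambda>h. h \<bullet> grad v x)) (at x)"
      using has_derivative_grad[OF x(2)] V(1) x(1)
      by (rule has_derivative_transform_within_open) (simp add: w_def)
    then have "dir_deriv w b x = b \<bullet> grad v x" for b
      by (intro has_dir_deriv_imp_eq has_derivative_imp_has_dir_deriv)
    then show ?thesis by (simp add: f_def inner_commute[of _ "grad v x"] euclidean_representation)
  qed
  have "AE x in lebesgue. x \<notin> {x \<in> V. \<not> v differentiable (at x)}"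
    using lip_loc_differentiable_AE[OF V] by (simp only: negligible_iff_null_sets AE_not_in)
  then have "AE x in lebesgue. f x = g x"
    by eventually_elim (use eq in \<open>auto simp: g_def\<close>)
  with f have "g \<in> borel_measurable lebesgue" by (rule borel_measurable_AE)
  moreover have "(\<lambda>x. ereal (H x)) \<in> borel_measurable borel"
    using H by (intro borel_measurable_ereal borel_measurable_continuous_onI)
  ultimately have "(\<lambda>x. ereal (H (g x))) \<in> borel_measurable lebesgue"
    by (rule measurable_compose)
  then have "(\<lambda>x. ereal (H (g x))) \<in> borel_measurable (lebesgue_on V)"
    by (rule measurable_restrict_space1)
  then show ?thesis
    by (rule measurable_cong[THEN iffD1, rotated]) (auto simp: g_def space_restrict_space)
qed

lemma compact_well_inside_tube:
  fixes S :: "'a::euclidean_space set"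
  assumes "compact S" "open V" "S \<subseteq> V"
  shows "\<exists>W d. W \<lless> V \<and> 0 < d \<and> (\<forall>x\<in>S. cball x d \<subseteq> W)"
proof (cases "S = {}")
  case True
  then show ?thesis by (intro exI[of _ "{}"] exI[of _ 1]) (auto simp: well_inside_def)
next
  case False
  obtain r where r: "r > 0" "(\<Union>x\<in>S. ball x r) \<subseteq> V"
    using compact_subset_open_imp_ball_epsilon_subset[OF assms] by blast
  define W where "W = {x. infdist x S < r / 2}"
  have sub: "{x. infdist x S \<le> r / 2} \<subseteq> V"
  proof
    fix x assume x: "x \<in> {x. infdist x S \<le> r / 2}"
    obtain y where "y \<in> S" "infdist x S = dist x y"
      using infdist_attains_inf[of S x] False compact_imp_closed[OF assms(1)] by auto
    with x r(1) have "x \<in> ball y r" by (simp add: dist_commute)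
    then show "x \<in> V" using r(2) \<open>y \<in> S\<close> by blast
  qed
  have comp: "compact {x. infdist x S \<le> r / 2}"
    using r(1) False assms(1) by (intro compact_infdist_le) auto
  have closW: "closure W \<subseteq> {x. infdist x S \<le> r / 2}"
    by (rule closure_minimal[OF _ compact_imp_closed[OF comp]]) (auto simp: W_def)
  then have "compact (closure W)"
    using compact_Int_closed[OF comp, of "closure W"] by (simp add: Int_absorb1)
  moreover have "open W"
    unfolding W_def by (intro open_Collect_less continuous_intros)
  ultimately have "W \<lless> V"
    unfolding well_inside_def using closW sub by blast
  moreover have "cball x (r / 4) \<subseteq> W" if "x \<in> S" for x
  proof
    fix y assume "y \<in> cball x (r / 4)"
    then show "y \<in> W"
      using infdist_le[OF that, of y] r(1) by (simp add: W_def dist_commute)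
  qed
  ultimately show ?thesis using r(1) by (intro exI[of _ W] exI[of _ "r / 4"]) auto
qed

text \<open>The bound may fail along the whole segment from a to b. If the increment were too large,
  it would be so for all translates starting in a small ball, yet almost every translate satisfies
  the gradient bound at almost all of its points.\<close>

lemma segment_increment_le_AE:
  fixes v :: "'a::euclidean_space \<Rightarrow> real"
  assumes V: "open V" "v \<in> lip_loc V" and N: "negligible N"
    and grad_le: "\<And>x. x \<in> V - N \<Longrightarrow> (b - a) \<bullet> grad v x \<le> c"
    and seg: "closed_segment a b \<subseteq> V"
  shows "v b - v a \<le> c"
proof (rule ccontr)
  assume "\<not> v b - v a \<le> c"
  let ?S = "closed_segment a b" and ?e = "b - a"
  obtain W r where W: "W \<lless> V" and r: "r > 0" "\<And>x. x \<in> ?S \<Longrightarrow> cball x r \<subseteq> W"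
    using compact_well_inside_tube[OF compact_segment V(1) seg] by blast
  then have openW: "open W" and WV: "W \<subseteq> V"
    using closure_subset[of W] by (auto simp: well_inside_def)
  obtain C where "C-lipschitz_on W v" using V(2) W by (auto simp: lip_loc_def)
  then obtain w where w: "C-lipschitz_on UNIV w" "\<And>y. y \<in> W \<Longrightarrow> w y = v y"
    by (rule lipschitz_extension_real) (rule that)
  have ab: "a \<in> W" "b \<in> W" using r(2)[of a] r(2)[of b] r(1) by auto
  \<comment> \<open>Starting points of translates that violate the claim; an open set containing
    \<open>a\<close>, hence not null.\<close>
  define P where "P = ball a r \<inter> {x. c < w (x + ?e) - w x}"
  have contw: "continuous_on UNIV w" using w(1) by (rule lipschitz_on_continuous_on)
  have "continuous_on UNIV (\<lambda>x. w (x + ?e))"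
    by (rule continuous_on_compose2[OF contw]) (auto intro: continuous_intros)
  then have "continuous_on UNIV (\<lambda>x. w (x + ?e) - w x)"
    using contw by (rule continuous_on_diff)
  then have "open P"
    unfolding P_def by (intro open_Int open_ball open_Collect_less continuous_on_const)
  moreover have "a \<in> P"
    using \<open>\<not> v b - v a \<le> c\<close> r(1) w(2)[OF ab(1)] w(2)[OF ab(2)] by (simp add: P_def)
  ultimately have "\<not> negligible P" using open_not_negligible by blast
  define N' where "N' = N \<union> {x \<in> V. \<not> v differentiable (at x)}"
  have "negligible N'"
    unfolding N'_def by (intro negligible_Un N lip_loc_differentiable_AE V)
  then have "AE x in lebesgue. x \<notin> N'" by (simp only: negligible_iff_null_sets AE_not_in)
  then have "AE x in lborel. x \<notin> N'" by (simp add: AE_completion_iff)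
  \<comment> \<open>A Borel null set containing \<open>N'\<close>, as Fubini requires
    measurability.\<close>
  then obtain A where A: "N' \<subseteq> A" "A \<in> null_sets lborel"
    by (auto elim!: AE_E simp: null_sets_def)
  then have "AE x in lborel. AE t in lborel. x + t *\<^sub>R ?e \<notin> A"
    by (subst AE_lines_iff) (auto simp: AE_not_in null_sets_def)
  then have "AE x in lborel. x \<notin> P"
  proof eventually_elim
    case (elim x)
    show "x \<notin> P"
    proof
      assume x: "x \<in> P"
      define \<phi> where "\<phi> t = w (x + t *\<^sub>R ?e)" for t
      have "(C * norm ?e)-lipschitz_on UNIV \<phi>"
        unfolding \<phi>_def by (rule lipschitz_on_line[OF w(1)])
      moreover from elim have "AE t in lebesgue. x + t *\<^sub>R ?e \<notin> A"
        by (simp add: AE_completion)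
      then have "negligible {t. x + t *\<^sub>R ?e \<in> A}"
        by (simp add: negligible_iff_null_sets completion.AE_iff_null_sets)
      moreover have "l \<le> c" if t: "t \<in> {0..1} - {t. x + t *\<^sub>R ?e \<in> A}"
        and l: "((\<lambda>h. (\<phi> (t + h) - \<phi> t) / h) \<longlongrightarrow> l) (at_right 0)" for t l
      proof -
        let ?y = "x + t *\<^sub>R ?e"
        have "a + t *\<^sub>R ?e \<in> ?S"
          using t by (auto simp: in_segment algebra_simps intro!: exI[of _ t])
        moreover have "?y \<in> cball (a + t *\<^sub>R ?e) r" using x by (simp add: P_def)
        ultimately have y: "?y \<in> W" using r(2) by blast
        then have diff: "v differentiable (at ?y)" and le: "?e \<bullet> grad v ?y \<le> c"
          using t A(1) WV grad_le[of ?y] by (auto simp: N'_def)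
        have "(w has_derivative (\<lambda>h. h \<bullet> grad v ?y)) (at ?y)"
          using has_derivative_grad[OF diff] openW y
          by (rule has_derivative_transform_within_open) (simp add: w(2))
        then have "has_dir_deriv w ?e ?y (?e \<bullet> grad v ?y)"
          by (rule has_derivative_imp_has_dir_deriv)
        then have "((\<lambda>h. (\<phi> (t + h) - \<phi> t) / h) \<longlongrightarrow> ?e \<bullet> grad v ?y) (at_right 0)"
          by (simp add: has_dir_deriv_def \<phi>_def algebra_simps)
        then show "l \<le> c"
          using le tendsto_unique[OF _ l] by (metis trivial_limit_at_right_real)
      qed
      ultimately have "\<phi> 1 - \<phi> 0 \<le> c * (1 - 0)"
        by (intro lipschitz_mean_value_AE[of _ \<phi> "{t. x + t *\<^sub>R ?e \<in> A}" 0 1 c]) auto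
      with x show False by (simp add: \<phi>_def P_def)
    qed
  qed
  then have "AE x in lebesgue. x \<notin> P" by (simp add: AE_completion)
  then have "negligible P"
    by (simp add: negligible_iff_null_sets completion.AE_iff_null_sets)
  with \<open>\<not> negligible P\<close> show False ..
qed

section \<open>Cones and the Lagrangian\<close>

locale hamiltonian =
  fixes H :: "'a::euclidean_space \<Rightarrow> real"
  assumes convex_H: "convex_on UNIV H"
    and H_zero: "H 0 = 0"
    and H_nonneg: "0 \<le> H p"
    and bounded_zero_set: "bounded {p. H p = 0}"
begin

lemma continuous_H: "continuous_on A H"
  using convex_on_continuous[OF open_UNIV convex_H] continuous_on_subset by blast

lemma H_convex_combination:
  assumes "0 \<le> s" "0 \<le> t" "s + t = 1"
  shows "H (s *\<^sub>R p + t *\<^sub>R q) \<le> s * H p + t * H q"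
  using convex_H assms by (simp add: convex_on_def)

text \<open>Take a sphere of radius R enclosing the zero set and the minimum m > 0 of
  \<open>H\<close> on it. By convexity and H 0 = 0, \<open>H\<close> is at least m |p| / R outside;
  subtracting m makes the bound trivial inside.\<close>

lemma H_linear_growth: "\<exists>\<eta>>0. \<exists>B\<ge>0. \<forall>p. \<eta> * norm p - B \<le> H p"
proof -
  obtain R where R: "R > 0" "\<And>p. H p = 0 \<Longrightarrow> norm p < R"
    using bounded_zero_set unfolding bounded_pos_less by blast
  obtain p0 where p0: "norm p0 = R" "\<And>p. norm p = R \<Longrightarrow> H p0 \<le> H p"
    using continuous_attains_inf[OF compact_sphere _ continuous_H, of 0 R] R(1) by auto
  define m where "m = H p0"
  have m: "m > 0" using R(2)[of p0] p0(1) H_nonneg[of p0] unfolding m_def by fastforce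
  have "m / R * norm p - m \<le> H p" for p
  proof (cases "norm p \<le> R")
    case True
    then have "m / R * norm p \<le> m / R * R" using m R(1) by (intro mult_left_mono) auto
    then show ?thesis using R(1) H_nonneg[of p] by simp
  next
    case False
    define s where "s = R / norm p"
    have "R < norm p" using False by simp
    with R(1) have "0 < norm p" by (rule less_trans)
    with \<open>R < norm p\<close> have s: "0 < s" "s < 1"
      unfolding s_def using R(1) by (simp, subst divide_less_eq_1_pos)
    have "norm (s *\<^sub>R p) = R" using \<open>0 < norm p\<close> R(1) by (simp add: s_def)
    then have "m \<le> H (s *\<^sub>R p)" using p0(2) unfolding m_def by blast
    also have "\<dots> \<le> s * H p"
      using H_convex_combination[of s "1 - s" p 0] s by (simp add: H_zero)
    finally have "m * norm p \<le> R * H p" using \<open>0 < norm p\<close> R(1) by (simp add: s_def field_simps)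
    then have "m / R * norm p \<le> H p" using R(1) by (simp add: field_simps)
    then show ?thesis using m by linarith
  qed
  then show ?thesis using m R(1) by (intro exI[of _ "m / R"] exI[of _ m] conjI) auto
qed

lemma compact_sublevel: "compact {p. H p \<le> k}"
proof -
  obtain \<eta> B where \<eta>: "\<eta> > 0" "\<And>p. \<eta> * norm p - B \<le> H p"
    using H_linear_growth by blast
  have "norm p \<le> (k + B) / \<eta>" if "H p \<le> k" for p
    using \<eta>(2)[of p] that \<eta>(1) by (simp add: field_simps)
  then have "bounded {p. H p \<le> k}" unfolding bounded_iff by blast
  moreover have "closed {p. H p \<le> k}"
    by (intro closed_Collect_le continuous_H continuous_on_const)
  ultimately show ?thesis by (simp add: compact_eq_bounded_closed)
qed

lemma level_set_meets_ray:
  assumes "H p \<le> k" "x \<noteq> 0"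
  shows "\<exists>s\<ge>0. H (p + s *\<^sub>R x) = k"
proof -
  obtain \<eta> B where \<eta>: "\<eta> > 0" "\<And>p. \<eta> * norm p - B \<le> H p"
    using H_linear_growth by blast
  \<comment> \<open>Chosen so that the norm of the endpoint is at least |k + B| / \<eta>, where
    linear growth has already passed the level k.\<close>
  define s where "s = (\<bar>k + B\<bar> / \<eta> + norm p) / norm x"
  have s: "s \<ge> 0" using \<eta>(1) by (simp add: s_def)
  have "\<bar>k + B\<bar> / \<eta> = norm (s *\<^sub>R x) - norm p"
    using assms(2) \<eta>(1) by (simp add: s_def)
  also have "\<dots> \<le> norm (p + s *\<^sub>R x)" using norm_triangle_ineq4[of "p + s *\<^sub>R x" p] by simp
  finally have "\<eta> * (\<bar>k + B\<bar> / \<eta>) \<le> \<eta> * norm (p + s *\<^sub>R x)"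
    using \<eta>(1) by (intro mult_left_mono) auto
  then have "k \<le> H (p + s *\<^sub>R x)" using \<eta>(2)[of "p + s *\<^sub>R x"] \<eta>(1) by simp
  moreover have "continuous_on {0..s} (\<lambda>s. H (p + s *\<^sub>R x))"
    by (rule continuous_on_compose2[OF continuous_H[of UNIV]]) (auto intro!: continuous_intros)
  ultimately show ?thesis
    using IVT'[of "\<lambda>s. H (p + s *\<^sub>R x)" 0 k s] assms(1) s by auto
qed

text \<open>A maximizer over the compact sublevel set can be pushed in direction x up to the level k
  without decreasing the product. So C_k is the support function of the convex set {H \<le> k}, the
  form used from here on.\<close>

lemma cone_max:
  assumes "0 \<le> k"
  shows "\<exists>p. H p = k \<and> cone H k x = p \<bullet> x \<and> (\<forall>q. H q \<le> k \<longrightarrow> q \<bullet> x \<le> p \<bullet> x)"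
proof -
  have "{p. H p \<le> k} \<noteq> {}" using H_zero assms by (auto intro: exI[of _ 0])
  moreover have "continuous_on {p. H p \<le> k} (\<lambda>p. p \<bullet> x)"
    by (intro continuous_intros)
  ultimately have "\<exists>p\<in>{p. H p \<le> k}. \<forall>q\<in>{p. H p \<le> k}. q \<bullet> x \<le> p \<bullet> x"
    by (rule continuous_attains_sup[OF compact_sublevel])
  then obtain p where p: "H p \<le> k" "\<And>q. H q \<le> k \<Longrightarrow> q \<bullet> x \<le> p \<bullet> x"
    by blast
  obtain b :: 'a where "b \<in> Basis" using nonempty_Basis by blast
  \<comment> \<open>For x = 0 every product vanishes, and any nonzero direction leads to the level
    set.\<close>
  define y where "y = (if x = 0 then b else x)"
  have "y \<noteq> 0" using \<open>b \<in> Basis\<close> nonzero_Basis by (auto simp: y_def)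
  then obtain s where s: "s \<ge> 0" "H (p + s *\<^sub>R y) = k"
    using level_set_meets_ray p(1) by blast
  define q where "q = p + s *\<^sub>R y"
  have "p \<bullet> x \<le> q \<bullet> x" using s(1) by (auto simp: q_def y_def inner_add_left)
  then have q: "H q = k" "\<And>r. H r \<le> k \<Longrightarrow> r \<bullet> x \<le> q \<bullet> x"
    using s(2) p(2) by (auto simp: q_def intro: order_trans)
  have "cone H k x = q \<bullet> x"
    unfolding cone_def max_on_def by (rule Greatest_equality) (use q in auto)
  with q show ?thesis by blast
qed

lemma cone_attained: "0 \<le> k \<Longrightarrow> \<exists>p. H p = k \<and> cone H k x = p \<bullet> x"
  using cone_max by blast

lemma cone_upper: "H p \<le> k \<Longrightarrow> p \<bullet> x \<le> cone H k x"
  using cone_max[of k x] H_nonneg[of p] by fastforce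

lemma cone_least:
  assumes "0 \<le> k" "\<And>p. H p \<le> k \<Longrightarrow> p \<bullet> x \<le> c"
  shows "cone H k x \<le> c"
  using cone_attained[OF assms(1), of x] assms(2) by fastforce

lemma cone_at_0 [simp]: "0 \<le> k \<Longrightarrow> cone H k 0 = 0"
  using cone_attained[of k 0] by auto

lemma cone_scaleR:
  assumes "0 \<le> k" "0 \<le> c"
  shows "cone H k (c *\<^sub>R x) = c * cone H k x"
proof (rule antisym)
  show "cone H k (c *\<^sub>R x) \<le> c * cone H k x"
    using assms cone_upper by (intro cone_least) (auto intro: mult_left_mono)
  obtain p where "H p = k" "cone H k x = p \<bullet> x" using cone_attained assms(1) by blast
  then show "c * cone H k x \<le> cone H k (c *\<^sub>R x)"
    using cone_upper[of p k "c *\<^sub>R x"] by simp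
qed

lemma cone_add_le: "0 \<le> k \<Longrightarrow> cone H k (x + y) \<le> cone H k x + cone H k y"
  by (intro cone_least) (auto simp: inner_add_right intro: add_mono cone_upper)

lemma cone_mono: "0 \<le> i \<Longrightarrow> i \<le> k \<Longrightarrow> cone H i x \<le> cone H k x"
  by (rule cone_least) (auto intro: cone_upper)

text \<open>Pushing a maximizer at level i along x to level k strictly raises the product. This
  strictness yields the strict gain of \<open>u - v\<close> in (4) to (1).\<close>

lemma cone_strict_mono:
  assumes "0 \<le> i" "i < k" "x \<noteq> 0"
  shows "cone H i x < cone H k x"
proof -
  obtain p where p: "H p = i" "cone H i x = p \<bullet> x" using cone_attained assms(1) by blast
  obtain s where s: "s \<ge> 0" "H (p + s *\<^sub>R x) = k"
    using level_set_meets_ray[of p k x] assms p by auto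
  have "s \<noteq> 0" using s p assms(2) by auto
  with s(1) have "p \<bullet> x < (p + s *\<^sub>R x) \<bullet> x" using assms(3) by (simp add: inner_add_left)
  also have "\<dots> \<le> cone H k x" using s(2) by (intro cone_upper) simp
  finally show ?thesis using p by simp
qed

lemma cone_le_norm: "0 \<le> k \<Longrightarrow> \<exists>R\<ge>0. \<forall>x. cone H k x \<le> R * norm x"
proof -
  assume k: "0 \<le> k"
  obtain R where R: "R > 0" "\<And>p. H p \<le> k \<Longrightarrow> norm p \<le> R"
    using compact_imp_bounded[OF compact_sublevel, of k] unfolding bounded_pos by blast
  have "cone H k x \<le> R * norm x" for x
  proof (rule cone_least[OF k])
    fix p assume "H p \<le> k"
    have "p \<bullet> x \<le> norm p * norm x" by (rule norm_cauchy_schwarz)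
    also have "\<dots> \<le> R * norm x" using R(2)[OF \<open>H p \<le> k\<close>] by (intro mult_right_mono) auto
    finally show "p \<bullet> x \<le> R * norm x" .
  qed
  then show ?thesis using R(1) by (intro exI[of _ R]) auto
qed

lemma cone_lipschitz:
  assumes "0 \<le> k"
  shows "\<exists>R. R-lipschitz_on UNIV (cone H k)"
proof -
  obtain R where R: "R \<ge> 0" "\<And>x. cone H k x \<le> R * norm x" using cone_le_norm[OF assms] by blast
  have le: "cone H k x - cone H k y \<le> R * dist x y" for x y
    using cone_add_le[OF assms, of y "x - y"] R(2)[of "x - y"] by (simp add: dist_norm)
  have "R-lipschitz_on UNIV (cone H k)"
  proof (rule lipschitz_onI)
    show "dist (cone H k x) (cone H k y) \<le> R * dist x y" for x y
      using le[of x y] le[of y x] by (simp add: dist_real_def dist_commute abs_le_iff)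
  qed (rule R(1))
  then show ?thesis ..
qed

lemma continuous_cone: "0 \<le> k \<Longrightarrow> continuous_on A (cone H k)"
  using cone_lipschitz lipschitz_on_continuous_on continuous_on_subset by (metis top_greatest)

lemma continuous_on_cone_diff: "0 \<le> k \<Longrightarrow> continuous_on A (\<lambda>x. cone H k (x - x0))"
  by (rule continuous_on_compose2[OF continuous_cone[of k UNIV]]) (auto intro!: continuous_intros)

text \<open>As soon as {H \<le> k} contains the ball of radius |\<rho>|, its support function
  dominates that of the ball. The threshold is the maximum of \<open>H\<close> on this ball.\<close>

lemma cone_ge_norm: "\<exists>K\<ge>0. \<forall>k\<ge>K. \<forall>x. \<rho> * norm x \<le> cone H k x"
proof -
  obtain p0 where p0: "\<And>p. norm p \<le> \<bar>\<rho>\<bar> \<Longrightarrow> H p \<le> H p0"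
  proof -
    have "\<exists>p0\<in>cball 0 \<bar>\<rho>\<bar>. \<forall>p\<in>cball 0 \<bar>\<rho>\<bar>. H p \<le> H p0"
      by (intro continuous_attains_sup compact_cball continuous_H) simp
    then show thesis using that by (metis mem_cball_0)
  qed
  have "\<rho> * norm x \<le> cone H k x" if "H p0 \<le> k" for k x
  proof (cases "x = 0")
    case False
    define p where "p = (\<rho> / norm x) *\<^sub>R x"
    have "norm p = \<bar>\<rho>\<bar>" using False by (simp add: p_def)
    then have "p \<bullet> x \<le> cone H k x" using p0[of p] that by (intro cone_upper) simp
    then show ?thesis using False by (simp add: p_def dot_square_norm power2_eq_square)
  qed (use that H_nonneg[of p0] in simp)
  then show ?thesis using H_nonneg[of p0] by blast
qed

text \<open>Concavity of k \<mapsto> C_k(z): the convex combination of maximizers at levels i and j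
  has \<open>H\<close> at most k. The cross-multiplied form covers the degenerate cases.\<close>

lemma cone_concave:
  assumes "0 \<le> i" "i \<le> k" "k \<le> j"
  shows "(k - i) * (cone H j z - cone H k z) \<le> (j - k) * (cone H k z - cone H i z)"
proof (cases "i = j")
  case False
  obtain p where p: "H p = i" "cone H i z = p \<bullet> z" using cone_attained assms(1) by blast
  obtain q where q: "H q = j" "cone H j z = q \<bullet> z" using cone_attained[of j z] assms by auto
  define s t where "s = (j - k) / (j - i)" and "t = (k - i) / (j - i)"
  have st: "0 \<le> s" "0 \<le> t" "s + t = 1"
    using assms False by (auto simp: s_def t_def add_divide_distrib[symmetric])
  have "s * (j - i) = j - k" "t * (j - i) = k - i" using False by (auto simp: s_def t_def)
  then have "s * i + t * j = k" using st(3) by algebra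
  then have "H (s *\<^sub>R p + t *\<^sub>R q) \<le> k" using H_convex_combination[OF st, of p q] p q by simp
  then have "s * cone H i z + t * cone H j z \<le> cone H k z"
    using cone_upper[of "s *\<^sub>R p + t *\<^sub>R q" k z] p q by (simp add: inner_add_left)
  then have "(j - i) * (s * cone H i z + t * cone H j z) \<le> (j - i) * cone H k z"
    using assms by (intro mult_left_mono) auto
  moreover have "(j - i) * (s * cone H i z + t * cone H j z)
      = s * (j - i) * cone H i z + t * (j - i) * cone H j z"
    by (simp only: distrib_left mult_ac)
  ultimately show ?thesis
    unfolding \<open>s * (j - i) = j - k\<close> \<open>t * (j - i) = k - i\<close> by (simp add: algebra_simps)
qed (use assms in auto)

text \<open>A closed convex set is determined by its support function. The sign change turns the
  minimizing side of the hyperplane into the maximizing one.\<close>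

lemma cone_separation:
  assumes "0 \<le> k" "k < H p"
  shows "\<exists>e. cone H k e < p \<bullet> e"
proof -
  have "convex {p. H p \<le> k}"
    unfolding convex_def
  proof (intro ballI allI impI)
    fix p q and s t :: real
    assume pq: "p \<in> {p. H p \<le> k}" "q \<in> {p. H p \<le> k}" and st: "0 \<le> s" "0 \<le> t" "s + t = 1"
    have "H (s *\<^sub>R p + t *\<^sub>R q) \<le> s * H p + t * H q" by (rule H_convex_combination[OF st])
    also have "\<dots> \<le> k" using pq st by (intro convex_bound_le) auto
    finally show "s *\<^sub>R p + t *\<^sub>R q \<in> {p. H p \<le> k}" by simp
  qed
  moreover have "closed {p. H p \<le> k}" using compact_sublevel compact_imp_closed by blast
  ultimately obtain e b where e: "e \<bullet> p < b" "\<And>q. H q \<le> k \<Longrightarrow> b < e \<bullet> q"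
    using separating_hyperplane_closed_point[of "{p. H p \<le> k}" p] assms(2) by auto
  obtain q where "H q = k" "cone H k (- e) = q \<bullet> - e" using cone_attained assms(1) by blast
  then have "cone H k (- e) < p \<bullet> - e" using e by (fastforce simp: inner_commute)
  then show ?thesis ..
qed

text \<open>Over \<^term>\<open>z\<close>, the least admissible \<^term>\<open>c\<close> is \<open>t L(z / t)\<close> for \<open>t > 0\<close>; for \<open>t = 0\<close> only
  \<open>z = 0\<close> is admissible, which makes the flow formula uniform in \<open>t \<ge> 0\<close>.\<close>

definition action_le :: "real \<Rightarrow> 'a \<Rightarrow> real \<Rightarrow> bool"
  where "action_le t z c \<longleftrightarrow> (\<forall>p. p \<bullet> z - t * H p \<le> c)"

lemma action_leD_cone: "action_le t z c \<Longrightarrow> 0 \<le> k \<Longrightarrow> cone H k z - k * t \<le> c"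
  using cone_attained[of k z] by (auto simp: action_le_def mult.commute)

lemma action_leI_cone:
  assumes "\<And>k. 0 \<le> k \<Longrightarrow> cone H k z - k * t \<le> c"
  shows "action_le t z c"
  unfolding action_le_def
proof
  fix p
  show "p \<bullet> z - t * H p \<le> c"
    using assms[OF H_nonneg[of p]] cone_upper[OF order_refl, of p z] by (simp add: mult.commute)
qed

lemma action_le_nonneg: "action_le t z c \<Longrightarrow> 0 \<le> c"
  unfolding action_le_def by (drule spec[of _ 0]) (simp add: H_zero)

lemma action_le_scale:
  assumes "action_le t z c" "0 \<le> s"
  shows "action_le (s * t) (s *\<^sub>R z) (s * c)"
  unfolding action_le_def
proof
  fix p
  have "s * (p \<bullet> z - t * H p) \<le> s * c"
    using assms by (intro mult_left_mono) (auto simp: action_le_def)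
  then show "p \<bullet> s *\<^sub>R z - s * t * H p \<le> s * c" by (simp add: algebra_simps)
qed

lemma action_le_0: "0 \<le> t \<Longrightarrow> action_le t 0 0"
  by (simp add: action_le_def H_nonneg)

lemma action_le_0_time:
  assumes "action_le 0 z c"
  shows "z = 0"
proof (rule ccontr)
  assume "z \<noteq> 0"
  have "((\<bar>c\<bar> + 1) / (z \<bullet> z)) *\<^sub>R z \<bullet> z \<le> c"
    using assms unfolding action_le_def by (metis diff_zero mult_zero_left)
  then show False using \<open>z \<noteq> 0\<close> by simp
qed

text \<open>L is at most B on the ball of radius \<eta>, by duality with the linear growth of
  \<open>H\<close>: every nearby point can be reached in a time proportional to its distance at a
  cost proportional to that time.\<close>

lemma action_le_small: "\<exists>\<eta>>0. \<exists>B\<ge>0. \<forall>t\<ge>0. \<forall>z. norm z \<le> \<eta> * t \<longrightarrow> action_le t z (B * t)"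
proof -
  obtain \<eta> B where \<eta>: "\<eta> > 0" "B \<ge> 0" "\<And>p. \<eta> * norm p - B \<le> H p"
    using H_linear_growth by blast
  have "p \<bullet> z - t * H p \<le> B * t" if "t \<ge> 0" "norm z \<le> \<eta> * t" for t z p
  proof -
    have "p \<bullet> z \<le> norm p * norm z" by (rule norm_cauchy_schwarz)
    also have "\<dots> \<le> norm p * (\<eta> * t)" using that by (intro mult_left_mono) auto
    also have "\<dots> = t * (\<eta> * norm p - B) + B * t" by (simp add: algebra_simps)
    also have "\<dots> \<le> t * H p + B * t" using \<eta>(3) that by (intro add_right_mono mult_left_mono) auto
    finally show ?thesis by simp
  qed
  then show ?thesis using \<eta> unfolding action_le_def by blast
qed

text \<open>Superlinear growth of L, since \<rho> is arbitrary: moving fast costs more than any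
  multiple of the distance.\<close>

lemma action_le_coercive: "\<exists>\<kappa>\<ge>0. \<forall>t z c. action_le t z c \<longrightarrow> \<rho> * norm z - \<kappa> * t \<le> c"
proof -
  obtain \<kappa> where "\<kappa> \<ge> 0" "\<And>z. \<rho> * norm z \<le> cone H \<kappa> z" using cone_ge_norm by blast
  then have "\<rho> * norm z - \<kappa> * t \<le> c" if "action_le t z c" for t z c
    using action_leD_cone[OF that, of \<kappa>] by (smt (verit))
  then show ?thesis using \<open>\<kappa> \<ge> 0\<close> by blast
qed

text \<open>The form in which lower semicontinuity of L enters the existence of maximizers.\<close>

lemma closed_action_le: "closed {w. action_le t (fst w) (snd w)}"
proof -
  have "{w. action_le t (fst w) (snd w)} = (\<Inter>p. {w. p \<bullet> fst w - t * H p \<le> snd w})"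
    by (auto simp: action_le_def)
  then show ?thesis by (auto intro!: closed_INT closed_Collect_le continuous_intros)
qed

text \<open>The time \<open>\<tau>\<close> is a supergradient of the concave function \<open>k \<mapsto> C\<^sub>k(z)\<close>.\<close>

lemma cone_optimal_time:
  assumes "0 < k" "z \<noteq> 0"
  shows "\<exists>\<tau>>0. action_le \<tau> z (cone H k z - k * \<tau>)"
proof -
  \<comment> \<open>The left difference quotients at k of the concave function. Each dominates every
    right quotient, so their infimum lies between both families; k > 0 makes \<open>S\<close>
    nonempty, and strict monotonicity makes the infimum positive.\<close>
  define S where "S = (\<lambda>j. (cone H k z - cone H j z) / (k - j)) ` {0..<k}"
  define \<tau> where "\<tau> = Inf S"
  have right: "(cone H j z - cone H k z) / (j - k) \<le> s" if s: "s \<in> S" and "k < j" for s j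
  proof -
    obtain i where i: "0 \<le> i" "i < k" "s = (cone H k z - cone H i z) / (k - i)"
      using s by (auto simp: S_def)
    then have "cone H k z - cone H i z = (k - i) * s" by simp
    then have "(k - i) * (cone H j z - cone H k z) \<le> (k - i) * ((j - k) * s)"
      using cone_concave[of i k j z] i \<open>k < j\<close> by (simp only: mult_ac less_imp_le)
    then have "cone H j z - cone H k z \<le> (j - k) * s"
      using i(2) by (simp only: mult_le_cancel_left_pos diff_gt_0_iff_gt)
    then show ?thesis using \<open>k < j\<close> by (simp add: pos_divide_le_eq mult.commute)
  qed
  have S: "S \<noteq> {}" "bdd_below S"
    using assms(1) right[of _ "k + 1"] by (auto simp: S_def intro!: bdd_belowI[of _ "(cone H (k + 1) z - cone H k z) / (k + 1 - k)"])
  have left: "\<tau> * (k - j) \<le> cone H k z - cone H j z" if "0 \<le> j" "j < k" for j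
  proof -
    have "\<tau> \<le> (cone H k z - cone H j z) / (k - j)"
      unfolding \<tau>_def using that S(2) by (intro cInf_lower) (auto simp: S_def)
    then show ?thesis using that by (simp add: field_simps)
  qed
  have right': "cone H j z - cone H k z \<le> \<tau> * (j - k)" if "k < j" for j
  proof -
    have "(cone H j z - cone H k z) / (j - k) \<le> \<tau>"
      unfolding \<tau>_def using right that S(1) by (intro cInf_greatest) auto
    then show ?thesis using that by (simp add: field_simps)
  qed
  have "0 < cone H (k + 1) z - cone H k z"
    using cone_strict_mono[of k "k + 1" z] assms by simp
  then have "\<tau> > 0" using right'[of "k + 1"] by simp
  moreover have "action_le \<tau> z (cone H k z - k * \<tau>)"
  proof (rule action_leI_cone)
    fix j :: real assume "0 \<le> j"
    then show "cone H j z - j * \<tau> \<le> cone H k z - k * \<tau>"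
      using left[of j] right'[of j] by (cases j k rule: linorder_cases) (auto simp: algebra_simps)
  qed
  ultimately show ?thesis by blast
qed

text \<open>With \<open>flow_le\<close>, this describes the flow as the supremum of u y - c over
  pairs with \<open>action_le t (y - x) c\<close>, in real numbers and for t = 0 as well.\<close>

lemma flow_ge:
  assumes "x \<in> U" "y \<in> U" "0 \<le> t" "action_le t (y - x) c"
  shows "ereal (u y - c) \<le> flow H U t u x"
proof (cases "t = 0")
  case True
  then show ?thesis
    using action_le_0_time[of "y - x" c] action_le_nonneg[OF assms(4)] assms(4) by (simp add: flow_def)
next
  case False
  with assms(3) have t: "t > 0" by simp
  have "lagrangian H ((y - x) /\<^sub>R t) \<le> ereal (c / t)"
    unfolding lagrangian_def
  proof (rule SUP_least)
    fix p
    have "p \<bullet> (y - x) - t * H p \<le> c" using assms(4) by (simp add: action_le_def)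
    then show "ereal (p \<bullet> ((y - x) /\<^sub>R t) - H p) \<le> ereal (c / t)"
      using divide_right_mono[of "p \<bullet> (y - x) - t * H p" c t] t
      by (simp add: diff_divide_distrib inverse_eq_divide)
  qed
  then have "ereal t * lagrangian H ((y - x) /\<^sub>R t) \<le> ereal t * ereal (c / t)"
    using t by (intro ereal_mult_left_mono) auto
  then have "ereal t * lagrangian H ((y - x) /\<^sub>R t) \<le> ereal c" using t by simp
  then have "ereal (u y) - ereal c \<le> ereal (u y) - ereal t * lagrangian H ((y - x) /\<^sub>R t)"
    by (intro ereal_minus_mono) auto
  then show ?thesis using False assms(2) by (auto simp: flow_def intro: SUP_upper2)
qed

lemma flow_le:
  assumes "x \<in> U" "0 \<le> t" "\<And>y c. y \<in> U \<Longrightarrow> action_le t (y - x) c \<Longrightarrow> u y - c \<le> m"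
  shows "flow H U t u x \<le> ereal m"
proof (cases "t = 0")
  case True
  then show ?thesis using assms(3)[of x 0] assms(1) action_le_0[of t] by (simp add: flow_def)
next
  case False
  with assms(2) have t: "t > 0" by simp
  have "ereal (u y) - ereal t * lagrangian H ((y - x) /\<^sub>R t) \<le> ereal m" if y: "y \<in> U" for y
  proof -
    have upper: "ereal (p \<bullet> ((y - x) /\<^sub>R t) - H p) \<le> lagrangian H ((y - x) /\<^sub>R t)" for p
      unfolding lagrangian_def by (rule SUP_upper) simp
    show ?thesis
    proof (cases "lagrangian H ((y - x) /\<^sub>R t)")
      case (real l)
      have "action_le t (y - x) (t * l)"
        unfolding action_le_def
      proof
        fix p
        have "p \<bullet> ((y - x) /\<^sub>R t) - H p \<le> l" using upper[of p] real by simp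
        then have "t * (p \<bullet> ((y - x) /\<^sub>R t) - H p) \<le> t * l" using t by (intro mult_left_mono) auto
        then show "p \<bullet> (y - x) - t * H p \<le> t * l" using t by (simp add: right_diff_distrib inverse_eq_divide)
      qed
      then show ?thesis using assms(3)[OF y] real by simp
    next
      case MInf
      then show ?thesis using upper[of 0] by simp
    next
      case PInf
      then show ?thesis using t by simp
    qed
  qed
  then show ?thesis using False by (auto simp: flow_def intro: SUP_least)
qed

end

section \<open>The flow of a bounded function\<close>

text \<open>Without a maximum, the open sets where u - g is below its value at some y cover S. A
  finite subcover has a best y, which then lies in none of its members.\<close>

lemma usc_attains_max:
  fixes u g :: "'a::topological_space \<Rightarrow> real"
  assumes S: "compact S" "S \<noteq> {}" "S \<subseteq> U" and u: "usc_on U u" and g: "continuous_on U g"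
  shows "\<exists>x\<in>S. \<forall>y\<in>S. u y - g y \<le> u x - g x"
proof (rule ccontr)
  assume "\<not> ?thesis"
  then have less: "\<forall>x\<in>S. \<exists>y\<in>S. u x - g x < u y - g y" by (auto simp: not_le)
  have "openin (top_of_set U) {x \<in> U. u x - g x < c}" for c
  proof -
    have "{x \<in> U. u x - g x < c} = (\<Union>q. {x \<in> U. u x < q} \<inter> {x \<in> U. q - c < g x})"
    proof (intro subset_antisym subsetI)
      fix x assume x: "x \<in> {x \<in> U. u x - g x < c}"
      then obtain q where "u x < q" "q < c + g x" using dense[of "u x" "c + g x"] by auto
      then show "x \<in> (\<Union>q. {x \<in> U. u x < q} \<inter> {x \<in> U. q - c < g x})" using x by auto
    qed auto
    moreover have "openin (top_of_set U) {x \<in> U. q - c < g x}" for q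
      using continuous_openin_preimage_gen[OF g open_greaterThan[of "q - c"]]
      by (simp add: vimage_def Int_def)
    ultimately show ?thesis
      using u by (auto simp: usc_on_def intro!: openin_Union openin_Int)
  qed
  then have "\<forall>y. \<exists>B. open B \<and> {x \<in> U. u x - g x < u y - g y} = U \<inter> B"
    by (auto simp: openin_open)
  then obtain B where B: "\<And>y. open (B y)" "\<And>y. {x \<in> U. u x - g x < u y - g y} = U \<inter> B y"
    by metis
  have B_iff: "x \<in> B y \<longleftrightarrow> u x - g x < u y - g y" if "x \<in> S" for x y
    using B(2)[of y] that S(3) by blast
  have "S \<subseteq> (\<Union>y\<in>S. B y)" using less B_iff by blast
  then obtain S' where S': "S' \<subseteq> S" "finite S'" "S \<subseteq> (\<Union>y\<in>S'. B y)"
    using compactE_image[OF S(1), of S B] B(1) by blast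
  then have "S' \<noteq> {}" using S(2) by blast
  have "Max ((\<lambda>y. u y - g y) ` S') \<in> (\<lambda>y. u y - g y) ` S'"
    using S'(2) \<open>S' \<noteq> {}\<close> by (intro Max_in) auto
  then obtain y where "y \<in> S'" "Max ((\<lambda>y. u y - g y) ` S') = u y - g y" by blast
  then have y: "y \<in> S'" "\<And>z. z \<in> S' \<Longrightarrow> u z - g z \<le> u y - g y"
    using Max_ge[OF finite_imageI[OF S'(2)], of _ "\<lambda>y. u y - g y"] by auto
  then obtain z where "z \<in> S'" "y \<in> B z" using S' by blast
  then show False using y B_iff S'(1) by fastforce
qed

lemma max_on_eq:
  assumes "x \<in> S" "\<And>y. y \<in> S \<Longrightarrow> f y \<le> f x"
  shows "max_on S f = f x"
  unfolding max_on_def by (rule Greatest_equality) (use assms in auto)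

lemma frontier_nonempty_bounded:
  fixes V :: "'a::euclidean_space set"
  assumes "compact (closure V)" "V \<noteq> {}"
  shows "frontier V \<noteq> {}"
  using assms not_bounded_UNIV[where 'a='a] compact_imp_bounded
  by (auto simp: frontier_eq_empty)

text \<open>\<open>V\<close> need not be convex, so nearby pairs cannot be chained; pairs at
  distance more than \<rho> are handled by the oscillation bound 2 M.\<close>

lemma lip_loc_I_bounded:
  fixes u :: "'a::euclidean_space \<Rightarrow> real"
  assumes M: "\<And>x. x \<in> U \<Longrightarrow> \<bar>u x\<bar> \<le> M"
    and local: "\<And>V. V \<lless> U \<Longrightarrow> \<exists>\<rho>>0. \<exists>K\<ge>0. \<forall>x\<in>V. \<forall>y\<in>V. norm (y - x) \<le> \<rho> \<longrightarrow> u y - u x \<le> K * norm (y - x)"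
  shows "u \<in> lip_loc U"
  unfolding lip_loc_def
proof (intro CollectI allI impI)
  fix V assume V: "V \<lless> U"
  then obtain \<rho> K where \<rho>: "\<rho> > 0" and K: "K \<ge> 0"
    and loc: "\<And>x y. x \<in> V \<Longrightarrow> y \<in> V \<Longrightarrow> norm (y - x) \<le> \<rho> \<Longrightarrow> u y - u x \<le> K * norm (y - x)"
    using local by blast
  have VU: "V \<subseteq> U" using V closure_subset[of V] by (auto simp: well_inside_def)
  define C where "C = max K (2 * M / \<rho>)"
  have le: "u y - u x \<le> C * norm (y - x)" if "x \<in> V" "y \<in> V" for x y
  proof (cases "norm (y - x) \<le> \<rho>")
    case True
    have "K * norm (y - x) \<le> C * norm (y - x)" by (intro mult_right_mono) (auto simp: C_def)
    then show ?thesis using loc[OF that True] by linarith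
  next
    case False
    have "M \<ge> 0" using M[of x] that VU by fastforce
    have "u y - u x \<le> 2 * M / \<rho> * \<rho>" using M[of x] M[of y] that VU \<rho> by fastforce
    also have "\<dots> \<le> 2 * M / \<rho> * norm (y - x)"
      using False \<rho> \<open>M \<ge> 0\<close> by (intro mult_left_mono) auto
    also have "\<dots> \<le> C * norm (y - x)" by (intro mult_right_mono) (auto simp: C_def)
    finally show ?thesis .
  qed
  have "C-lipschitz_on V u"
  proof (rule lipschitz_onI)
    show "dist (u x) (u y) \<le> C * dist x y" if "x \<in> V" "y \<in> V" for x y
      using le[OF that] le[OF that(2,1)] by (simp add: dist_real_def dist_norm norm_minus_commute abs_le_iff)
    show "0 \<le> C" using K by (simp add: C_def)
  qed
  then show "\<exists>C. C-lipschitz_on V u" ..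
qed

locale bounded_flow = hamiltonian H for H :: "'a::euclidean_space \<Rightarrow> real" +
  fixes U :: "'a set" and u :: "'a \<Rightarrow> real" and M :: real
  assumes open_U: "open U"
    and u_bound: "x \<in> U \<Longrightarrow> \<bar>u x\<bar> \<le> M"
begin

definition hflow :: "real \<Rightarrow> 'a \<Rightarrow> real"
  where "hflow t x = real_of_ereal (flow H U t u x)"

lemma flow_eq_hflow:
  assumes "x \<in> U" "0 \<le> t"
  shows "flow H U t u x = ereal (hflow t x)"
proof -
  have "ereal (u x - 0) \<le> flow H U t u x"
    using assms action_le_0 by (intro flow_ge) auto
  moreover have "flow H U t u x \<le> ereal M"
  proof (rule flow_le[OF assms])
    fix y c assume "y \<in> U" "action_le t (y - x) c"
    then show "u y - c \<le> M" using u_bound[of y] action_le_nonneg by fastforce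
  qed
  ultimately show ?thesis unfolding hflow_def
    by (cases "flow H U t u x") auto
qed

lemma hflow_ge: "x \<in> U \<Longrightarrow> y \<in> U \<Longrightarrow> 0 \<le> t \<Longrightarrow> action_le t (y - x) c \<Longrightarrow> u y - c \<le> hflow t x"
  using flow_ge[of x U y t c u] by (simp add: flow_eq_hflow)

lemma hflow_le: "x \<in> U \<Longrightarrow> 0 \<le> t \<Longrightarrow>
    (\<And>y c. y \<in> U \<Longrightarrow> action_le t (y - x) c \<Longrightarrow> u y - c \<le> m) \<Longrightarrow> hflow t x \<le> m"
  using flow_le[of x U t u m] by (simp add: flow_eq_hflow)

lemma hflow_0 [simp]: "hflow 0 x = u x"
  by (simp add: hflow_def flow_def)

lemma u_le_hflow: "x \<in> U \<Longrightarrow> 0 \<le> t \<Longrightarrow> u x \<le> hflow t x"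
  using hflow_ge[of x x t 0] action_le_0 by simp

lemma hflow_le_bound: "x \<in> U \<Longrightarrow> 0 \<le> t \<Longrightarrow> hflow t x \<le> M"
  using u_bound action_le_nonneg by (intro hflow_le) fastforce+

lemma action_le_mono: "action_le a z c \<Longrightarrow> a \<le> b \<Longrightarrow> action_le b z c"
  unfolding action_le_def by (meson H_nonneg diff_left_mono mult_right_mono order_trans)

lemma hflow_mono: "x \<in> U \<Longrightarrow> 0 \<le> a \<Longrightarrow> a \<le> b \<Longrightarrow> hflow a x \<le> hflow b x"
  by (rule hflow_le) (auto intro: hflow_ge action_le_mono)

text \<open>By superlinearity, covering the distance d in short time costs more than the oscillation
  of \<open>u\<close>, while staying put gives at least -M. This localizes the flow to small
  balls.\<close>

lemma far_points_irrelevant: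
  assumes "0 < d"
  shows "\<exists>\<delta>>0. \<forall>x y t c. y \<in> U \<longrightarrow> t \<le> \<delta> \<longrightarrow> action_le t (y - x) c \<longrightarrow> d \<le> norm (y - x) \<longrightarrow> u y - c < - M"
proof -
  \<comment> \<open>The slope makes the cost at distance d at least 2 |M| + 2, of which a time up to
    1 / (\<kappa> + 1) takes back at most 1.\<close>
  obtain \<kappa> where \<kappa>: "\<kappa> \<ge> 0" "\<And>t z c. action_le t z c \<Longrightarrow> (2 * \<bar>M\<bar> + 2) / d * norm z - \<kappa> * t \<le> c"
    using action_le_coercive[of "(2 * \<bar>M\<bar> + 2) / d"] by blast
  have "u y - c < - M" if "y \<in> U" "t \<le> 1 / (\<kappa> + 1)" "action_le t (y - x) c" "d \<le> norm (y - x)" for x y t c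
  proof -
    have "(2 * \<bar>M\<bar> + 2) / d * d \<le> (2 * \<bar>M\<bar> + 2) / d * norm (y - x)"
      using that(4) assms by (intro mult_left_mono) auto
    moreover have "\<kappa> * t \<le> \<kappa> * (1 / (\<kappa> + 1))" using that(2) \<kappa>(1) by (intro mult_left_mono) auto
    moreover have "\<kappa> * (1 / (\<kappa> + 1)) \<le> 1" using \<kappa>(1) by simp
    ultimately have "2 * \<bar>M\<bar> + 1 \<le> c" using \<kappa>(2)[OF that(3)] assms by simp
    then show ?thesis using u_bound[OF that(1)] by linarith
  qed
  then show ?thesis using \<kappa>(1) by (intro exI[of _ "1 / (\<kappa> + 1)"]) auto
qed

lemma far_points_irrelevant_hflow:
  assumes "0 < d"
  shows "\<exists>\<delta>>0. \<forall>x y t c. x \<in> U \<longrightarrow> y \<in> U \<longrightarrow> 0 \<le> t \<longrightarrow> t \<le> \<delta> \<longrightarrow> action_le t (y - x) c \<longrightarrow>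
    d \<le> norm (y - x) \<longrightarrow> (\<forall>s\<ge>0. u y - c < hflow s x)"
proof -
  have "- M \<le> hflow s x" if "x \<in> U" "0 \<le> s" for x s
    using u_le_hflow[OF that] u_bound[OF that(1)] by linarith
  then show ?thesis using far_points_irrelevant[OF assms] by (meson order_less_le_trans)
qed

lemma well_inside_tube:
  assumes "V \<lless> U"
  shows "\<exists>W d. W \<lless> U \<and> 0 < d \<and> W \<subseteq> U \<and> V \<subseteq> U \<and> (\<forall>x\<in>V. cball x d \<subseteq> W)"
proof -
  from assms have "compact (closure V)" "closure V \<subseteq> U" by (auto simp: well_inside_def)
  from compact_well_inside_tube[OF this(1) open_U this(2)] obtain W d where
    "W \<lless> U" "0 < d" "\<forall>x\<in>closure V. cball x d \<subseteq> W" by blast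
  then show ?thesis
    using \<open>closure V \<subseteq> U\<close> closure_subset[of V] closure_subset[of W]
    by (intro exI[of _ W] exI[of _ d]) (auto simp: well_inside_def)
qed

text \<open>The competitor at the earlier time is obtained by shortening the segment to the same
  endpoint by the factor \<open>a / b\<close>.\<close>

lemma hflow_time_lipschitz:
  assumes lip: "u \<in> lip_loc U" and V: "V \<lless> U"
  shows "\<exists>\<delta>>0. \<exists>k\<ge>0. \<forall>x\<in>V. \<forall>a b. 0 \<le> a \<longrightarrow> a \<le> b \<longrightarrow> b \<le> \<delta> \<longrightarrow> hflow b x - hflow a x \<le> k * (b - a)"
proof -
  obtain W d where W: "W \<lless> U" "0 < d" "W \<subseteq> U" "V \<subseteq> U" "\<And>x. x \<in> V \<Longrightarrow> cball x d \<subseteq> W"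
    using well_inside_tube[OF V] by blast
  then obtain L where L: "L-lipschitz_on W u" using lip by (auto simp: lip_loc_def)
  \<comment> \<open>Coercivity at the slope L of \<open>u\<close>: dropping the fraction 1 - r of
    the segment loses at most (1 - r) L |z|, which is at most the saved cost (1 - r) c plus k (b -
    a).\<close>
  obtain k where k: "k \<ge> 0" "\<And>t z c. action_le t z c \<Longrightarrow> L * norm z - k * t \<le> c"
    using action_le_coercive[of L] by blast
  obtain \<delta> where \<delta>: "\<delta> > 0" and far: "\<And>x y t c s. x \<in> U \<Longrightarrow> y \<in> U \<Longrightarrow> 0 \<le> t \<Longrightarrow> t \<le> \<delta> \<Longrightarrow>
      action_le t (y - x) c \<Longrightarrow> d \<le> norm (y - x) \<Longrightarrow> 0 \<le> s \<Longrightarrow> u y - c < hflow s x"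
    using far_points_irrelevant_hflow[OF W(2)] by blast
  have "hflow b x - hflow a x \<le> k * (b - a)" if x: "x \<in> V" and ab: "0 \<le> a" "a \<le> b" "b \<le> \<delta>" for x a b
  proof (cases "b = 0")
    case True
    then show ?thesis using ab by simp
  next
    case False
    then have b: "b > 0" using ab by simp
    have xU: "x \<in> U" using x W(4) by blast
    define r where "r = a / b"
    have r: "0 \<le> r" "r \<le> 1" "r * b = a" using ab b by (auto simp: r_def)
    have "hflow b x \<le> hflow a x + k * (b - a)"
    proof (rule hflow_le[OF xU])
      show "0 \<le> b" using b by simp
      fix y c assume y: "y \<in> U" and c: "action_le b (y - x) c"
      show "u y - c \<le> hflow a x + k * (b - a)"
      proof (cases "d \<le> norm (y - x)")
        case True
        have "0 \<le> k * (b - a)" using k(1) ab by simp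
        then show ?thesis using far[OF xU y _ ab(3) c True ab(1)] b by simp
      next
        case False
        define y' where "y' = x + r *\<^sub>R (y - x)"
        have "y \<in> cball x d" using False by (simp add: dist_norm norm_minus_commute)
        moreover have "norm (r *\<^sub>R (y - x)) \<le> d"
          using False r mult_left_le_one_le[of "norm (y - x)" r] by simp
        then have "y' \<in> cball x d" by (simp add: y'_def dist_norm)
        ultimately have yW: "y \<in> W" "y' \<in> W" using W(5)[OF x] by auto
        have "action_le a (y' - x) (r * c)"
          using action_le_scale[OF c r(1)] by (simp add: y'_def r(3))
        then have 1: "u y' - r * c \<le> hflow a x"
          using yW(2) W(3) ab by (intro hflow_ge xU) auto
        have "y - y' = (1 - r) *\<^sub>R (y - x)" by (simp add: y'_def algebra_simps)
        then have "norm (y - y') = (1 - r) * norm (y - x)" using r by simp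
        then have "u y - u y' \<le> (1 - r) * (L * norm (y - x))"
          using lipschitz_onD[OF L yW] by (simp add: dist_real_def dist_norm mult_ac)
        also have "\<dots> \<le> (1 - r) * (c + k * b)"
          using k(2)[OF c] r by (intro mult_left_mono) auto
        also have "\<dots> = c - r * c + k * (b - r * b)" by (simp add: algebra_simps)
        finally show ?thesis using 1 r(3) by simp
      qed
    qed
    then show ?thesis by simp
  qed
  then show ?thesis using \<delta> k(1) by blast
qed

text \<open>Translating the endpoint together with the starting point keeps the action unchanged, so
  the flow inherits the Lipschitz constant of \<open>u\<close>. Far endpoints do not compete, so
  translates stay in \<open>W\<close>.\<close>

lemma hflow_space_lipschitz:
  assumes lip: "u \<in> lip_loc U" and V: "V \<lless> U"
  shows "\<exists>\<delta>>0. \<exists>L\<ge>0. \<exists>d>0. \<forall>x\<in>V. \<forall>y\<in>V. \<forall>t. 0 \<le> t \<longrightarrow> t \<le> \<delta> \<longrightarrow> norm (y - x) \<le> d \<longrightarrow>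
    hflow t x - hflow t y \<le> L * norm (y - x)"
proof -
  obtain W d where W: "W \<lless> U" "0 < d" "W \<subseteq> U" "V \<subseteq> U" "\<And>x. x \<in> V \<Longrightarrow> cball x d \<subseteq> W"
    using well_inside_tube[OF V] by blast
  then obtain L where L: "L-lipschitz_on W u" using lip by (auto simp: lip_loc_def)
  have "0 < d / 2" using W(2) by simp
  then obtain \<delta> where \<delta>: "\<delta> > 0" and far: "\<And>x y t c. y \<in> U \<Longrightarrow> t \<le> \<delta> \<Longrightarrow>
      action_le t (y - x) c \<Longrightarrow> d / 2 \<le> norm (y - x) \<Longrightarrow> u y - c < - M"
    using far_points_irrelevant by metis
  have "hflow t x \<le> hflow t y + L * norm (y - x)"
    if xy: "x \<in> V" "y \<in> V" "norm (y - x) \<le> d / 2" and t: "0 \<le> t" "t \<le> \<delta>" for x y t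
  proof (rule hflow_le)
    show xU: "x \<in> U" using xy W(4) by blast
    have yU: "y \<in> U" using xy W(4) by blast
    fix z c assume z: "z \<in> U" and c: "action_le t (z - x) c"
    show "u z - c \<le> hflow t y + L * norm (y - x)"
    proof (cases "d / 2 \<le> norm (z - x)")
      case True
      have "- M \<le> hflow t y" using u_le_hflow[OF yU t(1)] u_bound[OF yU] by linarith
      moreover have "0 \<le> L * norm (y - x)" using lipschitz_on_nonneg[OF L] by simp
      ultimately show ?thesis using far[OF z t(2) c True] by linarith
    next
      case False
      define z' where "z' = z + (y - x)"
      have "norm (z' - x) \<le> norm (z - x) + norm (y - x)"
        using norm_triangle_ineq[of "z - x" "y - x"] by (simp add: z'_def algebra_simps)
      then have "z' \<in> cball x d" using False xy(3) by (simp add: dist_norm norm_minus_commute)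
      moreover have "z \<in> cball x d" using False W(2) by (simp add: dist_norm norm_minus_commute)
      ultimately have zW: "z \<in> W" "z' \<in> W" using W(5)[OF xy(1)] by auto
      have "action_le t (z' - y) c" using c by (simp add: z'_def)
      then have "u z' - c \<le> hflow t y" using zW(2) W(3) t by (intro hflow_ge yU) auto
      moreover have "u z - u z' \<le> L * norm (y - x)"
        using lipschitz_onD[OF L zW] by (simp add: dist_real_def dist_norm z'_def norm_minus_commute)
      ultimately show ?thesis by simp
    qed
  qed (rule t(1))
  then show ?thesis
    using \<delta> \<open>0 < d / 2\<close> lipschitz_on_nonneg[OF L] unfolding diff_le_eq
    by (metis add.commute)
qed

end

section \<open>From comparison with cones to convexity\<close>

context bounded_flow
begin

lemma comparison_with_cones_aboveD:
  assumes cca: "comparison_with_cones_above H U u"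
    and k: "0 \<le> k" and V: "V \<lless> U" "x0 \<notin> V"
    and m: "\<And>y. y \<in> frontier V \<Longrightarrow> u y - cone H k (y - x0) \<le> m"
    and y: "y \<in> V"
  shows "u y - cone H k (y - x0) \<le> m"
proof -
  let ?f = "\<lambda>x. u x - cone H k (x - x0)"
  have comp: "compact (closure V)" "closure V \<subseteq> U" using V(1) by (auto simp: well_inside_def)
  have usc: "usc_on U u" using cca by (simp add: comparison_with_cones_above_def)
  have "frontier V \<noteq> {}" using frontier_nonempty_bounded[OF comp(1)] y by blast
  have sub: "frontier V \<subseteq> closure V" by (simp add: frontier_def)
  obtain a where a: "a \<in> closure V" "\<And>x. x \<in> closure V \<Longrightarrow> ?f x \<le> ?f a"
    using usc_attains_max[OF comp(1) _ comp(2) usc continuous_on_cone_diff[OF k, of U x0]] y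
      closure_subset[of V] by blast
  obtain b where b: "b \<in> frontier V" "\<And>x. x \<in> frontier V \<Longrightarrow> ?f x \<le> ?f b"
    using usc_attains_max[OF compact_frontier_bounded \<open>frontier V \<noteq> {}\<close> _ usc continuous_on_cone_diff[OF k, of U x0]]
      sub comp bounded_subset[OF compact_imp_bounded[OF comp(1)] closure_subset] by blast
  have "max_on (closure V) ?f = max_on (frontier V) ?f"
    using cca k V by (auto simp: comparison_with_cones_above_def)
  moreover have "max_on (closure V) ?f = ?f a" using a by (rule max_on_eq)
  moreover have "max_on (frontier V) ?f = ?f b" using b by (rule max_on_eq)
  ultimately have "?f a = ?f b" by simp
  with a(2)[of y] m[OF b(1)] y closure_subset[of V] show ?thesis by fastforce
qed

text \<open>A cone with vertex x so steep that it exceeds the oscillation of \<open>u\<close> on the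
  sphere of radius d lies above u - u x inside the ball.\<close>

lemma comparison_imp_lip_loc:
  assumes cca: "comparison_with_cones_above H U u"
  shows "u \<in> lip_loc U"
proof (rule lip_loc_I_bounded[OF u_bound])
  fix V assume "V \<lless> U"
  then obtain W d where W: "W \<lless> U" "0 < d" "W \<subseteq> U" "V \<subseteq> U" "\<And>x. x \<in> V \<Longrightarrow> cball x d \<subseteq> W"
    using well_inside_tube by blast
  obtain k where k: "k \<ge> 0" "\<And>x. 2 * M / d * norm x \<le> cone H k x"
    using cone_ge_norm[of "2 * M / d"] by blast
  obtain R where R: "R \<ge> 0" "\<And>x. cone H k x \<le> R * norm x"
    using cone_le_norm[OF k(1)] by blast
  have "u y - u x \<le> R * norm (y - x)" if x: "x \<in> V" and near: "norm (y - x) \<le> d / 2" for x y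
  proof (cases "y = x")
    case False
    \<comment> \<open>Puncturing the ball puts the vertex outside the domain, as the comparison
      demands; the vertex then only has to be checked as a boundary point.\<close>
    define V' where "V' = ball x d - {x}"
    have clos: "closure V' \<subseteq> cball x d" unfolding V'_def by (rule closure_minimal) auto
    have dU: "cball x d \<subseteq> U" using W(3) W(5)[OF x] by blast
    have "open V'" unfolding V'_def by (intro open_Diff) auto
    moreover have "compact (closure V')"
      using compact_Int_closed[OF compact_cball, of "closure V'" x d] clos by (simp add: Int_absorb1)
    ultimately have V': "V' \<lless> U" using clos dU by (auto simp: well_inside_def)
    have "u y - cone H k (y - x) \<le> u x"
    proof (rule comparison_with_cones_aboveD[OF cca k(1) V'])
      show "x \<notin> V'" by (simp add: V'_def)
      show "y \<in> V'" using near W(2) False by (simp add: V'_def dist_norm norm_minus_commute)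
      fix z assume "z \<in> frontier V'"
      then have "z \<in> cball x d" "z \<notin> V'"
        using clos \<open>open V'\<close> by (auto simp: frontier_def interior_open)
      then consider "z = x" | "norm (z - x) = d"
        by (force simp: V'_def dist_norm norm_minus_commute)
      then show "u z - cone H k (z - x) \<le> u x"
      proof cases
        case 2
        have "z \<in> U" "x \<in> U" using \<open>z \<in> cball x d\<close> dU x W(4) by auto
        then show ?thesis
          using k(2)[of "z - x"] 2 W(2) u_bound[of z] u_bound[of x] by simp
      qed (use k(1) in simp)
    qed
    then show ?thesis using R(2)[of "y - x"] by linarith
  qed simp
  then show "\<exists>\<rho>>0. \<exists>K\<ge>0. \<forall>x\<in>V. \<forall>y\<in>V. norm (y - x) \<le> \<rho> \<longrightarrow> u y - u x \<le> K * norm (y - x)"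
    using W(2) R(1) by (intro exI[of _ "d / 2"] conjI exI[of _ R]) auto
qed

text \<open>The cone of slope \<open>k\<close> equal to the chord is compared with \<^term>\<open>u\<close> on the set of points whose
  optimal travel times at slope \<open>k\<close>, the supergradients of \<open>k \<mapsto> C\<^sub>k(z)\<close>, all lie strictly between
  \<open>a\<close> and \<open>b\<close>. At points outside this set \<^term>\<open>u\<close> is controlled by the value of the flow at
  time \<open>a\<close> or at time \<open>b\<close>.\<close>

lemma hflow_below_chord:
  assumes cca: "comparison_with_cones_above H U u"
    and x: "x \<in> U" and ab: "0 \<le> a" "a \<le> s" "s \<le> b"
    and k: "0 \<le> k" "k < K" "hflow b x - hflow a x = k * (b - a)"
    and D: "compact D" "D \<subseteq> U"
    and inside: "\<And>y. cone H K (y - x) - cone H k (y - x) \<le> b * (K - k) \<Longrightarrow> y \<in> D"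
  shows "hflow s x \<le> hflow a x + k * (s - a)"
proof -
  \<comment> \<open>In \<open>V1\<close> some right quotient at k exceeds a; in \<open>V2\<close>
    some left quotient is below b. By concavity this forces the closed conditions \<open>C1\<close>
    and \<open>C2\<close> on the opposite quotients, which survive on the closure.\<close>
  define V1 where "V1 = {y. \<exists>j>k. a * (j - k) < cone H j (y - x) - cone H k (y - x)}"
  define V2 where "V2 = {y. \<exists>i. 0 \<le> i \<and> i < k \<and> cone H k (y - x) - cone H i (y - x) < b * (k - i)}"
  define V where "V = V1 \<inter> V2"
  define C1 where "C1 = {y. \<forall>i. 0 \<le> i \<and> i < k \<longrightarrow> a * (k - i) \<le> cone H k (y - x) - cone H i (y - x)}"
  define C2 where "C2 = {y. \<forall>j>k. cone H j (y - x) - cone H k (y - x) \<le> b * (j - k)}"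
  have V1_C1: "V1 \<subseteq> C1"
  proof
    fix y assume "y \<in> V1"
    then obtain j where j: "j > k" "a * (j - k) < cone H j (y - x) - cone H k (y - x)"
      by (auto simp: V1_def)
    have "a * (k - i) \<le> cone H k (y - x) - cone H i (y - x)" if i: "0 \<le> i" "i < k" for i
    proof -
      have "(j - k) * (a * (k - i)) = (k - i) * (a * (j - k))" by simp
      also have "\<dots> \<le> (k - i) * (cone H j (y - x) - cone H k (y - x))"
        using i j by (intro mult_left_mono) auto
      also have "\<dots> \<le> (j - k) * (cone H k (y - x) - cone H i (y - x))"
        using i j by (intro cone_concave) auto
      finally show ?thesis using j(1) by (simp only: mult_le_cancel_left_pos diff_gt_0_iff_gt)
    qed
    then show "y \<in> C1" by (simp add: C1_def)
  qed
  have V2_C2: "V2 \<subseteq> C2"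
  proof
    fix y assume "y \<in> V2"
    then obtain i where i: "0 \<le> i" "i < k" "cone H k (y - x) - cone H i (y - x) < b * (k - i)"
      by (auto simp: V2_def)
    have "cone H j (y - x) - cone H k (y - x) \<le> b * (j - k)" if j: "j > k" for j
    proof -
      have "(k - i) * (cone H j (y - x) - cone H k (y - x)) \<le> (j - k) * (cone H k (y - x) - cone H i (y - x))"
        using i j by (intro cone_concave) auto
      also have "\<dots> \<le> (j - k) * (b * (k - i))" using i j by (intro mult_left_mono) auto
      also have "\<dots> = (k - i) * (b * (j - k))" by simp
      finally show ?thesis using i(2) by (simp only: mult_le_cancel_left_pos diff_gt_0_iff_gt)
    qed
    then show "y \<in> C2" by (simp add: C2_def)
  qed
  have "closed C1"
  proof -
    have "C1 = (\<Inter>i\<in>{0..<k}. {y. a * (k - i) \<le> cone H k (y - x) - cone H i (y - x)})"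
      by (auto simp: C1_def)
    then show ?thesis using k(1)
      by (auto intro!: closed_INT closed_Collect_le continuous_on_diff continuous_on_cone_diff continuous_on_const)
  qed
  moreover have "closed C2"
  proof -
    have "C2 = (\<Inter>j\<in>{k<..}. {y. cone H j (y - x) - cone H k (y - x) \<le> b * (j - k)})"
      by (auto simp: C2_def)
    then show ?thesis using k(1)
      by (auto intro!: closed_INT closed_Collect_le continuous_on_diff continuous_on_cone_diff continuous_on_const)
  qed
  ultimately have clos: "closure V \<subseteq> C1 \<inter> C2"
    using V1_C1 V2_C2 by (intro closure_minimal) (auto simp: V_def)
  have "open V1"
  proof -
    have "V1 = (\<Union>j\<in>{k<..}. {y. a * (j - k) < cone H j (y - x) - cone H k (y - x)})"
      by (auto simp: V1_def)
    then show ?thesis using k(1)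
      by (auto intro!: open_UN open_Collect_less continuous_on_diff continuous_on_cone_diff continuous_on_const)
  qed
  moreover have "open V2"
  proof -
    have "V2 = (\<Union>i\<in>{0..<k}. {y. cone H k (y - x) - cone H i (y - x) < b * (k - i)})"
      by (auto simp: V2_def)
    then show ?thesis using k(1)
      by (auto intro!: open_UN open_Collect_less continuous_on_diff continuous_on_cone_diff continuous_on_const)
  qed
  ultimately have openV: "open V" by (simp add: V_def open_Int)
  \<comment> \<open>The condition of \<open>C2\<close> at the single level K already confines the
    region to \<open>D\<close>.\<close>
  have "closure V \<subseteq> D" using clos inside k(2) by (auto simp: C2_def)
  then have "compact (closure V)"
    using compact_Int_closed[OF D(1), of "closure V"] by (simp add: Int_absorb1)
  then have V: "V \<lless> U" using openV \<open>closure V \<subseteq> D\<close> D(2) by (auto simp: well_inside_def)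
  have xV: "x \<notin> V" using k(1) ab(1) by (auto simp: V_def V1_def mult_less_0_iff)
  \<comment> \<open>Outside \<open>V1\<close> the concave function grows at rate at most a beyond k,
    so at time a only the levels up to k have to be tested. Dually, outside \<open>V2\<close> only
    the levels from k on matter at time b.\<close>
  have early: "action_le a (y - x) c"
    if "y \<notin> V1" "\<And>i. 0 \<le> i \<Longrightarrow> i \<le> k \<Longrightarrow> cone H i (y - x) - i * a \<le> c" for y c
  proof (rule action_leI_cone)
    fix j :: real assume "0 \<le> j"
    show "cone H j (y - x) - j * a \<le> c"
    proof (cases "j \<le> k")
      case False
      then have "cone H j (y - x) - cone H k (y - x) \<le> a * (j - k)"
        using that(1) by (auto simp: V1_def not_less)
      then show ?thesis using that(2)[of k] k(1) by (simp add: algebra_simps)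
    qed (use that(2) \<open>0 \<le> j\<close> in blast)
  qed
  have late: "action_le b (y - x) c"
    if "y \<notin> V2" "\<And>j. k \<le> j \<Longrightarrow> cone H j (y - x) - j * b \<le> c" for y c
  proof (rule action_leI_cone)
    fix i :: real assume "0 \<le> i"
    show "cone H i (y - x) - i * b \<le> c"
    proof (cases "k \<le> i")
      case False
      then have "b * (k - i) \<le> cone H k (y - x) - cone H i (y - x)"
        using that(1) \<open>0 \<le> i\<close> by (auto simp: V2_def not_less)
      then show ?thesis using that(2)[of k] by (simp add: algebra_simps)
    qed (use that(2) in blast)
  qed
  have hb: "hflow b x = hflow a x + k * (b - a)" using k(3) by simp
  have on_V: "u y - cone H k (y - x) \<le> hflow a x - k * a" if "y \<in> V" for y
  proof (rule comparison_with_cones_aboveD[OF cca k(1) V xV _ that])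
    fix y assume "y \<in> frontier V"
    then have y: "y \<in> C1" "y \<in> C2" "y \<notin> V" "y \<in> U"
      using clos openV \<open>closure V \<subseteq> D\<close> D(2) by (auto simp: frontier_def interior_open)
    show "u y - cone H k (y - x) \<le> hflow a x - k * a"
    proof (cases "y \<in> V1")
      case False
      have "action_le a (y - x) (cone H k (y - x) - k * a)"
      proof (rule early[OF False])
        fix i assume "0 \<le> i" "i \<le> k"
        then show "cone H i (y - x) - i * a \<le> cone H k (y - x) - k * a"
          using y(1) by (cases "i = k") (auto simp: C1_def algebra_simps)
      qed
      then show ?thesis using hflow_ge[OF x y(4) ab(1)] by fastforce
    next
      case True
      then have "y \<notin> V2" using y(3) by (simp add: V_def)
      then have "action_le b (y - x) (cone H k (y - x) - k * b)"
      proof (rule late)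
        fix j assume "k \<le> j"
        then have "cone H j (y - x) - cone H k (y - x) \<le> b * (j - k)"
          using y(2) by (auto simp: C2_def le_less)
        then show "cone H j (y - x) - j * b \<le> cone H k (y - x) - k * b"
          by (simp add: algebra_simps)
      qed
      then have "u y - (cone H k (y - x) - k * b) \<le> hflow b x"
        using ab by (intro hflow_ge x y) auto
      then show ?thesis unfolding hb by (simp add: algebra_simps)
    qed
  qed
  show ?thesis
  proof (rule hflow_le[OF x])
    show "0 \<le> s" using ab by simp
    fix y c assume y: "y \<in> U" and c: "action_le s (y - x) c"
    note c' = action_leD_cone[OF c]
    \<comment> \<open>Changing the time from s to a (or b) alters the bound at level i by i times
      the difference; on the relevant levels this is no worse than the chord's change at slope k. In
      \<open>V\<close> the cone comparison applies directly.\<close>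
    consider "y \<notin> V1" | "y \<notin> V2" | "y \<in> V" by (auto simp: V_def)
    then show "u y - c \<le> hflow a x + k * (s - a)"
    proof cases
      case 1
      have "action_le a (y - x) (c + k * (s - a))"
      proof (rule early[OF 1])
        fix i assume i: "0 \<le> i" "i \<le> k"
        have "i * (s - a) \<le> k * (s - a)" using i ab by (intro mult_right_mono) auto
        then show "cone H i (y - x) - i * a \<le> c + k * (s - a)"
          using c'[OF i(1)] by (simp add: algebra_simps)
      qed
      then show ?thesis using hflow_ge[OF x y ab(1)] by fastforce
    next
      case 2
      have "action_le b (y - x) (c - k * (b - s))"
      proof (rule late[OF 2])
        fix j assume j: "k \<le> j"
        have "k * (b - s) \<le> j * (b - s)" using j ab by (intro mult_right_mono) auto
        then show "cone H j (y - x) - j * b \<le> c - k * (b - s)"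
          using c'[of j] j k(1) by (simp add: algebra_simps)
      qed
      then have "u y - (c - k * (b - s)) \<le> hflow b x"
        using ab by (intro hflow_ge x y) auto
      then show ?thesis unfolding hb by (simp add: algebra_simps)
    next
      case 3
      then show ?thesis using on_V c'[OF k(1)] by (fastforce simp: algebra_simps)
    qed
  qed
qed

lemma comparison_imp_convexity:
  assumes cca: "comparison_with_cones_above H U u"
  shows "convexity_criterion H U u"
  unfolding convexity_criterion_def hflow_def[symmetric]
proof (intro conjI allI impI)
  have lip: "u \<in> lip_loc U" using cca by (rule comparison_imp_lip_loc)
  show "continuous_on U u" using open_U lip by (rule lip_loc_continuous_on)
  show "bounded (u ` U)" using u_bound unfolding bounded_iff by fastforce
  fix V assume V: "V \<lless> U"
  obtain W d where W: "W \<lless> U" "0 < d" "W \<subseteq> U" "V \<subseteq> U" "\<And>x. x \<in> V \<Longrightarrow> cball x d \<subseteq> W"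
    using well_inside_tube[OF V] by blast
  obtain \<delta>1 k0 where \<delta>1: "\<delta>1 > 0" and k0: "k0 \<ge> 0"
    and slope: "\<And>x a b. x \<in> V \<Longrightarrow> 0 \<le> a \<Longrightarrow> a \<le> b \<Longrightarrow> b \<le> \<delta>1 \<Longrightarrow> hflow b x - hflow a x \<le> k0 * (b - a)"
    using hflow_time_lipschitz[OF lip V] by blast
  obtain R where R: "R \<ge> 0" "\<And>x. cone H k0 x \<le> R * norm x"
    using cone_le_norm[OF k0] by blast
  \<comment> \<open>With C_k at most R |z| for all admissible slopes, C_K exceeds C_k by at least
    |z|. Hence the region of the comparison has radius at most b (K - k), which is at most \<delta>
    K, and \<delta> depends on \<open>V\<close> alone.\<close>
  obtain K0 where K0: "\<And>k x. k \<ge> K0 \<Longrightarrow> (R + 1) * norm x \<le> cone H k x"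
    using cone_ge_norm[of "R + 1"] by blast
  define K where "K = max K0 (k0 + 1)"
  define \<delta> where "\<delta> = min \<delta>1 (d / K)"
  have K: "K > 0" "K > k0" "\<And>x. (R + 1) * norm x \<le> cone H K x"
    using K0 k0 by (auto simp: K_def)
  have \<delta>: "\<delta> > 0" "\<delta> \<le> \<delta>1" "\<delta> * K \<le> d"
    using \<delta>1 W(2) K(1) by (auto simp: \<delta>_def min_def field_simps)
  have "convex_on {0..\<delta>} (\<lambda>t. hflow t x)" if x: "x \<in> V" for x
  proof (rule convex_on_linorderI)
    fix t a b :: real
    assume t: "0 < t" "t < 1" and a: "a \<in> {0..\<delta>}" and b: "b \<in> {0..\<delta>}" and "a < b"
    have xU: "x \<in> U" using x W(4) by blast
    define k where "k = (hflow b x - hflow a x) / (b - a)"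
    define s where "s = (1 - t) *\<^sub>R a + t *\<^sub>R b"
    have s: "s = a + t * (b - a)" by (simp add: s_def algebra_simps)
    have ts: "0 \<le> t * (b - a)" "t * (b - a) \<le> 1 * (b - a)"
      using t \<open>a < b\<close> by (auto intro!: mult_nonneg_nonneg mult_right_mono)
    have keq: "hflow b x - hflow a x = k * (b - a)" using \<open>a < b\<close> by (simp add: k_def)
    have k: "0 \<le> k" "k \<le> k0"
      using slope[OF x, of a b] hflow_mono[OF xU, of a b] a b \<open>a < b\<close> \<delta>(2)
      by (auto simp: k_def pos_divide_le_eq)
    have "hflow s x \<le> hflow a x + k * (s - a)"
    proof (rule hflow_below_chord[OF cca xU _ _ _ k(1) _ keq, where D = "cball x d"])
      show "k < K" using k K by simp
      show "cball x d \<subseteq> U" using W(3) W(5)[OF x] by blast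
      fix y assume y: "cone H K (y - x) - cone H k (y - x) \<le> b * (K - k)"
      have "cone H k (y - x) \<le> R * norm (y - x)"
        using cone_mono[OF k, of "y - x"] R(2)[of "y - x"] by linarith
      moreover have "b * (K - k) \<le> \<delta> * K"
        using b k K by (intro mult_mono) auto
      ultimately have "norm (y - x) \<le> d"
        using y K(3)[of "y - x"] \<delta>(3) by (simp add: algebra_simps)
      then show "y \<in> cball x d" by (simp add: dist_norm norm_minus_commute)
    qed (use a s ts in auto)
    also have "\<dots> = (1 - t) * hflow a x + t * (hflow a x + k * (b - a))"
      by (simp add: s algebra_simps)
    also have "hflow a x + k * (b - a) = hflow b x" using keq by simp
    finally show "hflow ((1 - t) *\<^sub>R a + t *\<^sub>R b) x \<le> (1 - t) * hflow a x + t * hflow b x"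
      by (simp only: s_def)
  qed (rule convex_real_interval)
  then show "\<exists>\<delta>>0. \<forall>x\<in>V. convex_on {0..\<delta>} (\<lambda>t. hflow t x)"
    using \<delta>(1) by blast
qed

end

section \<open>The initial slope of the flow and the remaining implications\<close>

text \<open>Take the last point where \<psi> is at most \<psi> a. It produces a starting point from
  which the rise persists over a whole right interval.\<close>

lemma last_exit:
  fixes \<psi> :: "real \<Rightarrow> real"
  assumes "continuous_on {a..b} \<psi>" "a \<le> b" "\<psi> a < \<psi> b"
  shows "\<exists>s\<in>{a..<b}. \<forall>r\<in>{s<..b}. \<psi> s < \<psi> r"
proof -
  let ?S = "{r \<in> {a..b}. \<psi> r \<le> \<psi> a}"
  have "closed ?S"
    using continuous_closed_preimage[OF assms(1) closed_atLeastAtMost closed_atMost[of "\<psi> a"]]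
    by (simp add: vimage_def Int_def)
  have "{a..b} \<inter> ?S = ?S" by blast
  then have "compact ?S"
    using compact_Int_closed[OF compact_Icc \<open>closed ?S\<close>, of a b] by (simp only:)
  then obtain s where s: "s \<in> ?S" "\<And>r. r \<in> ?S \<Longrightarrow> r \<le> s"
    using compact_attains_sup[of ?S] assms(2) by auto
  have "\<psi> s < \<psi> r" if "r \<in> {s<..b}" for r
    using s(1) s(2)[of r] that by fastforce
  moreover have "s \<in> {a..<b}" using s(1) assms(3) by (cases "s = b") auto
  ultimately show ?thesis by blast
qed

lemma usc_on_imp_open:
  assumes "open U" "usc_on U f"
  shows "open {x \<in> U. f x < c}"
  using assms by (simp add: usc_on_def openin_open_eq)

lemma lip_loc_mono:
  assumes "V \<subseteq> U" "v \<in> lip_loc U"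
  shows "v \<in> lip_loc V"
  using assms by (force simp: lip_loc_def well_inside_def)

lemma negligible_iff_AE_lebesgue_on:
  fixes V :: "'a::euclidean_space set"
  assumes "open V" "AE x in lebesgue_on V. P x"
  shows "negligible {x \<in> V. \<not> P x}"
proof -
  have "V \<in> sets lebesgue" using assms(1) by auto
  then have "AE x in lebesgue. x \<in> V \<longrightarrow> P x"
    using assms(2) by (subst (asm) AE_restrict_space_iff) auto
  then have "{x. \<not> (x \<in> V \<longrightarrow> P x)} \<in> null_sets lebesgue"
    by (simp add: completion.AE_iff_null_sets)
  moreover have "{x. \<not> (x \<in> V \<longrightarrow> P x)} = {x \<in> V. \<not> P x}" by blast
  ultimately show ?thesis by (simp add: negligible_iff_null_sets)
qed

context bounded_flow
begin

lemma hflow_le_chord: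
  assumes x: "x \<in> U" and conv: "convex_on {0..\<delta>} (\<lambda>t. hflow t x)" and st: "0 \<le> s" "s \<le> t" "0 < t" "t \<le> \<delta>"
  shows "hflow s x \<le> u x + s / t * (hflow t x - u x)"
proof -
  have "hflow ((1 - s / t) *\<^sub>R 0 + (s / t) *\<^sub>R t) x \<le> (1 - s / t) * hflow 0 x + s / t * hflow t x"
    using st by (intro convex_onD[OF conv]) auto
  then show ?thesis using st by (simp add: algebra_simps)
qed

lemma S_plus_eq:
  assumes "x \<in> U"
  shows "S_plus H U u x = Limsup (at_right 0) (\<lambda>t. ereal ((hflow t x - u x) / t))"
  unfolding S_plus_def
  by (rule Limsup_eq) (use assms in \<open>auto simp: flow_eq_hflow eventually_at_right_field intro!: exI[of _ 1]\<close>)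

text \<open>Difference quotients of a convex function increase with t, so each one at a fixed time
  bounds the initial slope.\<close>

lemma S_plus_le_quotient:
  assumes x: "x \<in> U" and conv: "convex_on {0..\<delta>} (\<lambda>t. hflow t x)" and t: "0 < t" "t \<le> \<delta>"
  shows "S_plus H U u x \<le> ereal ((hflow t x - u x) / t)"
  unfolding S_plus_eq[OF x]
proof (rule Limsup_bounded)
  have "(hflow s x - u x) / s \<le> (hflow t x - u x) / t" if "0 < s" "s < t" for s
    using hflow_le_chord[OF x conv, of s t] that t by (simp add: field_simps)
  then show "\<forall>\<^sub>F s in at_right 0. ereal ((hflow s x - u x) / s) \<le> ereal ((hflow t x - u x) / t)"
    using t(1) unfolding eventually_at_right_field by auto
qed

lemma S_plus_ge:
  assumes x: "x \<in> U" and d: "0 < d" "\<And>s. 0 < s \<Longrightarrow> s < d \<Longrightarrow> c * s \<le> hflow s x - u x"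
  shows "ereal c \<le> S_plus H U u x"
  unfolding S_plus_eq[OF x]
proof (rule le_Limsup)
  show "\<forall>\<^sub>F s in at_right 0. ereal c \<le> ereal ((hflow s x - u x) / s)"
    using d unfolding eventually_at_right_field by (auto simp: pos_le_divide_eq intro!: exI[of _ d])
qed simp

lemma S_plus_lessD:
  assumes x: "x \<in> U" and c: "S_plus H U u x < c"
  obtains d where "0 < d" "\<And>s. 0 < s \<Longrightarrow> s < d \<Longrightarrow> ereal ((hflow s x - u x) / s) < c"
  using Limsup_lessD[OF c[unfolded S_plus_eq[OF x]]] by (rule at_right_zeroE) (rule that)

section \<open>From the uniform to the pointwise convexity criterion\<close>

text \<open>The point y is reached in time t = |y - x| / \<eta> at cost B t, and convexity on
  [0, \<delta>] spreads the total rise of at most 2 |M| linearly, leaving at most 2 |M| t / \<delta>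
  at time t.\<close>

lemma convexity_imp_lip_loc:
  assumes "convexity_criterion H U u"
  shows "u \<in> lip_loc U"
proof (rule lip_loc_I_bounded[OF u_bound])
  fix V assume "V \<lless> U"
  then obtain \<delta> where \<delta>: "\<delta> > 0" "\<And>x. x \<in> V \<Longrightarrow> convex_on {0..\<delta>} (\<lambda>t. hflow t x)"
    using assms unfolding convexity_criterion_def hflow_def[symmetric] by blast
  have VU: "V \<subseteq> U" using \<open>V \<lless> U\<close> closure_subset[of V] by (auto simp: well_inside_def)
  obtain \<eta> B where \<eta>: "\<eta> > 0" "B \<ge> 0" "\<And>t z. t \<ge> 0 \<Longrightarrow> norm z \<le> \<eta> * t \<Longrightarrow> action_le t z (B * t)"
    using action_le_small by blast
  define K where "K = (B + 2 * \<bar>M\<bar> / \<delta>) / \<eta>"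
  have "u y - u x \<le> K * norm (y - x)" if xy: "x \<in> V" "y \<in> V" "norm (y - x) \<le> \<eta> * \<delta>" for x y
  proof (cases "y = x")
    case False
    define t where "t = norm (y - x) / \<eta>"
    have t: "t > 0" "t \<le> \<delta>" "norm (y - x) = \<eta> * t"
      using False xy(3) \<eta>(1) by (auto simp: t_def field_simps)
    have U: "x \<in> U" "y \<in> U" using xy VU by auto
    have "u y - B * t \<le> hflow t x" using \<eta>(3) t U by (intro hflow_ge) auto
    also have "\<dots> \<le> u x + t / \<delta> * (hflow \<delta> x - u x)"
      using t \<delta> by (intro hflow_le_chord[OF U(1) \<delta>(2)[OF xy(1)]]) auto
    also have "\<dots> \<le> u x + t / \<delta> * (2 * \<bar>M\<bar>)"
      using hflow_le_bound[OF U(1), of \<delta>] u_bound[OF U(1)] t \<delta>(1)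
      by (intro add_left_mono mult_left_mono) auto
    finally have "u y - u x \<le> (B + 2 * \<bar>M\<bar> / \<delta>) * t" by (simp add: algebra_simps)
    then show ?thesis using \<eta>(1) by (simp add: K_def t_def)
  qed simp
  moreover have "0 \<le> K" using \<eta> \<delta>(1) by (simp add: K_def)
  ultimately show "\<exists>\<rho>>0. \<exists>K\<ge>0. \<forall>x\<in>V. \<forall>y\<in>V. norm (y - x) \<le> \<rho> \<longrightarrow> u y - u x \<le> K * norm (y - x)"
    using \<eta>(1) \<delta>(1) by (intro exI[of _ "\<eta> * \<delta>"] conjI exI[of _ K]) auto
qed

lemma convexity_imp_pointwise:
  assumes cc: "convexity_criterion H U u"
  shows "pointwise_convexity_criterion H U u"
  unfolding pointwise_convexity_criterion_def hflow_def[symmetric]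
proof (intro conjI)
  show lip: "u \<in> lip_loc U" using cc by (rule convexity_imp_lip_loc)
  show "bounded (u ` U)" using cc by (simp add: convexity_criterion_def)
  have conv: "\<exists>\<delta>>0. \<forall>x\<in>V. convex_on {0..\<delta>} (\<lambda>t. hflow t x)" if "V \<lless> U" for V
    using cc that unfolding convexity_criterion_def hflow_def[symmetric] by blast
  show "\<forall>x\<in>U. \<exists>\<delta>>0. convex_on {0..\<delta>} (\<lambda>t. hflow t x)"
  proof
    fix x assume "x \<in> U"
    then obtain r where "r > 0" "ball x r \<lless> U" using well_inside_ball[OF open_U] by blast
    then show "\<exists>\<delta>>0. convex_on {0..\<delta>} (\<lambda>t. hflow t x)"
      using conv[of "ball x r"] by (meson centre_in_ball)
  qed
  show "usc_on U (S_plus H U u)"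
    unfolding usc_on_def
  proof
    fix c
    have "open {x \<in> U. S_plus H U u x < c}"
    proof (subst open_subopen, rule ballI)
      fix x assume "x \<in> {x \<in> U. S_plus H U u x < c}"
      then have x: "x \<in> U" "S_plus H U u x < c" by auto
      obtain r where r: "r > 0" "ball x r \<lless> U" using well_inside_ball[OF open_U x(1)] by blast
      then have rU: "ball x r \<subseteq> U" using closure_subset[of "ball x r"] unfolding well_inside_def by blast
      obtain \<delta> where \<delta>: "\<delta> > 0" "\<And>y. y \<in> ball x r \<Longrightarrow> convex_on {0..\<delta>} (\<lambda>t. hflow t y)"
        using conv[OF r(2)] by blast
      obtain \<delta>' L d where \<delta>': "\<delta>' > 0" and L: "L \<ge> 0" and d: "d > 0"
        and lipx: "\<And>y z t. y \<in> ball x r \<Longrightarrow> z \<in> ball x r \<Longrightarrow> 0 \<le> t \<Longrightarrow> t \<le> \<delta>' \<Longrightarrow> norm (z - y) \<le> d \<Longrightarrow>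
          hflow t y - hflow t z \<le> L * norm (z - y)"
        using hflow_space_lipschitz[OF lip r(2)] by blast
      obtain e where e: "e > 0" "\<And>s. 0 < s \<Longrightarrow> s < e \<Longrightarrow> ereal ((hflow s x - u x) / s) < c"
        using S_plus_lessD[OF x] by blast
      define t where "t = min (min \<delta> \<delta>') (e / 2)"
      have t: "0 < t" "t \<le> \<delta>" "t \<le> \<delta>'" "t < e" using \<delta> \<delta>' e by (auto simp: t_def)
      define q where "q = (hflow t x - u x) / t"
      have "ereal q < c" using e(2) t by (simp add: q_def)
      then obtain c' where c': "q < c'" "ereal c' < c" using ereal_dense2 by force
      \<comment> \<open>Moving the base point changes \<open>hflow t\<close> and \<open>u\<close>,
        which is the flow at time 0, by at most L \<rho> each; the quotient at the fixed time t must
        stay below c'.\<close>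
      define \<rho> where "\<rho> = min (min r d) ((c' - q) * t / (2 * L + 1))"
      have \<rho>: "\<rho> > 0" "\<rho> \<le> r" "\<rho> \<le> d" "\<rho> * (2 * L + 1) \<le> (c' - q) * t"
      proof -
        have L1: "0 < 2 * L + 1" using L by simp
        have "0 < (c' - q) * t / (2 * L + 1)" using L1 c' t by simp
        then show "\<rho> > 0" using r d by (simp add: \<rho>_def)
        have "\<rho> \<le> (c' - q) * t / (2 * L + 1)" by (simp add: \<rho>_def)
        then show "\<rho> * (2 * L + 1) \<le> (c' - q) * t" using L1 by (simp only: pos_le_divide_eq)
      qed (auto simp: \<rho>_def)
      have "ball x \<rho> \<subseteq> {x \<in> U. S_plus H U u x < c}"
      proof
        fix y assume y: "y \<in> ball x \<rho>"
        then have yr: "y \<in> ball x r" "norm (y - x) < \<rho>" "norm (x - y) = norm (y - x)"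
          using \<rho> by (auto simp: dist_norm norm_minus_commute)
        have yU: "y \<in> U" using yr rU by blast
        have "hflow t y - hflow t x \<le> L * norm (y - x)"
          using lipx[of y x t] yr \<rho> r t by simp
        moreover have "u x - u y \<le> L * norm (y - x)"
          using lipx[of x y 0] yr \<rho> r \<delta>' by simp
        moreover have "hflow t x - u x = q * t" using t by (simp add: q_def)
        ultimately have "hflow t y - u y \<le> q * t + norm (y - x) * (2 * L)" by (simp add: algebra_simps)
        also have "norm (y - x) * (2 * L) \<le> \<rho> * (2 * L)" using yr L by (intro mult_right_mono) auto
        also have "q * t + \<rho> * (2 * L) < c' * t" using \<rho>(1,4) by (simp add: algebra_simps)
        finally have "(hflow t y - u y) / t < c'" using t(1) by (simp add: field_simps)
        then have "ereal ((hflow t y - u y) / t) < c" using c'(2) by (meson ereal_less_eq(3) less_imp_le order_le_less_trans)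
        moreover have "S_plus H U u y \<le> ereal ((hflow t y - u y) / t)"
          by (rule S_plus_le_quotient[OF yU \<delta>(2)[OF yr(1)] t(1,2)])
        ultimately show "y \<in> {x \<in> U. S_plus H U u x < c}" using yU by simp
      qed
      then show "\<exists>T. open T \<and> x \<in> T \<and> T \<subseteq> {x \<in> U. S_plus H U u x < c}"
        using \<rho>(1) by (intro exI[of _ "ball x \<rho>"]) auto
    qed
    then show "openin (top_of_set U) {x \<in> U. S_plus H U u x < c}"
      using open_U by (auto simp: openin_open_eq)
  qed
qed

section \<open>Uphill steps and the way from pointwise convexity to minimality\<close>

text \<open>Travelling along h z in time h \<tau> costs h (C_\<kappa>(z) - \<kappa> \<tau>). If
  \<open>u\<close> gains h (C_\<kappa>(z) - \<eta>) on the way, the flow gains \<kappa> \<tau> -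
  \<eta> per time \<tau>.\<close>

lemma S_plus_ge_directional:
  assumes w: "w \<in> U" and z: "z \<noteq> 0" and \<tau>: "0 < \<tau>" "action_le \<tau> z (cone H \<kappa> z - \<kappa> * \<tau>)"
    and h0: "0 < h0" "\<And>h. 0 < h \<Longrightarrow> h < h0 \<Longrightarrow> h * (cone H \<kappa> z - \<eta>) \<le> u (w + h *\<^sub>R z) - u w"
  shows "ereal (\<kappa> - \<eta> / \<tau>) \<le> S_plus H U u w"
proof -
  obtain r where r: "r > 0" "ball w r \<subseteq> U" using open_U w open_contains_ball by blast
  show ?thesis
  proof (rule S_plus_ge[OF w])
    show "0 < min h0 (r / norm z) * \<tau>" using h0(1) r(1) z \<tau>(1) by simp
    fix s assume s: "0 < s" "s < min h0 (r / norm z) * \<tau>"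
    define h where "h = s / \<tau>"
    have "h < min h0 (r / norm z)" using s(2) \<tau>(1) unfolding h_def by (simp only: pos_divide_less_eq)
    then have h: "0 < h" "h < h0" "h < r / norm z" "s = h * \<tau>"
      using s \<tau>(1) by (auto simp: h_def)
    have "h * norm z < r" using h(3) z by (simp add: pos_less_divide_eq)
    then have "w + h *\<^sub>R z \<in> ball w r" using h(1) by (simp add: dist_norm)
    then have U: "w + h *\<^sub>R z \<in> U" using r(2) by blast
    have "action_le s (h *\<^sub>R z) (h * (cone H \<kappa> z - \<kappa> * \<tau>))"
      using action_le_scale[OF \<tau>(2), of h] h by simp
    then have "u (w + h *\<^sub>R z) - h * (cone H \<kappa> z - \<kappa> * \<tau>) \<le> hflow s w"
      using s(1) h(1) by (intro hflow_ge[OF w U]) auto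
    moreover have "(\<kappa> - \<eta> / \<tau>) * s = h * (\<kappa> * \<tau> - \<eta>)" using \<tau>(1) by (simp add: h(4) field_simps)
    ultimately show "(\<kappa> - \<eta> / \<tau>) * s \<le> hflow s w - u w"
      using h0(2)[OF h(1,2)] by (simp add: algebra_simps)
  qed
qed

text \<open>Maximizing over the pair of endpoint and cost at once gives a continuous function on a
  compact set. Costs above 2 |M| and points at distance at least d cannot compete with staying at
  x.\<close>

lemma hflow_attained:
  assumes lip: "u \<in> lip_loc U" and x: "x \<in> U" and d: "0 < d" "cball x d \<subseteq> U"
  shows "\<exists>\<delta>>0. \<forall>t. 0 \<le> t \<longrightarrow> t \<le> \<delta> \<longrightarrow> (\<exists>y c. y \<in> cball x d \<and> action_le t (y - x) c \<and> hflow t x = u y - c)"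
proof -
  obtain \<delta> where \<delta>: "\<delta> > 0" and far: "\<And>x y t c. y \<in> U \<Longrightarrow> t \<le> \<delta> \<Longrightarrow>
      action_le t (y - x) c \<Longrightarrow> d \<le> norm (y - x) \<Longrightarrow> u y - c < - M"
    using far_points_irrelevant[OF d(1)] by blast
  have "\<exists>y c. y \<in> cball x d \<and> action_le t (y - x) c \<and> hflow t x = u y - c" if t: "0 \<le> t" "t \<le> \<delta>" for t
  proof -
    define A where "A = {w. action_le t (fst w - x) (snd w)}"
    define Z where "Z = (cball x d \<times> {0..2 * \<bar>M\<bar>}) \<inter> A"
    have "A = (\<lambda>w. (fst w - x, snd w)) -` {w. action_le t (fst w) (snd w)}"
      by (auto simp: A_def)
    moreover have "continuous_on UNIV (\<lambda>w :: 'a \<times> real. (fst w - x, snd w))"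
      by (intro continuous_intros)
    ultimately have "closed A"
      using closed_vimage[OF closed_action_le] by metis
    then have "compact Z" unfolding Z_def by (intro compact_Int_closed compact_Times compact_cball compact_Icc)
    moreover have x0: "(x, 0) \<in> Z" using d(1) t action_le_0[of t] by (auto simp: Z_def A_def)
    moreover have "continuous_on Z (\<lambda>w. u (fst w) - snd w)"
    proof (intro continuous_on_diff continuous_on_snd continuous_on_id)
      show "continuous_on Z (\<lambda>w. u (fst w))"
        by (rule continuous_on_compose2[OF lip_loc_continuous_on[OF open_U lip]])
          (use d(2) in \<open>auto simp: Z_def intro!: continuous_intros\<close>)
    qed
    ultimately obtain w where w: "w \<in> Z" "\<And>w'. w' \<in> Z \<Longrightarrow> u (fst w') - snd w' \<le> u (fst w) - snd w"
      using continuous_attains_sup[of Z "\<lambda>w. u (fst w) - snd w"] by blast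
    have wA: "fst w \<in> cball x d" "action_le t (fst w - x) (snd w)" using w(1) by (auto simp: Z_def A_def)
    have low: "- M \<le> u (fst w) - snd w" using w(2)[OF x0] u_bound[OF x] by simp
    have "hflow t x = u (fst w) - snd w"
    proof (rule antisym)
      show "u (fst w) - snd w \<le> hflow t x"
        using wA d(2) t by (intro hflow_ge[OF x]) auto
      show "hflow t x \<le> u (fst w) - snd w"
      proof (rule hflow_le[OF x t(1)])
        fix y c assume y: "y \<in> U" and c: "action_le t (y - x) c"
        consider "d \<le> norm (y - x)" | "2 * \<bar>M\<bar> < c" | "norm (y - x) < d" "c \<le> 2 * \<bar>M\<bar>" by linarith
        then show "u y - c \<le> u (fst w) - snd w"
        proof cases
          case 1
          then show ?thesis using far[OF y t(2) c] low by simp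
        next
          case 2
          then show ?thesis using u_bound[OF y] low by linarith
        next
          case 3
          then have "(y, c) \<in> Z"
            using c action_le_nonneg[OF c] by (auto simp: Z_def A_def dist_norm norm_minus_commute)
          then show ?thesis using w(2) by fastforce
        qed
      qed
    qed
    then show ?thesis using wA by blast
  qed
  then show ?thesis using \<delta> by blast
qed

text \<open>A maximizer in the flow formula for small time lies uphill and has at least the same slope:
  by convexity \<^term>\<open>u\<close> lies below its chord on the segment from \<open>x\<close> to \<open>y\<close>, so points of slope
  almost \<open>\<kappa>\<close> accumulate at \<open>y\<close>.\<close>

lemma S_plus_uphill:
  assumes pcc: "pointwise_convexity_criterion H U u"
    and V: "open V" "V \<subseteq> U" "x \<in> V" and \<kappa>: "0 < \<kappa>" "ereal \<kappa> \<le> S_plus H U u x"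
  shows "\<exists>y\<in>V. y \<noteq> x \<and> closed_segment x y \<subseteq> V \<and> cone H \<kappa> (y - x) \<le> u y - u x \<and> ereal \<kappa> \<le> S_plus H U u y"
proof -
  have lip: "u \<in> lip_loc U" and usc: "usc_on U (S_plus H U u)"
    using pcc by (auto simp: pointwise_convexity_criterion_def)
  have xU: "x \<in> U" using V by blast
  obtain \<delta> where \<delta>: "\<delta> > 0" "convex_on {0..\<delta>} (\<lambda>t. hflow t x)"
    using pcc xU unfolding pointwise_convexity_criterion_def hflow_def[symmetric] by blast
  obtain d where d: "d > 0" "cball x d \<subseteq> V" using V open_contains_cball by blast
  then obtain \<delta>' where \<delta>': "\<delta>' > 0" and att: "\<And>t. 0 \<le> t \<Longrightarrow> t \<le> \<delta>' \<Longrightarrow>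
      \<exists>y c. y \<in> cball x d \<and> action_le t (y - x) c \<and> hflow t x = u y - c"
    using hflow_attained[OF lip xU d(1)] V(2) by blast
  define t where "t = min \<delta> \<delta>'"
  have t: "0 < t" "t \<le> \<delta>" "t \<le> \<delta>'" using \<delta> \<delta>' by (auto simp: t_def)
  obtain y c where y: "y \<in> cball x d" and c: "action_le t (y - x) c" and eq: "hflow t x = u y - c"
    using att[of t] t by auto
  define z where "z = y - x"
  have seg: "closed_segment x y \<subseteq> cball x d"
    using y d(1) by (intro closed_segment_subset convex_cball) auto
  have yV: "y \<in> V" using y d by blast
  have "ereal \<kappa> \<le> ereal ((hflow t x - u x) / t)"
    using \<kappa>(2) S_plus_le_quotient[OF xU \<delta>(2) t(1,2)] by (rule order_trans)
  then have rise: "\<kappa> * t + c \<le> u y - u x" using t(1) eq by (simp add: pos_le_divide_eq)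
  then have up: "cone H \<kappa> z \<le> u y - u x"
    using action_leD_cone[OF c, of \<kappa>] \<kappa>(1) by (simp add: z_def)
  have "y \<noteq> x"
  proof
    assume "y = x"
    then show False using rise action_le_nonneg[OF c] mult_pos_pos[OF \<kappa>(1) t(1)] by simp
  qed
  then have z: "z \<noteq> 0" by (simp add: z_def)
  define \<phi> where "\<phi> s = u (x + s *\<^sub>R z)" for s
  have in_seg: "x + s *\<^sub>R z \<in> closed_segment x y" if "s \<in> {0..1}" for s
    using that by (auto simp: in_segment z_def algebra_simps intro!: exI[of _ s])
  then have in_V: "x + s *\<^sub>R z \<in> V" if "s \<in> {0..1}" for s
    using that seg d(2) by blast
  \<comment> \<open>The point at fraction s is reached in time s t at cost s c, and convexity bounds
    the flow at time s t by its chord.\<close>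
  have below: "\<phi> s \<le> (1 - s) * u x + s * u y" if s: "s \<in> {0..1}" for s
  proof -
    have "action_le (s * t) (x + s *\<^sub>R z - x) (s * c)"
      using action_le_scale[OF c, of s] s by (simp add: z_def)
    then have "\<phi> s - s * c \<le> hflow (s * t) x"
      unfolding \<phi>_def using in_V[OF s] V(2) s t(1) by (intro hflow_ge[OF xU]) auto
    also have "\<dots> \<le> u x + s * t / t * (hflow t x - u x)"
      using s t by (intro hflow_le_chord[OF xU \<delta>(2)]) (auto simp: mult_left_le_one_le)
    finally show ?thesis using t(1) by (simp add: eq algebra_simps)
  qed
  have cont\<phi>: "continuous_on {0..1} \<phi>"
    unfolding \<phi>_def
    by (rule continuous_on_compose2[OF lip_loc_continuous_on[OF open_U lip]])
      (use in_V V(2) in \<open>auto intro!: continuous_intros\<close>)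
  obtain \<tau> where \<tau>: "\<tau> > 0" "action_le \<tau> z (cone H \<kappa> z - \<kappa> * \<tau>)"
    using cone_optimal_time[OF \<kappa>(1) z] by blast
  have near: "\<exists>s\<in>{a..<1}. ereal (\<kappa> - \<eta> / \<tau>) \<le> S_plus H U u (x + s *\<^sub>R z)"
    if a: "0 \<le> a" "a < 1" and \<eta>: "0 < \<eta>" for a \<eta>
  proof -
    \<comment> \<open>Near the endpoint the chord bound forces \<open>u\<close> to rise at rate at
      least C_\<kappa>(z) on average. Removing slightly less leaves a strict increase up to 1, and
      the last exit supplies a point where the rate holds to the right.\<close>
    define \<psi> where "\<psi> s = \<phi> s - (cone H \<kappa> z - \<eta>) * s" for s
    have "(1 - a) * (cone H \<kappa> z) \<le> (1 - a) * (u y - u x)"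
      using up a by (intro mult_left_mono) auto
    moreover have "(1 - a) * \<eta> > 0" using a \<eta> by simp
    moreover have "\<phi> 1 = u y" by (simp add: \<phi>_def z_def)
    ultimately have "\<psi> a < \<psi> 1" using below[of a] a by (simp add: \<psi>_def algebra_simps)
    moreover have "continuous_on {a..1} \<psi>"
      unfolding \<psi>_def using continuous_on_subset[OF cont\<phi>, of "{a..1}"] a
      by (intro continuous_intros) auto
    ultimately obtain s where s: "s \<in> {a..<1}" "\<And>r. r \<in> {s<..1} \<Longrightarrow> \<psi> s < \<psi> r"
      using last_exit[of a 1 \<psi>] a by auto
    have "ereal (\<kappa> - \<eta> / \<tau>) \<le> S_plus H U u (x + s *\<^sub>R z)"
    proof (rule S_plus_ge_directional[OF _ z \<tau>])
      show "x + s *\<^sub>R z \<in> U" using in_V[of s] V(2) s a by auto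
      show "0 < 1 - s" using s by simp
      fix h assume h: "0 < h" "h < 1 - s"
      have "\<psi> s < \<psi> (s + h)" using s h by auto
      then show "h * (cone H \<kappa> z - \<eta>) \<le> u (x + s *\<^sub>R z + h *\<^sub>R z) - u (x + s *\<^sub>R z)"
        by (simp add: \<psi>_def \<phi>_def algebra_simps)
    qed
    then show ?thesis using s(1) by blast
  qed
  have "ereal \<kappa> \<le> S_plus H U u y"
  proof (rule ccontr)
    assume "\<not> ereal \<kappa> \<le> S_plus H U u y"
    then obtain q where q: "S_plus H U u y < ereal q" "q < \<kappa>"
      using ereal_dense2[of "S_plus H U u y" "ereal \<kappa>"] by (auto simp: not_le)
    have "open {w \<in> U. S_plus H U u w < ereal q}" using usc_on_imp_open[OF open_U usc] .
    then obtain r where r: "r > 0" "ball y r \<subseteq> {w \<in> U. S_plus H U u w < ereal q}"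
      using q yV V(2) open_contains_ball by (metis (no_types, lifting) mem_Collect_eq subsetD)
    define a where "a = max 0 (1 - r / (2 * norm z))"
    have a: "0 \<le> a" "a < 1" using r(1) z by (auto simp: a_def)
    \<comment> \<open>The tolerance is chosen so that \<kappa> - \<eta> / \<tau> equals q, and
      \<open>a\<close> so close to 1 that the point lies in the ball around y.\<close>
    obtain s where s: "s \<in> {a..<1}" "ereal (\<kappa> - (\<kappa> - q) * \<tau> / \<tau>) \<le> S_plus H U u (x + s *\<^sub>R z)"
      using near[OF a, of "(\<kappa> - q) * \<tau>"] q \<tau>(1) by auto
    have "y - (x + s *\<^sub>R z) = (1 - s) *\<^sub>R z" by (simp add: z_def algebra_simps)
    then have "dist y (x + s *\<^sub>R z) = (1 - s) * norm z" using s by (simp add: dist_norm)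
    also have "\<dots> \<le> r / (2 * norm z) * norm z"
      using s by (intro mult_right_mono) (auto simp: a_def)
    also have "\<dots> < r" using r(1) z by simp
    finally have "S_plus H U u (x + s *\<^sub>R z) < ereal q" using r(2) by auto
    then show False using s(2) \<tau>(1) by simp
  qed
  then show ?thesis
    using yV \<open>y \<noteq> x\<close> seg d(2) up by (intro bexI[of _ y]) (auto simp: z_def)
qed

lemma pointwise_imp_subminimizing:
  assumes pcc: "pointwise_convexity_criterion H U u"
  shows "absolutely_subminimizing H U u"
  unfolding absolutely_subminimizing_def
proof (intro conjI allI impI)
  show lip: "u \<in> lip_loc U" using pcc by (simp add: pointwise_convexity_criterion_def)
  have usc: "usc_on U (S_plus H U u)" using pcc by (simp add: pointwise_convexity_criterion_def)
  fix V v
  assume V: "V \<lless> U" and v: "v \<in> lip_loc V" "continuous_on (closure V) v"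
    and bd: "\<forall>x\<in>frontier V. v x = u x" and le: "\<forall>x\<in>V. v x \<le> u x"
  have openV: "open V" and comp: "compact (closure V)" and clU: "closure V \<subseteq> U"
    using V by (auto simp: well_inside_def)
  then have VU: "V \<subseteq> U" using closure_subset by blast
  define m where "m = H_norm H V v"
  have "ereal (H (grad u x)) \<le> m" if x: "x \<in> V" for x
  proof (rule ccontr)
    assume nle: "\<not> ereal (H (grad u x)) \<le> m"
    define N where "N = {y \<in> V. \<not> ereal (H (grad v y)) \<le> m}"
    have N: "negligible N"
      unfolding N_def m_def H_norm_def by (rule negligible_iff_AE_lebesgue_on[OF openV esssup_AE])
    \<comment> \<open>A point outside \<open>N\<close> gives 0 \<le> m, so the essential supremum is
      not minus infinity.\<close>
    have "\<not> V \<subseteq> N"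
      using open_not_negligible[OF openV] x N negligible_subset by blast
    then obtain y where "ereal (H (grad v y)) \<le> m" by (auto simp: N_def)
    then have "0 \<le> m" using H_nonneg[of "grad v y"] by (meson ereal_less_eq(5) order_trans)
    then obtain k where k: "m = ereal k" "0 \<le> k" using nle by (cases m) auto
    then have less: "k < H (grad u x)" using nle by simp
    have v_seg: "v b - v a \<le> cone H k (b - a)" if "closed_segment a b \<subseteq> V" for a b
    proof (rule segment_increment_le_AE[OF openV v(1) N _ that])
      fix y assume "y \<in> V - N"
      then have "H (grad v y) \<le> k" by (simp add: N_def k)
      then show "(b - a) \<bullet> grad v y \<le> cone H k (b - a)" by (subst inner_commute) (rule cone_upper)
    qed
    \<comment> \<open>Above k, so that uphill steps gain strictly on \<open>v\<close>; below
      H(Du(x)), so that separation finds a direction in which \<open>u\<close> grows faster than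
      C_\<kappa>.\<close>
    define \<kappa> where "\<kappa> = (k + H (grad u x)) / 2"
    have \<kappa>: "k < \<kappa>" "\<kappa> < H (grad u x)" "0 < \<kappa>" using less k(2) by (auto simp: \<kappa>_def)
    have step: "\<exists>y\<in>V. u w - v w < u y - v y \<and> ereal \<kappa> \<le> S_plus H U u y"
      if w: "w \<in> V" "ereal \<kappa> \<le> S_plus H U u w" for w
    proof -
      obtain y where y: "y \<in> V" "y \<noteq> w" "closed_segment w y \<subseteq> V" "cone H \<kappa> (y - w) \<le> u y - u w"
        "ereal \<kappa> \<le> S_plus H U u y"
        using S_plus_uphill[OF pcc openV VU w(1) \<kappa>(3) w(2)] by blast
      have "cone H k (y - w) < cone H \<kappa> (y - w)"
        using k(2) \<kappa>(1) y(2) by (intro cone_strict_mono) auto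
      then show ?thesis using v_seg[OF y(3)] y by (intro bexI[of _ y]) auto
    qed
    \<comment> \<open>Elsewhere the gradient has the default value 0, where \<open>H\<close>
      vanishes and cannot exceed k.\<close>
    have diff: "u differentiable (at x)"
    proof (rule ccontr)
      assume "\<not> u differentiable (at x)"
      then show False using less k(2) by (simp add: grad_def H_zero)
    qed
    obtain e where e: "cone H \<kappa> e < grad u x \<bullet> e"
      using cone_separation[of \<kappa> "grad u x"] \<kappa> by auto
    then have "e \<noteq> 0" using \<kappa>(3) by auto
    then obtain \<tau> where \<tau>: "\<tau> > 0" "action_le \<tau> e (cone H \<kappa> e - \<kappa> * \<tau>)"
      using cone_optimal_time[OF \<kappa>(3)] by blast
    have "\<forall>\<^sub>F h in at_right 0. cone H \<kappa> e < (u (x + h *\<^sub>R e) - u x) / h"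
      using order_tendstoD(1)[OF has_dir_deriv_grad[OF diff, of e, unfolded has_dir_deriv_def]] e
      by (simp add: inner_commute)
    then obtain h0 where h0: "h0 > 0" "\<And>h. 0 < h \<Longrightarrow> h < h0 \<Longrightarrow> cone H \<kappa> e < (u (x + h *\<^sub>R e) - u x) / h"
      by (rule at_right_zeroE) (rule that)
    have "ereal (\<kappa> - 0 / \<tau>) \<le> S_plus H U u x"
    proof (rule S_plus_ge_directional[OF _ \<open>e \<noteq> 0\<close> \<tau> h0(1)])
      show "x \<in> U" using x VU by blast
      show "h * (cone H \<kappa> e - 0) \<le> u (x + h *\<^sub>R e) - u x" if "0 < h" "h < h0" for h
        using h0(2)[OF that] that by (simp add: pos_less_divide_eq mult.commute)
    qed
    then have Sx: "ereal \<kappa> \<le> S_plus H U u x" by simp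
    \<comment> \<open>Compact because the removed set is open by upper semicontinuity; uphill steps
      from points of \<open>V\<close> end in \<open>A\<close> again.\<close>
    define A where "A = closure V - {w \<in> U. S_plus H U u w < ereal \<kappa>}"
    have A_iff: "w \<in> A \<longleftrightarrow> w \<in> closure V \<and> ereal \<kappa> \<le> S_plus H U u w" for w
      using clU by (auto simp: A_def not_less)
    have "compact A"
      unfolding A_def using comp usc_on_imp_open[OF open_U usc] by (rule compact_diff)
    moreover have "x \<in> A" using x Sx closure_subset by (auto simp: A_iff)
    moreover have "continuous_on A (\<lambda>w. u w - v w)"
      using continuous_on_subset[OF lip_loc_continuous_on[OF open_U lip] clU] v(2)
      by (intro continuous_on_diff) (auto elim!: continuous_on_subset simp: A_iff)
    ultimately obtain w where w: "w \<in> A" "\<And>y. y \<in> A \<Longrightarrow> u y - v y \<le> u w - v w"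
      using continuous_attains_sup[of A "\<lambda>w. u w - v w"] by blast
    have VA: "y \<in> A" if "y \<in> V" "ereal \<kappa> \<le> S_plus H U u y" for y
      using that closure_subset by (auto simp: A_iff)
    \<comment> \<open>At x itself the difference may be 0; one uphill step makes the maximum
      strictly positive.\<close>
    obtain y where y: "y \<in> V" "u x - v x < u y - v y" "ereal \<kappa> \<le> S_plus H U u y"
      using step[OF x Sx] by blast
    have "0 < u w - v w" using w(2)[OF VA[OF y(1,3)]] y(2) le x by fastforce
    then have "w \<notin> frontier V" using bd by auto
    then have "w \<in> V" using w(1) openV by (auto simp: A_iff frontier_def interior_open)
    then obtain y' where "y' \<in> V" "u w - v w < u y' - v y'" "ereal \<kappa> \<le> S_plus H U u y'"
      using step w(1) by (auto simp: A_iff)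
    then show False using w(2)[OF VA] by fastforce
  qed
  then show "H_norm H V u \<le> H_norm H V v"
    unfolding H_norm_def m_def[unfolded H_norm_def, symmetric]
    using borel_measurable_H_grad[OF openV lip_loc_mono[OF VU lip] continuous_H]
    by (intro esssup_I) (auto intro!: AE_I2 simp: space_restrict_space)
qed

section \<open>From minimality to comparison with cones\<close>

text \<open>By subadditivity the cone grows at most like C_k(e) in every direction e, so separation
  excludes a gradient outside {H \<le> k}.\<close>

lemma H_grad_cone_le:
  assumes "0 \<le> k"
  shows "H (grad (\<lambda>x. cone H k (x - x0) + c) x) \<le> k"
proof (rule ccontr)
  let ?v = "\<lambda>x. cone H k (x - x0) + c"
  assume "\<not> H (grad ?v x) \<le> k"
  then have less: "k < H (grad ?v x)" by simp
  then have diff: "?v differentiable (at x)"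
    using assms by (auto simp: grad_def H_zero split: if_splits)
  obtain e where e: "cone H k e < grad ?v x \<bullet> e"
    using cone_separation[OF assms less] by blast
  have "e \<bullet> grad ?v x \<le> cone H k e"
  proof (rule tendsto_upperbound[OF has_dir_deriv_grad[OF diff, of e, unfolded has_dir_deriv_def]])
    have "(?v (x + t *\<^sub>R e) - ?v x) / t \<le> cone H k e" if "t > 0" for t
      using cone_add_le[OF assms, of "x - x0" "t *\<^sub>R e"] cone_scaleR[OF assms, of t e] that
      by (simp add: pos_divide_le_eq algebra_simps)
    then show "\<forall>\<^sub>F t in at_right 0. (?v (x + t *\<^sub>R e) - ?v x) / t \<le> cone H k e"
      unfolding eventually_at_right_field by (auto intro!: exI[of _ 1])
  qed simp
  with e show False by (simp add: inner_commute)
qed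

lemma subminimizing_imp_comparison:
  assumes sub: "absolutely_subminimizing H U u"
  shows "comparison_with_cones_above H U u"
  unfolding comparison_with_cones_above_def
proof (intro conjI allI impI)
  have lip: "u \<in> lip_loc U" using sub by (simp add: absolutely_subminimizing_def)
  have cont: "continuous_on U u" using open_U lip by (rule lip_loc_continuous_on)
  show "usc_on U u"
    unfolding usc_on_def
  proof
    fix c
    show "openin (top_of_set U) {x \<in> U. u x < c}"
      using continuous_openin_preimage_gen[OF cont open_lessThan[of c]] by (simp add: vimage_def Int_def)
  qed
  fix k :: real and V and x0 :: 'a
  assume k: "0 \<le> k" and V: "V \<lless> U" and x0: "x0 \<notin> V"
  let ?f = "\<lambda>x. u x - cone H k (x - x0)"
  have openV: "open V" and comp: "compact (closure V)" and clU: "closure V \<subseteq> U"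
    using V by (auto simp: well_inside_def)
  then have VU: "V \<subseteq> U" using closure_subset by blast
  show "max_on (closure V) ?f = max_on (frontier V) ?f"
  proof (cases "V = {}")
    case False
    have contf: "continuous_on (closure V) ?f"
      using continuous_on_subset[OF cont clU] by (intro continuous_on_diff continuous_on_cone_diff k)
    have "frontier V \<noteq> {}" using frontier_nonempty_bounded[OF comp False] .
    have fsub: "frontier V \<subseteq> closure V" by (simp add: frontier_def)
    have "compact (frontier V)"
      using compact_frontier_bounded bounded_subset[OF compact_imp_bounded[OF comp] closure_subset] by blast
    then obtain b where b: "b \<in> frontier V" "\<And>x. x \<in> frontier V \<Longrightarrow> ?f x \<le> ?f b"
      using continuous_attains_sup[OF _ \<open>frontier V \<noteq> {}\<close> continuous_on_subset[OF contf fsub]] by blast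
    obtain a where a: "a \<in> closure V" "\<And>x. x \<in> closure V \<Longrightarrow> ?f x \<le> ?f a"
      using continuous_attains_sup[OF comp _ contf] False by auto
    have "\<not> ?f b < ?f a"
    proof
      assume "?f b < ?f a"
      \<comment> \<open>Above all boundary values, so the superlevel set \<open>W\<close> has its
        frontier inside \<open>V\<close>, where u equals the cone plus c: the cone is then an
        admissible competitor in \<open>W\<close>.\<close>
      define c where "c = (?f a + ?f b) / 2"
      have c: "?f b < c" "c < ?f a" using \<open>?f b < ?f a\<close> by (auto simp: c_def)
      have "a \<in> V" using a(1) b(2)[of a] \<open>?f b < ?f a\<close> openV by (auto simp: frontier_def interior_open)
      define W where "W = {x \<in> V. c < ?f x}"
      have "W = V \<inter> ?f -` {c<..}" by (auto simp: W_def)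
      then have openW: "open W"
        using continuous_open_preimage[OF continuous_on_subset[OF contf closure_subset] openV open_greaterThan]
        by simp
      have WV: "W \<subseteq> V" by (auto simp: W_def)
      then have clW: "closure W \<subseteq> closure V" by (rule closure_mono)
      then have "compact (closure W)"
        using compact_Int_closed[OF comp, of "closure W"] by (simp add: Int_absorb1)
      then have W: "W \<lless> U" using openW clW clU by (auto simp: well_inside_def)
      have clWf: "closure W \<subseteq> {x \<in> closure V. c \<le> ?f x}"
      proof (rule closure_minimal)
        show "W \<subseteq> {x \<in> closure V. c \<le> ?f x}" using closure_subset[of V] by (auto simp: W_def)
        show "closed {x \<in> closure V. c \<le> ?f x}"
          using continuous_closed_preimage[OF contf closed_closure closed_atLeast[of c]]
          by (simp add: vimage_def Int_def)
      qed
      have fr: "?f x = c" if "x \<in> frontier W" for x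
      proof -
        from that have x: "x \<in> closure W" "x \<notin> W" using openW by (auto simp: frontier_def interior_open)
        then have "x \<in> closure V" "c \<le> ?f x" using clWf by auto
        moreover have "x \<notin> frontier V" using b(2)[of x] c(1) \<open>c \<le> ?f x\<close> by linarith
        ultimately have "x \<in> V" using openV by (auto simp: frontier_def interior_open)
        then show ?thesis using x(2) \<open>c \<le> ?f x\<close> by (auto simp: W_def)
      qed
      define v where "v x = cone H k (x - x0) + c" for x
      obtain R where R: "R-lipschitz_on UNIV (cone H k)" using cone_lipschitz[OF k] by blast
      have "R-lipschitz_on UNIV v"
      proof (rule lipschitz_onI)
        show "dist (v x) (v y) \<le> R * dist x y" for x y
          using lipschitz_onD[OF R, of "x - x0" "y - x0"] by (simp add: v_def dist_norm)
      qed (rule lipschitz_on_nonneg[OF R])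
      then have vlip: "v \<in> lip_loc W" by (auto simp: lip_loc_def intro: lipschitz_on_subset)
      have "continuous_on (closure W) v"
        unfolding v_def by (intro continuous_on_add continuous_on_cone_diff k continuous_on_const)
      moreover have "v x = u x" if "x \<in> frontier W" for x using fr[OF that] by (simp add: v_def)
      moreover have "\<forall>x\<in>W. v x \<le> u x" by (auto simp: v_def W_def)
      ultimately have "H_norm H W u \<le> H_norm H W v"
        using sub W vlip unfolding absolutely_subminimizing_def by blast
      also have "\<dots> \<le> ereal k"
        unfolding H_norm_def
        using borel_measurable_H_grad[OF openW vlip continuous_H] H_grad_cone_le[OF k, of x0 c]
        by (intro esssup_I) (auto simp: v_def[abs_def])
      finally have norm_u: "H_norm H W u \<le> ereal k" .
      define N where "N = {x \<in> W. \<not> ereal (H (grad u x)) \<le> H_norm H W u}"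
      have N: "negligible N"
        unfolding N_def H_norm_def by (rule negligible_iff_AE_lebesgue_on[OF openW esssup_AE])
      have seg: "u q - u p \<le> cone H k (q - p)" if "closed_segment p q \<subseteq> W" for p q
      proof (rule segment_increment_le_AE[OF openW lip_loc_mono[OF _ lip] N _ that])
        show "W \<subseteq> U" using WV VU by blast
        fix y assume "y \<in> W - N"
        then have "ereal (H (grad u y)) \<le> H_norm H W u" by (simp add: N_def)
        then have "ereal (H (grad u y)) \<le> ereal k" using norm_u by (rule order_trans)
        then show "(q - p) \<bullet> grad u y \<le> cone H k (q - p)" by (subst inner_commute) (simp add: cone_upper)
      qed
      \<comment> \<open>The ray from \<open>a\<close> to the vertex must leave \<open>W\<close>,
        because the vertex is outside \<open>V\<close>; t is the first exit time.\<close>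
      define z where "z = x0 - a"
      define T where "T = {t \<in> {0..1}. a + t *\<^sub>R z \<notin> W}"
      have "T = {0..1} \<inter> (\<lambda>t. a + t *\<^sub>R z) -` (- W)" by (auto simp: T_def)
      then have "compact T"
        using openW by (auto intro!: compact_Int_closed continuous_closed_vimage continuous_intros simp: closed_Compl)
      moreover have "1 \<in> T" using x0 WV by (auto simp: T_def z_def)
      ultimately obtain t where t: "t \<in> T" "\<And>r. r \<in> T \<Longrightarrow> t \<le> r"
        using compact_attains_inf[of T] by blast
      have aW: "a \<in> W" using \<open>a \<in> V\<close> c by (simp add: W_def)
      have t01: "0 < t" "t \<le> 1" using t(1) aW by (cases "t = 0"; auto simp: T_def)+
      have inW: "a + r *\<^sub>R z \<in> W" if "0 \<le> r" "r < t" for r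
        using t(2)[of r] that t01 by (fastforce simp: T_def)
      define b' where "b' = a + t *\<^sub>R z"
      have lim: "((\<lambda>r. a + r *\<^sub>R z) \<longlongrightarrow> b') (at_left t)"
        unfolding b'_def by (intro tendsto_intros)
      have ev: "\<forall>\<^sub>F r in at_left t. 0 \<le> r \<and> r < t"
        using t01(1) unfolding eventually_at_left_field by (intro exI[of _ 0]) auto
      have "b' \<in> closure W"
        using lim by (rule Lim_in_closed_set[rotated 3])
          (use ev inW closure_subset in \<open>auto elim!: eventually_mono\<close>)
      moreover have "b' \<notin> W" using t(1) by (simp add: T_def b'_def)
      ultimately have "b' \<in> frontier W" using openW by (simp add: frontier_def interior_open)
      then have fb: "u b' = cone H k (b' - x0) + c" using fr by fastforce
      \<comment> \<open>The exit point itself is not in \<open>W\<close>, so the increment bound is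
        applied on shorter segments and passed to the limit.\<close>
      have "u a - u b' \<le> cone H k (a - b')"
      proof (rule tendsto_le)
        have "isCont u b'"
          using cont open_U clW clU \<open>b' \<in> closure W\<close> continuous_on_eq_continuous_at by blast
        then have "((\<lambda>r. u (a + r *\<^sub>R z)) \<longlongrightarrow> u b') (at_left t)"
          using lim isCont_tendsto_compose by blast
        then show "((\<lambda>r. u a - u (a + r *\<^sub>R z)) \<longlongrightarrow> u a - u b') (at_left t)"
          by (intro tendsto_intros)
        have "isCont (cone H k) (a - b')"
          using continuous_cone[OF k, of UNIV] by (simp add: continuous_on_eq_continuous_at)
        moreover have "((\<lambda>r. a - (a + r *\<^sub>R z)) \<longlongrightarrow> a - b') (at_left t)"
          by (intro tendsto_intros lim)
        ultimately show "((\<lambda>r. cone H k (a - (a + r *\<^sub>R z))) \<longlongrightarrow> cone H k (a - b')) (at_left t)"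
          by (rule isCont_tendsto_compose)
        show "\<forall>\<^sub>F r in at_left t. u a - u (a + r *\<^sub>R z) \<le> cone H k (a - (a + r *\<^sub>R z))"
          using ev
        proof eventually_elim
          case (elim r)
          have "closed_segment (a + r *\<^sub>R z) a \<subseteq> W"
          proof
            fix y assume "y \<in> closed_segment (a + r *\<^sub>R z) a"
            then obtain l where l: "0 \<le> l" "l \<le> 1" "y = (1 - l) *\<^sub>R (a + r *\<^sub>R z) + l *\<^sub>R a"
              by (auto simp: in_segment)
            then have "y = a + ((1 - l) * r) *\<^sub>R z" by (simp add: algebra_simps)
            moreover have "(1 - l) * r \<le> 1 * r" using l elim by (intro mult_right_mono) auto
            ultimately show "y \<in> W" using inW[of "(1 - l) * r"] l elim by simp
          qed
          then show ?case by (rule seg)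
        qed
      qed simp
      \<comment> \<open>Along a ray from the vertex the cone is additive, so the bounds before and
        after the exit point add up to u a - C_k(a - x0) \<le> c.\<close>
      moreover have "cone H k (b' - x0) + cone H k (a - b') = cone H k (a - x0)"
      proof -
        have e: "b' - x0 = (1 - t) *\<^sub>R (a - x0)" "a - b' = t *\<^sub>R (a - x0)"
          by (simp_all add: b'_def z_def algebra_simps)
        show ?thesis
          using cone_scaleR[OF k, of "1 - t" "a - x0"] cone_scaleR[OF k, of t "a - x0"] t01
          unfolding e by (simp add: left_diff_distrib)
      qed
      ultimately have "?f a \<le> c" using fb by simp
      with c(2) show False by simp
    qed
    then have "?f a = ?f b" using a(2)[of b] b(1) fsub by fastforce
    moreover have "max_on (closure V) ?f = ?f a" using a by (rule max_on_eq)
    moreover have "max_on (frontier V) ?f = ?f b" using b by (rule max_on_eq)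
    ultimately show ?thesis by simp
  qed simp
qed

end

theorem theorem4p8:
  fixes H :: "'a::euclidean_space \<Rightarrow> real" and U :: "'a set" and u :: "'a \<Rightarrow> real"
  assumes "convex_on UNIV H"
    and "H 0 = 0" and "\<forall>p. 0 \<le> H p"
    and "bounded {p. H p = 0}" and "interior {p. H p = 0} = {}"
    and "open U" and "bounded (u ` U)"
  shows "(absolutely_subminimizing H U u \<longleftrightarrow> comparison_with_cones_above H U u) \<and>
    (comparison_with_cones_above H U u \<longleftrightarrow> convexity_criterion H U u) \<and>
    (convexity_criterion H U u \<longleftrightarrow> pointwise_convexity_criterion H U u)"
proof -
  obtain M where "\<And>x. x \<in> U \<Longrightarrow> \<bar>u x\<bar> \<le> M"
    using assms(7) unfolding bounded_iff by auto
  then interpret bounded_flow H U u M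
    using assms by unfold_locales auto
  show ?thesis
    using subminimizing_imp_comparison comparison_imp_convexity convexity_imp_pointwise
      pointwise_imp_subminimizing by blast
qed

end
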